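(* Let $\mathcal{R}$ be the Ruperthedron defined in the context. Then: (1) $\mathcal{R}$ has Rupert's property and its Nieuwland number is at least $1.003$; (2) there is no $(\theta_1,\varphi_1,\theta_2,\varphi_2,\alpha)\in\mathbb{R}^5$ with $|\theta_1-\theta_2|,|\varphi_1-\varphi_2|,|\alpha|\le 0.0006$ such that $R(\alpha)M(\theta_1,\varphi_1)\mathcal{R}\subset\operatorname{int}\operatorname{conv}(M(\theta_2,\varphi_2)\mathcal{R})$. In particular, $\mathcal{R}$ has Rupert's property but is not locally Rupert.
   Context: For $\alpha,\theta,\varphi\in\mathbb{R}$ let $R(\alpha)=\begin{pmatrix}\cos\alpha&-\sin\alpha\\ \sin\alpha&\cos\alpha\end{pmatrix}$ and $M(\theta,\varphi)=\begin{pmatrix}-\sin\theta&\cos\theta&0\\ -\cos\theta\cos\varphi&-\sin\theta\cos\varphi&\sin\varphi\end{pmatrix}$; matrices act on finite point sets elementwise. A pointsymmetric polyhedron (finite non-degenerate set $\mathcal{P}\subset\mathbb{R}^3$ in convex position with $\mathcal{P}=-\mathcal{P}$) has Rupert's property if there exist $\theta_1,\theta_2\in[0,2\pi)$, $\varphi_1,\varphi_2\in[0,\pi]$, $\alpha\in[-\pi,\pi)$ with $R(\alpha)M(\theta_1,\varphi_1)\mathcal{P}\subset\operatorname{int}\operatorname{conv}(M(\theta_2,\varphi_2)\mathcal{P})$ (such a tuple is called a solution to Rupert's condition). Its Nieuwland number is the supremum of all $s>0$ for which there exist such parameters with $s\,R(\alpha)M(\theta_1,\varphi_1)\mathcal{P}\subset\operatorname{int}\operatorname{conv}(M(\theta_2,\varphi_2)\mathcal{P})$.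 $\mathcal{P}$ is locally Rupert if for every $\varepsilon>0$ there is a solution to Rupert's condition with $|\theta_1-\theta_2|,|\varphi_1-\varphi_2|,|\alpha|\le\varepsilon$. Let $R_z(\beta)=\begin{pmatrix}\cos\beta&-\sin\beta&0\\ \sin\beta&\cos\beta&0\\0&0&1\end{pmatrix}$, $\mathcal{C}_{30}=\{(-1)^\ell R_z(2\pi k/15): k=0,\dots,14,\ \ell=0,1\}$, and $D_1=\frac{1}{5861}(3939,0,4340)^t$, $D_2=10^{-4}(7855,4178,4484)^t$, $D_3=10^{-4}(9526,2057,1102)^t$. The Ruperthedron is $\mathcal{R}=\mathcal{C}_{30}D_1\cup\mathcal{C}_{30}D_2\cup\mathcal{C}_{30}D_3$. *)

theory Defs
  imports "HOL-Analysis.Analysis"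
begin

definition rot2 :: "real \<Rightarrow> real^2 \<Rightarrow> real^2" where
  "rot2 \<alpha> q = vector [cos \<alpha> * q$1 - sin \<alpha> * q$2, sin \<alpha> * q$1 + cos \<alpha> * q$2]"

definition projM :: "real \<Rightarrow> real \<Rightarrow> real^3 \<Rightarrow> real^2" where
  "projM \<theta> \<phi> p = vector
     [ - sin \<theta> * p$1 + cos \<theta> * p$2,
       - cos \<theta> * cos \<phi> * p$1 - sin \<theta> * cos \<phi> * p$2 + sin \<phi> * p$3]"

definition rotz :: "real \<Rightarrow> real^3 \<Rightarrow> real^3" where
  "rotz \<beta> p = vector [cos \<beta> * p$1 - sin \<beta> * p$2, sin \<beta> * p$1 + cos \<beta> * p$2, p$3]"

definition rupert_cond :: "real \<Rightarrow> (real^3) set \<Rightarrow> real \<Rightarrow> real \<Rightarrow> real \<Rightarrow> real \<Rightarrow> real \<Rightarrow> bool" where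
  "rupert_cond s P \<theta>\<^sub>1 \<phi>\<^sub>1 \<theta>\<^sub>2 \<phi>\<^sub>2 \<alpha> \<longleftrightarrow>
     (\<lambda>p. s *\<^sub>R rot2 \<alpha> (projM \<theta>\<^sub>1 \<phi>\<^sub>1 p)) ` P \<subseteq> interior (convex hull (projM \<theta>\<^sub>2 \<phi>\<^sub>2 ` P))"

definition in_param_range :: "real \<Rightarrow> real \<Rightarrow> real \<Rightarrow> real \<Rightarrow> real \<Rightarrow> bool" where
  "in_param_range \<theta>\<^sub>1 \<phi>\<^sub>1 \<theta>\<^sub>2 \<phi>\<^sub>2 \<alpha> \<longleftrightarrow>
     \<theta>\<^sub>1 \<in> {0..<2*pi} \<and> \<theta>\<^sub>2 \<in> {0..<2*pi} \<and> \<phi>\<^sub>1 \<in> {0..pi} \<and> \<phi>\<^sub>2 \<in> {0..pi} \<and> \<alpha> \<in> {-pi..<pi}"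

definition rupert_solution :: "(real^3) set \<Rightarrow> real \<Rightarrow> real \<Rightarrow> real \<Rightarrow> real \<Rightarrow> real \<Rightarrow> bool" where
  "rupert_solution P \<theta>\<^sub>1 \<phi>\<^sub>1 \<theta>\<^sub>2 \<phi>\<^sub>2 \<alpha> \<longleftrightarrow>
     in_param_range \<theta>\<^sub>1 \<phi>\<^sub>1 \<theta>\<^sub>2 \<phi>\<^sub>2 \<alpha> \<and> rupert_cond 1 P \<theta>\<^sub>1 \<phi>\<^sub>1 \<theta>\<^sub>2 \<phi>\<^sub>2 \<alpha>"

definition rupert :: "(real^3) set \<Rightarrow> bool" where
  "rupert P \<longleftrightarrow> (\<exists>\<theta>\<^sub>1 \<phi>\<^sub>1 \<theta>\<^sub>2 \<phi>\<^sub>2 \<alpha>. rupert_solution P \<theta>\<^sub>1 \<phi>\<^sub>1 \<theta>\<^sub>2 \<phi>\<^sub>2 \<alpha>)"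

definition nieuwland_number :: "(real^3) set \<Rightarrow> real" where
  "nieuwland_number P = Sup {s. s > 0 \<and> (\<exists>\<theta>\<^sub>1 \<phi>\<^sub>1 \<theta>\<^sub>2 \<phi>\<^sub>2 \<alpha>.
      in_param_range \<theta>\<^sub>1 \<phi>\<^sub>1 \<theta>\<^sub>2 \<phi>\<^sub>2 \<alpha> \<and> rupert_cond s P \<theta>\<^sub>1 \<phi>\<^sub>1 \<theta>\<^sub>2 \<phi>\<^sub>2 \<alpha>)}"

definition locally_rupert :: "(real^3) set \<Rightarrow> bool" where
  "locally_rupert P \<longleftrightarrow> (\<forall>\<epsilon>>0. \<exists>\<theta>\<^sub>1 \<phi>\<^sub>1 \<theta>\<^sub>2 \<phi>\<^sub>2 \<alpha>. rupert_solution P \<theta>\<^sub>1 \<phi>\<^sub>1 \<theta>\<^sub>2 \<phi>\<^sub>2 \<alpha> \<and>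
      \<bar>\<theta>\<^sub>1 - \<theta>\<^sub>2\<bar> \<le> \<epsilon> \<and> \<bar>\<phi>\<^sub>1 - \<phi>\<^sub>2\<bar> \<le> \<epsilon> \<and> \<bar>\<alpha>\<bar> \<le> \<epsilon>)"

definition D1 :: "real^3" where "D1 = vector [3939/5861, 0, 4340/5861]"
definition D2 :: "real^3" where "D2 = vector [7855/10000, 4178/10000, 4484/10000]"
definition D3 :: "real^3" where "D3 = vector [9526/10000, 2057/10000, 1102/10000]"

definition ruperthedron :: "(real^3) set" where
  "ruperthedron = {((-1) ^ l) *\<^sub>R rotz (2 * pi * real k / 15) D | k l D.
      k \<in> {0..14::nat} \<and> l \<in> {0..1::nat} \<and> D \<in> {D1, D2, D3}}"

end

theory Submission
  imports Defs
begin

text \<open>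
  Let a shadow be taken in direction \<open>X\<close>, and let \<open>P\<close> be a vertex whose image is, in the shadow, locally
  farthest from the origin. After a small change of the parameters the image of \<open>P\<close> can lie in the
  interior of the old shadow only if it has moved closer to the origin, that is, only if \<open>\<bar>X \<bullet> P\<bar>\<close> has
  increased. If \<open>X\<close> is a nonnegative combination of three such vertices with \<open>X \<bullet> P > 0\<close>, this cannot
  happen for all three at once. Being locally farthest is expressed by quadratic forms in \<open>X\<close>, one for each
  neighbour of \<open>P\<close>, and a quadratic form is nonnegative on a simplicial cone if its coefficients in the
  generators are. Modulo the symmetry group, all directions lie in one simplicial cone, which is subdivided
  until in each part three suitable vertices are found; the resulting certificate is checked in integer
  arithmetic with the vertices rounded to multiples of \<open>10 ^ -5\<close>.

  For the first part, rational sines and cosines are chosen near a numerically found solution, and every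
  vertex of the inner shadow is located in an open triangle spanned by vertices of the outer one.
\<close>

section \<open>Sines and cosines of multiples of 24 degrees\<close>

text \<open>Projection along a unit vector X leaves the squared length |P|^2 - (X . P)^2, so a
  shorter image of P means a larger |X . P|. If Y is the new direction and Y . P > X . P for three
  vertices of which X is a nonnegative combination, then pairing this combination with Y and with X
  gives Y . X > X . X = 1, against Cauchy-Schwarz. Since -P is a vertex along with P, asking for X .
  P > 0 is no loss. The obstacle is that the neighbourhood has a fixed size: three parameters, each
  changed by up to 0.0006, move the image of a point of the unit ball by up to 0.0018. Being locally
  farthest must therefore hold with a definite margin, uniformly over all directions; the numerical
  checks ask for slightly more, which absorbs the rounding. The exception is the top face: its
  vertices are coplanar, a determinant vanishes exactly, and trigonometric identities replace the
  numbers. The Nieuwland number brings an obligation of its own: membership of 1.003 bounds the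
  supremum from below only once the set of scales is known to be bounded above.\<close>

lemma cos_pi_fifth: "cos (pi / 5) = (1 + sqrt 5) / 4"
proof -
  define x where "x = cos (pi / 5)"
  have pos: "x > 0"
    unfolding x_def by (rule cos_gt_zero) (use pi_gt_zero in auto)
  \<comment> \<open>The angles \<open>3 * (pi / 5)\<close> and \<open>2 * (pi / 5)\<close> are
    supplementary, so the triple and double angle formulas give a cubic equation for
    \<open>x\<close>. Its root -1 is excluded by positivity, and completing the square solves the
    remaining quadratic.\<close>
  have "cos (3 * (pi / 5)) = cos (pi - 2 * (pi / 5))"
    by (rule arg_cong[where f = cos]) simp
  also have "\<dots> = - cos (2 * (pi / 5))"
    by (rule cos_pi_minus)
  finally have "4 * x ^ 3 - 3 * x = - (2 * x\<^sup>2 - 1)"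
    unfolding x_def by (simp only: cos_treble_cos cos_double_cos)
  then have "(x + 1) * ((4 * x - 1)\<^sup>2 - 5) = 0"
    by algebra
  with pos have sq: "(4 * x - 1)\<^sup>2 = 5"
    by auto
  then have "\<bar>4 * x - 1\<bar> = sqrt 5"
    by (metis real_sqrt_abs)
  moreover have "4 * x - 1 \<noteq> - sqrt 5"
  proof
    assume "4 * x - 1 = - sqrt 5"
    moreover have "1 < sqrt (5::real)" by simp
    ultimately show False using pos by linarith
  qed
  ultimately have "4 * x - 1 = sqrt 5"
    by linarith
  then show ?thesis
    by (simp add: x_def)
qed

definition cos15 :: "int \<Rightarrow> real" where "cos15 k = cos (2 * pi * real_of_int k / 15)"
definition sin15 :: "int \<Rightarrow> real" where "sin15 k = sin (2 * pi * real_of_int k / 15)"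

text \<open>24 degrees are 60 minus 36 degrees, so both values are expressed through
  \<open>sqrt 3\<close> and \<open>sqrt 5\<close>. The high accuracy is consumed by the recursion
  that follows.\<close>

lemma cos15_sin15_one:
  "\<bar>cos15 1 - 0.91354545764\<bar> \<le> 1 / 10 ^ 10" "\<bar>sin15 1 - 0.40673664308\<bar> \<le> 1 / 10 ^ 10"
proof -
  have s5: "2.236067977499 \<le> sqrt 5" "sqrt 5 \<le> 2.236067977500"
    by (rule real_le_rsqrt real_le_lsqrt; simp add: power2_eq_square)+
  have s3: "1.732050807568 \<le> sqrt 3" "sqrt 3 \<le> 1.732050807569"
    by (rule real_le_rsqrt real_le_lsqrt; simp add: power2_eq_square)+
  define x where "x = cos (pi / 5)"
  define y where "y = sin (pi / 5)"
  have x: "0.80901699437475 \<le> x" "x \<le> 0.809016994375"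
    using s5 by (auto simp: x_def cos_pi_fifth)
  have y0: "0 \<le> y"
    unfolding y_def by (intro sin_ge_zero) (use pi_gt_zero in auto)
  have "y\<^sup>2 = 1 - x\<^sup>2"
    by (simp add: x_def y_def sin_squared_eq)
  moreover have "0.80901699437475\<^sup>2 \<le> x\<^sup>2" "x\<^sup>2 \<le> 0.809016994375\<^sup>2"
    using x by (auto intro!: power_mono)
  ultimately have ysq: "0.587785252291\<^sup>2 \<le> y\<^sup>2" "y\<^sup>2 \<le> 0.587785252294\<^sup>2"
    by (simp_all add: power2_eq_square)
  have y: "0.587785252291 \<le> y" "y \<le> 0.587785252294"
    using power2_le_imp_le[OF ysq(1) y0] power2_le_imp_le[OF ysq(2)] by simp_all
  have ang: "2 * pi * real_of_int 1 / 15 = pi / 3 - pi / 5"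
    by simp
  define u where "u = sqrt 3 * y"
  define w where "w = sqrt 3 * x"
  have c: "cos15 1 = x / 2 + u / 2"
    unfolding cos15_def ang cos_diff by (simp add: cos_60 sin_60 x_def y_def u_def)
  have s: "sin15 1 = w / 2 - y / 2"
    unfolding sin15_def ang sin_diff by (simp add: cos_60 sin_60 x_def y_def w_def)
  have "1.732050807568 * 0.587785252291 \<le> u" "u \<le> 1.732050807569 * 0.587785252294"
    "1.732050807568 * 0.80901699437475 \<le> w" "w \<le> 1.732050807569 * 0.809016994375"
    unfolding u_def w_def by (intro mult_mono; use s3 x y in simp)+
  then show "\<bar>cos15 1 - 0.91354545764\<bar> \<le> 1 / 10 ^ 10" "\<bar>sin15 1 - 0.40673664308\<bar> \<le> 1 / 10 ^ 10"
    using x y unfolding c s abs_le_iff by simp_all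
qed

lemma cos15_sin15_add:
  "cos15 (j + k) = cos15 j * cos15 k - sin15 j * sin15 k"
  "sin15 (j + k) = sin15 j * cos15 k + cos15 j * sin15 k"
  by (simp_all add: cos15_def sin15_def distrib_left add_divide_distrib cos_add sin_add)

lemma cos15_sin15_diff_15: "cos15 (15 - k) = cos15 k" "sin15 (15 - k) = - sin15 k"
proof -
  have eq: "2 * pi * real_of_int (15 - k) / 15 = 2 * pi - 2 * pi * real_of_int k / 15"
    by (simp add: field_simps)
  show "cos15 (15 - k) = cos15 k" "sin15 (15 - k) = - sin15 k"
    unfolding cos15_def sin15_def eq by simp_all
qed

lemma product_error:
  fixes x c a b :: real
  assumes "\<bar>x - c\<bar> \<le> e" "\<bar>a - b\<bar> \<le> d" "\<bar>c\<bar> \<le> 1" "\<bar>a\<bar> \<le> m"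
  shows "\<bar>x * a - c * b\<bar> \<le> e * m + d"
proof -
  have "x * a - c * b = (x - c) * a + c * (a - b)"
    by (simp add: algebra_simps)
  also have "\<bar>\<dots>\<bar> \<le> \<bar>x - c\<bar> * \<bar>a\<bar> + \<bar>c\<bar> * \<bar>a - b\<bar>"
    by (metis abs_mult abs_triangle_ineq)
  also have "\<dots> \<le> e * m + 1 * d"
    using assms by (intro add_mono mult_mono) auto
  finally show ?thesis by simp
qed

text \<open>Angle addition multiplies an incoming error by at most 0.92 + 0.41 = 1.33, the bounds
  for \<open>cos15 1\<close> and \<open>sin15 1\<close>. The summand \<open>2 / 10 ^ 9\<close>
  covers the error of these two values and the rounding of the new decimals.\<close>

lemma cos15_sin15_step:
  assumes "\<bar>cos15 k - c\<bar> \<le> e" "\<bar>sin15 k - s\<bar> \<le> e" "\<bar>c\<bar> \<le> 1" "\<bar>s\<bar> \<le> 1"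
    and "\<bar>c * 0.91354545764 - s * 0.40673664308 - c'\<bar> \<le> 1 / 10 ^ 9"
    and "\<bar>s * 0.91354545764 + c * 0.40673664308 - s'\<bar> \<le> 1 / 10 ^ 9"
  shows "\<bar>cos15 (k + 1) - c'\<bar> \<le> 1.33 * e + 2 / 10 ^ 9 \<and> \<bar>sin15 (k + 1) - s'\<bar> \<le> 1.33 * e + 2 / 10 ^ 9"
proof -
  have m: "\<bar>cos15 1\<bar> \<le> 0.92" "\<bar>sin15 1\<bar> \<le> 0.41"
    using cos15_sin15_one unfolding abs_le_iff by simp_all
  note e1 = product_error[OF assms(1) cos15_sin15_one(1) assms(3) m(1)]
    and e2 = product_error[OF assms(2) cos15_sin15_one(2) assms(4) m(2)]
    and e3 = product_error[OF assms(2) cos15_sin15_one(1) assms(4) m(1)]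
    and e4 = product_error[OF assms(1) cos15_sin15_one(2) assms(3) m(2)]
  show ?thesis
    using e1 e2 e3 e4 assms(5,6) unfolding cos15_sin15_add abs_le_iff
    by (simp add: algebra_simps)
qed

text \<open>The error recursion runs only up to index 7, where the bound is
  \<open>3859 / 10 ^ 11\<close>; the remaining values follow by the reflection
  \<open>15 - k\<close>. Run through all indices, the recursion would exceed
  \<open>1 / 10 ^ 7\<close>.\<close>

lemma cos15_sin15_bounds:
  "\<bar>cos15 0 - (1.0000000000)\<bar> \<le> 1 / 10 ^ 7" "\<bar>sin15 0 - (0.0000000000)\<bar> \<le> 1 / 10 ^ 7"
  "\<bar>cos15 1 - (0.9135454576)\<bar> \<le> 1 / 10 ^ 7" "\<bar>sin15 1 - (0.4067366431)\<bar> \<le> 1 / 10 ^ 7"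
  "\<bar>cos15 2 - (0.6691306064)\<bar> \<le> 1 / 10 ^ 7" "\<bar>sin15 2 - (0.7431448255)\<bar> \<le> 1 / 10 ^ 7"
  "\<bar>cos15 3 - (0.3090169944)\<bar> \<le> 1 / 10 ^ 7" "\<bar>sin15 3 - (0.9510565163)\<bar> \<le> 1 / 10 ^ 7"
  "\<bar>cos15 4 - (- 0.1045284633)\<bar> \<le> 1 / 10 ^ 7" "\<bar>sin15 4 - (0.9945218954)\<bar> \<le> 1 / 10 ^ 7"
  "\<bar>cos15 5 - (- 0.5000000000)\<bar> \<le> 1 / 10 ^ 7" "\<bar>sin15 5 - (0.8660254038)\<bar> \<le> 1 / 10 ^ 7"
  "\<bar>cos15 6 - (- 0.8090169944)\<bar> \<le> 1 / 10 ^ 7" "\<bar>sin15 6 - (0.5877852523)\<bar> \<le> 1 / 10 ^ 7"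
  "\<bar>cos15 7 - (- 0.9781476007)\<bar> \<le> 1 / 10 ^ 7" "\<bar>sin15 7 - (0.2079116908)\<bar> \<le> 1 / 10 ^ 7"
  "\<bar>cos15 8 - (- 0.9781476007)\<bar> \<le> 1 / 10 ^ 7" "\<bar>sin15 8 - (- 0.2079116908)\<bar> \<le> 1 / 10 ^ 7"
  "\<bar>cos15 9 - (- 0.8090169944)\<bar> \<le> 1 / 10 ^ 7" "\<bar>sin15 9 - (- 0.5877852523)\<bar> \<le> 1 / 10 ^ 7"
  "\<bar>cos15 10 - (- 0.5000000000)\<bar> \<le> 1 / 10 ^ 7" "\<bar>sin15 10 - (- 0.8660254038)\<bar> \<le> 1 / 10 ^ 7"
  "\<bar>cos15 11 - (- 0.1045284633)\<bar> \<le> 1 / 10 ^ 7" "\<bar>sin15 11 - (- 0.9945218954)\<bar> \<le> 1 / 10 ^ 7"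
  "\<bar>cos15 12 - (0.3090169944)\<bar> \<le> 1 / 10 ^ 7" "\<bar>sin15 12 - (- 0.9510565163)\<bar> \<le> 1 / 10 ^ 7"
  "\<bar>cos15 13 - (0.6691306064)\<bar> \<le> 1 / 10 ^ 7" "\<bar>sin15 13 - (- 0.7431448255)\<bar> \<le> 1 / 10 ^ 7"
  "\<bar>cos15 14 - (0.9135454576)\<bar> \<le> 1 / 10 ^ 7" "\<bar>sin15 14 - (- 0.4067366431)\<bar> \<le> 1 / 10 ^ 7"
proof -
  have b0: "\<bar>cos15 0 - 1\<bar> \<le> 0" "\<bar>sin15 0 - 0\<bar> \<le> 0"
    by (simp_all add: cos15_def sin15_def)
  have b1: "\<bar>cos15 1 - (0.9135454576)\<bar> \<le> 200 / 10 ^ 11" "\<bar>sin15 1 - (0.4067366431)\<bar> \<le> 200 / 10 ^ 11"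
    using cos15_sin15_step[OF b0, of "0.9135454576" "0.4067366431"] by simp_all
  have b2: "\<bar>cos15 2 - (0.6691306064)\<bar> \<le> 466 / 10 ^ 11" "\<bar>sin15 2 - (0.7431448255)\<bar> \<le> 466 / 10 ^ 11"
    using cos15_sin15_step[OF b1, of "0.6691306064" "0.7431448255"] by simp_all
  have b3: "\<bar>cos15 3 - (0.3090169944)\<bar> \<le> 820 / 10 ^ 11" "\<bar>sin15 3 - (0.9510565163)\<bar> \<le> 820 / 10 ^ 11"
    using cos15_sin15_step[OF b2, of "0.3090169944" "0.9510565163"] by simp_all
  have b4: "\<bar>cos15 4 - (- 0.1045284633)\<bar> \<le> 1291 / 10 ^ 11" "\<bar>sin15 4 - (0.9945218954)\<bar> \<le> 1291 / 10 ^ 11"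
    using cos15_sin15_step[OF b3, of "- 0.1045284633" "0.9945218954"] by simp_all
  have b5: "\<bar>cos15 5 - (- 0.5000000000)\<bar> \<le> 1918 / 10 ^ 11" "\<bar>sin15 5 - (0.8660254038)\<bar> \<le> 1918 / 10 ^ 11"
    using cos15_sin15_step[OF b4, of "- 0.5000000000" "0.8660254038"] by simp_all
  have b6: "\<bar>cos15 6 - (- 0.8090169944)\<bar> \<le> 2751 / 10 ^ 11" "\<bar>sin15 6 - (0.5877852523)\<bar> \<le> 2751 / 10 ^ 11"
    using cos15_sin15_step[OF b5, of "- 0.8090169944" "0.5877852523"] by simp_all
  have b7: "\<bar>cos15 7 - (- 0.9781476007)\<bar> \<le> 3859 / 10 ^ 11" "\<bar>sin15 7 - (0.2079116908)\<bar> \<le> 3859 / 10 ^ 11"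
    using cos15_sin15_step[OF b6, of "- 0.9781476007" "0.2079116908"] by simp_all
  show "\<bar>cos15 0 - (1.0000000000)\<bar> \<le> 1 / 10 ^ 7"
    using b0 by simp
  show "\<bar>sin15 0 - (0.0000000000)\<bar> \<le> 1 / 10 ^ 7"
    using b0 by simp
  show "\<bar>cos15 1 - (0.9135454576)\<bar> \<le> 1 / 10 ^ 7"
    using b1 by simp
  show "\<bar>sin15 1 - (0.4067366431)\<bar> \<le> 1 / 10 ^ 7"
    using b1 by simp
  show "\<bar>cos15 2 - (0.6691306064)\<bar> \<le> 1 / 10 ^ 7"
    using b2 by simp
  show "\<bar>sin15 2 - (0.7431448255)\<bar> \<le> 1 / 10 ^ 7"
    using b2 by simp
  show "\<bar>cos15 3 - (0.3090169944)\<bar> \<le> 1 / 10 ^ 7"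
    using b3 by simp
  show "\<bar>sin15 3 - (0.9510565163)\<bar> \<le> 1 / 10 ^ 7"
    using b3 by simp
  show "\<bar>cos15 4 - (- 0.1045284633)\<bar> \<le> 1 / 10 ^ 7"
    using b4 by simp
  show "\<bar>sin15 4 - (0.9945218954)\<bar> \<le> 1 / 10 ^ 7"
    using b4 by simp
  show "\<bar>cos15 5 - (- 0.5000000000)\<bar> \<le> 1 / 10 ^ 7"
    using b5 by simp
  show "\<bar>sin15 5 - (0.8660254038)\<bar> \<le> 1 / 10 ^ 7"
    using b5 by simp
  show "\<bar>cos15 6 - (- 0.8090169944)\<bar> \<le> 1 / 10 ^ 7"
    using b6 by simp
  show "\<bar>sin15 6 - (0.5877852523)\<bar> \<le> 1 / 10 ^ 7"
    using b6 by simp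
  show "\<bar>cos15 7 - (- 0.9781476007)\<bar> \<le> 1 / 10 ^ 7"
    using b7 by simp
  show "\<bar>sin15 7 - (0.2079116908)\<bar> \<le> 1 / 10 ^ 7"
    using b7 by simp
  show "\<bar>cos15 8 - (- 0.9781476007)\<bar> \<le> 1 / 10 ^ 7"
    using b7 cos15_sin15_diff_15[of 7] unfolding abs_le_iff by simp
  show "\<bar>sin15 8 - (- 0.2079116908)\<bar> \<le> 1 / 10 ^ 7"
    using b7 cos15_sin15_diff_15[of 7] unfolding abs_le_iff by simp
  show "\<bar>cos15 9 - (- 0.8090169944)\<bar> \<le> 1 / 10 ^ 7"
    using b6 cos15_sin15_diff_15[of 6] unfolding abs_le_iff by simp
  show "\<bar>sin15 9 - (- 0.5877852523)\<bar> \<le> 1 / 10 ^ 7"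
    using b6 cos15_sin15_diff_15[of 6] unfolding abs_le_iff by simp
  show "\<bar>cos15 10 - (- 0.5000000000)\<bar> \<le> 1 / 10 ^ 7"
    using b5 cos15_sin15_diff_15[of 5] unfolding abs_le_iff by simp
  show "\<bar>sin15 10 - (- 0.8660254038)\<bar> \<le> 1 / 10 ^ 7"
    using b5 cos15_sin15_diff_15[of 5] unfolding abs_le_iff by simp
  show "\<bar>cos15 11 - (- 0.1045284633)\<bar> \<le> 1 / 10 ^ 7"
    using b4 cos15_sin15_diff_15[of 4] unfolding abs_le_iff by simp
  show "\<bar>sin15 11 - (- 0.9945218954)\<bar> \<le> 1 / 10 ^ 7"
    using b4 cos15_sin15_diff_15[of 4] unfolding abs_le_iff by simp
  show "\<bar>cos15 12 - (0.3090169944)\<bar> \<le> 1 / 10 ^ 7"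
    using b3 cos15_sin15_diff_15[of 3] unfolding abs_le_iff by simp
  show "\<bar>sin15 12 - (- 0.9510565163)\<bar> \<le> 1 / 10 ^ 7"
    using b3 cos15_sin15_diff_15[of 3] unfolding abs_le_iff by simp
  show "\<bar>cos15 13 - (0.6691306064)\<bar> \<le> 1 / 10 ^ 7"
    using b2 cos15_sin15_diff_15[of 2] unfolding abs_le_iff by simp
  show "\<bar>sin15 13 - (- 0.7431448255)\<bar> \<le> 1 / 10 ^ 7"
    using b2 cos15_sin15_diff_15[of 2] unfolding abs_le_iff by simp
  show "\<bar>cos15 14 - (0.9135454576)\<bar> \<le> 1 / 10 ^ 7"
    using b1 cos15_sin15_diff_15[of 1] unfolding abs_le_iff by simp
  show "\<bar>sin15 14 - (- 0.4067366431)\<bar> \<le> 1 / 10 ^ 7"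
    using b1 cos15_sin15_diff_15[of 1] unfolding abs_le_iff by simp
qed

section \<open>Shadows\<close>

lemma inner_real3: "x \<bullet> y = x$1 * y$1 + x$2 * y$2 + x$3 * y$3" for x y :: "real^3"
  by (simp add: inner_vec_def sum_3)

lemma inner_real2: "x \<bullet> y = x$1 * y$1 + x$2 * y$2" for x y :: "real^2"
  by (simp add: inner_vec_def sum_2)

text \<open>The left side is a squared chord of the unit circle, the right side the squared
  arc.\<close>

lemma two_minus_two_cos_le: "2 - 2 * cos x \<le> x\<^sup>2" for x :: real
proof -
  have "2 - 2 * cos x = 4 * (sin (x / 2))\<^sup>2"
    using cos_double_sin[of "x / 2"] by simp
  also have "\<dots> \<le> 4 * (x / 2)\<^sup>2"
    using abs_sin_x_le_abs_x[of "x / 2"] by (simp only: abs_le_square_iff)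
  finally show ?thesis by (simp add: power_divide)
qed

text \<open>This is the cross product of the two rows of M(\<theta>,\<phi>). With these rows it
  forms an orthonormal basis, so the shadow is the orthogonal projection along it.\<close>

definition view_dir :: "real \<Rightarrow> real \<Rightarrow> real^3" where
  "view_dir \<theta> \<phi> = vector [cos \<theta> * sin \<phi>, sin \<theta> * sin \<phi>, cos \<phi>]"

lemma norm_view_dir [simp]: "norm (view_dir \<theta> \<phi>) = 1"
proof -
  have "(cos \<theta>)\<^sup>2 + (sin \<theta>)\<^sup>2 = 1" "(cos \<phi>)\<^sup>2 + (sin \<phi>)\<^sup>2 = 1"
    by simp_all
  then have "view_dir \<theta> \<phi> \<bullet> view_dir \<theta> \<phi> = 1"
    unfolding view_dir_def inner_real3 vector_3 by algebra
  then show ?thesis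
    by (simp add: norm_eq_sqrt_inner)
qed

lemma inner_projM:
  "projM \<theta> \<phi> p \<bullet> projM \<theta> \<phi> q = p \<bullet> q - (view_dir \<theta> \<phi> \<bullet> p) * (view_dir \<theta> \<phi> \<bullet> q)"
proof -
  have "(cos \<theta>)\<^sup>2 + (sin \<theta>)\<^sup>2 = 1" "(cos \<phi>)\<^sup>2 + (sin \<phi>)\<^sup>2 = 1"
    by simp_all
  then show ?thesis
    unfolding projM_def view_dir_def inner_real2 inner_real3 vector_2 vector_3
    by algebra
qed

lemma linear_projM: "linear (projM \<theta> \<phi>)"
  by (rule linearI) (simp_all add: projM_def vec_eq_iff forall_2 algebra_simps)

lemma linear_rot2: "linear (rot2 \<alpha>)"
  by (rule linearI) (simp_all add: rot2_def vec_eq_iff forall_2 algebra_simps)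

lemma linear_rotz: "linear (rotz \<beta>)"
  by (rule linearI) (simp_all add: rotz_def vec_eq_iff forall_3 algebra_simps)

lemma norm_projM: "(norm (projM \<theta> \<phi> p))\<^sup>2 = (norm p)\<^sup>2 - (view_dir \<theta> \<phi> \<bullet> p)\<^sup>2"
  unfolding power2_norm_eq_inner inner_projM by (simp add: power2_eq_square)

lemma norm_projM_le: "norm (projM \<theta> \<phi> p) \<le> norm p"
  by (rule power2_le_imp_le) (simp_all add: norm_projM)

lemma inner_rotz: "rotz \<beta> p \<bullet> rotz \<beta> q = p \<bullet> q"
proof -
  have "(cos \<beta>)\<^sup>2 + (sin \<beta>)\<^sup>2 = 1"
    by simp
  then show ?thesis
    unfolding rotz_def inner_real3 vector_3 by algebra
qed

lemma rotz_rotz: "rotz \<beta> (rotz \<gamma> p) = rotz (\<beta> + \<gamma>) p"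
  by (simp add: rotz_def vec_eq_iff forall_3 cos_add sin_add algebra_simps)

lemma norm_rot2 [simp]: "norm (rot2 \<alpha> q) = norm q"
proof -
  have "(cos \<alpha>)\<^sup>2 + (sin \<alpha>)\<^sup>2 = 1"
    by simp
  then have "rot2 \<alpha> q \<bullet> rot2 \<alpha> q = q \<bullet> q"
    unfolding rot2_def inner_real2 vector_2 by algebra
  then show ?thesis
    by (simp add: norm_eq_sqrt_inner)
qed

section \<open>Lipschitz dependence of shadows and viewing directions on the parameters\<close>

lemma norm_rot2_diff_le: "norm (rot2 \<alpha> q - q) \<le> \<bar>\<alpha>\<bar> * norm q"
proof (rule power2_le_imp_le)
  have "(cos \<alpha>)\<^sup>2 + (sin \<alpha>)\<^sup>2 = 1"
    by simp
  then have "(norm (rot2 \<alpha> q - q))\<^sup>2 = (2 - 2 * cos \<alpha>) * (norm q)\<^sup>2"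
    unfolding rot2_def power2_norm_eq_inner inner_real2 vector_2 vector_minus_component by algebra
  also have "\<dots> \<le> \<alpha>\<^sup>2 * (norm q)\<^sup>2"
    by (intro mult_right_mono two_minus_two_cos_le) simp
  finally show "(norm (rot2 \<alpha> q - q))\<^sup>2 \<le> (\<bar>\<alpha>\<bar> * norm q)\<^sup>2"
    by (simp add: power_mult_distrib)
qed simp

lemma norm_rotz_diff_le: "norm (rotz \<beta> p - p) \<le> \<bar>\<beta>\<bar> * norm p"
proof (rule power2_le_imp_le)
  have "(cos \<beta>)\<^sup>2 + (sin \<beta>)\<^sup>2 = 1"
    by simp
  then have "(norm (rotz \<beta> p - p))\<^sup>2 = (2 - 2 * cos \<beta>) * ((norm p)\<^sup>2 - (p$3)\<^sup>2)"
    unfolding rotz_def power2_norm_eq_inner inner_real3 vector_3 vector_minus_component by algebra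
  also have "\<dots> \<le> (2 - 2 * cos \<beta>) * (norm p)\<^sup>2"
    by (intro mult_left_mono) simp_all
  also have "\<dots> \<le> \<beta>\<^sup>2 * (norm p)\<^sup>2"
    by (intro mult_right_mono two_minus_two_cos_le) simp
  finally show "(norm (rotz \<beta> p - p))\<^sup>2 \<le> (\<bar>\<beta>\<bar> * norm p)\<^sup>2"
    by (simp add: power_mult_distrib)
qed simp

text \<open>Turning the viewpoint about the vertical axis amounts to turning the solid backwards,
  which reduces changes of the azimuth to \<open>rotz\<close>.\<close>

lemma projM_add_angle: "projM (\<theta> + \<beta>) \<phi> p = projM \<theta> \<phi> (rotz (- \<beta>) p)"
  by (simp add: projM_def rotz_def vec_eq_iff forall_2 cos_add sin_add algebra_simps)

lemma view_dir_add_angle: "view_dir (\<theta> + \<beta>) \<phi> = rotz \<beta> (view_dir \<theta> \<phi>)"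
  by (simp add: view_dir_def rotz_def vec_eq_iff forall_3 cos_add sin_add algebra_simps)

text \<open>Cauchy-Schwarz for the chord between two points of the unit circle, combined with chord
  at most arc.\<close>

lemma cos_sin_diff_bound:
  fixes x y a b :: real
  shows "\<bar>(cos x - cos y) * a + (sin x - sin y) * b\<bar> \<le> \<bar>x - y\<bar> * sqrt (a\<^sup>2 + b\<^sup>2)"
proof -
  have one: "(cos x)\<^sup>2 + (sin x)\<^sup>2 = 1" "(cos y)\<^sup>2 + (sin y)\<^sup>2 = 1"
    by simp_all
  have "((cos x - cos y) * a + (sin x - sin y) * b)\<^sup>2 \<le>
      ((cos x - cos y)\<^sup>2 + (sin x - sin y)\<^sup>2) * (a\<^sup>2 + b\<^sup>2)"
    (is "(?c * a + ?s * b)\<^sup>2 \<le> _")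
  proof -
    have "(?c\<^sup>2 + ?s\<^sup>2) * (a\<^sup>2 + b\<^sup>2) - (?c * a + ?s * b)\<^sup>2 = (?c * b - ?s * a)\<^sup>2"
      by algebra
    then show ?thesis
      by (metis diff_ge_0_iff_ge zero_le_power2)
  qed
  also have "(cos x - cos y)\<^sup>2 + (sin x - sin y)\<^sup>2 = 2 - 2 * cos (x - y)"
    unfolding cos_diff using one by algebra
  also have "(2 - 2 * cos (x - y)) * (a\<^sup>2 + b\<^sup>2) \<le> (x - y)\<^sup>2 * (a\<^sup>2 + b\<^sup>2)"
    by (intro mult_right_mono two_minus_two_cos_le) simp
  finally have "((cos x - cos y) * a + (sin x - sin y) * b)\<^sup>2 \<le> (\<bar>x - y\<bar> * sqrt (a\<^sup>2 + b\<^sup>2))\<^sup>2"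
    by (simp add: power_mult_distrib)
  then have "\<bar>(cos x - cos y) * a + (sin x - sin y) * b\<bar> \<le> \<bar>\<bar>x - y\<bar> * sqrt (a\<^sup>2 + b\<^sup>2)\<bar>"
    by (simp only: abs_le_square_iff)
  then show ?thesis
    by (simp add: abs_mult)
qed

text \<open>The left side is the length of the projection of \<open>p\<close> to the vertical plane
  with azimuth \<theta>, the only part of \<open>p\<close> affected by a change of tilt.\<close>

lemma horizontal_vertical_bound:
  "sqrt ((cos \<theta> * p$1 + sin \<theta> * p$2)\<^sup>2 + (p$3)\<^sup>2) \<le> norm p" for p :: "real^3"
proof -
  have "(cos \<theta>)\<^sup>2 + (sin \<theta>)\<^sup>2 = 1"
    by simp
  then have "p \<bullet> p - ((cos \<theta> * p$1 + sin \<theta> * p$2)\<^sup>2 + (p$3)\<^sup>2) = (sin \<theta> * p$1 - cos \<theta> * p$2)\<^sup>2"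
    unfolding inner_real3 by algebra
  then have "(cos \<theta> * p$1 + sin \<theta> * p$2)\<^sup>2 + (p$3)\<^sup>2 \<le> p \<bullet> p"
    by (metis diff_ge_0_iff_ge zero_le_power2)
  then show ?thesis
    by (simp add: norm_eq_sqrt_inner)
qed

lemma norm_projM_diff_tilt: "norm (projM \<theta> \<phi> p - projM \<theta> \<phi>' p) \<le> \<bar>\<phi> - \<phi>'\<bar> * norm p"
proof -
  define h where "h = cos \<theta> * p$1 + sin \<theta> * p$2"
  have "projM \<theta> \<phi> p - projM \<theta> \<phi>' p =
      vector [0, (cos \<phi> - cos \<phi>') * (- h) + (sin \<phi> - sin \<phi>') * p$3]"
    by (simp add: projM_def h_def vec_eq_iff forall_2 algebra_simps)
  then have "norm (projM \<theta> \<phi> p - projM \<theta> \<phi>' p) = \<bar>(cos \<phi> - cos \<phi>') * (- h) + (sin \<phi> - sin \<phi>') * p$3\<bar>"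
    by (simp add: norm_eq_sqrt_inner inner_real2 flip: power2_eq_square)
  also have "\<dots> \<le> \<bar>\<phi> - \<phi>'\<bar> * sqrt (h\<^sup>2 + (p$3)\<^sup>2)"
    using cos_sin_diff_bound[of \<phi> \<phi>' "- h" "p$3"] by simp
  also have "\<dots> \<le> \<bar>\<phi> - \<phi>'\<bar> * norm p"
    unfolding h_def by (intro mult_left_mono horizontal_vertical_bound) simp
  finally show ?thesis .
qed

lemma view_dir_diff_tilt: "\<bar>view_dir \<theta> \<phi> \<bullet> p - view_dir \<theta> \<phi>' \<bullet> p\<bar> \<le> \<bar>\<phi> - \<phi>'\<bar> * norm p"
proof -
  define h where "h = cos \<theta> * p$1 + sin \<theta> * p$2"
  have "view_dir \<theta> \<phi> \<bullet> p - view_dir \<theta> \<phi>' \<bullet> p = (cos \<phi> - cos \<phi>') * p$3 + (sin \<phi> - sin \<phi>') * h"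
    by (simp add: view_dir_def inner_real3 h_def algebra_simps)
  then have "\<bar>view_dir \<theta> \<phi> \<bullet> p - view_dir \<theta> \<phi>' \<bullet> p\<bar> \<le> \<bar>\<phi> - \<phi>'\<bar> * sqrt (h\<^sup>2 + (p$3)\<^sup>2)"
    using cos_sin_diff_bound[of \<phi> \<phi>' "p$3" h] by (simp add: add.commute)
  also have "\<dots> \<le> \<bar>\<phi> - \<phi>'\<bar> * norm p"
    unfolding h_def by (intro mult_left_mono horizontal_vertical_bound) simp
  finally show ?thesis .
qed

lemma norm_projM_diff_azimuth: "norm (projM \<theta> \<phi> p - projM \<theta>' \<phi> p) \<le> \<bar>\<theta> - \<theta>'\<bar> * norm p"
proof -
  have "projM \<theta> \<phi> p - projM \<theta>' \<phi> p = projM \<theta>' \<phi> (rotz (- (\<theta> - \<theta>')) p - p)"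
    using projM_add_angle[of \<theta>' "\<theta> - \<theta>'" \<phi> p] by (simp add: linear_diff[OF linear_projM])
  then show ?thesis
    using norm_projM_le[of \<theta>' \<phi> "rotz (- (\<theta> - \<theta>')) p - p"] norm_rotz_diff_le[of "- (\<theta> - \<theta>')" p]
    by (metis abs_minus_cancel order_trans)
qed

lemma view_dir_diff_azimuth: "\<bar>view_dir \<theta> \<phi> \<bullet> p - view_dir \<theta>' \<phi> \<bullet> p\<bar> \<le> \<bar>\<theta> - \<theta>'\<bar> * norm p"
proof -
  have "view_dir \<theta> \<phi> \<bullet> p - view_dir \<theta>' \<phi> \<bullet> p = (rotz (\<theta> - \<theta>') (view_dir \<theta>' \<phi>) - view_dir \<theta>' \<phi>) \<bullet> p"
    using view_dir_add_angle[of \<theta>' "\<theta> - \<theta>'" \<phi>] by (simp add: inner_diff_left)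
  also have "\<bar>\<dots>\<bar> \<le> norm (rotz (\<theta> - \<theta>') (view_dir \<theta>' \<phi>) - view_dir \<theta>' \<phi>) * norm p"
    by (rule Cauchy_Schwarz_ineq2)
  also have "\<dots> \<le> \<bar>\<theta> - \<theta>'\<bar> * norm p"
    using norm_rotz_diff_le[of "\<theta> - \<theta>'" "view_dir \<theta>' \<phi>"] by (intro mult_right_mono) simp_all
  finally show ?thesis .
qed

text \<open>The parameters are changed one at a time: planar rotation, azimuth, tilt.\<close>

lemma norm_rot2_projM_diff:
  "norm (rot2 \<alpha> (projM \<theta> \<phi> p) - projM \<theta>' \<phi>' p) \<le> (\<bar>\<alpha>\<bar> + \<bar>\<theta> - \<theta>'\<bar> + \<bar>\<phi> - \<phi>'\<bar>) * norm p"
proof -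
  have "rot2 \<alpha> (projM \<theta> \<phi> p) - projM \<theta>' \<phi>' p =
      (rot2 \<alpha> (projM \<theta> \<phi> p) - projM \<theta> \<phi> p) + (projM \<theta> \<phi> p - projM \<theta>' \<phi> p)
      + (projM \<theta>' \<phi> p - projM \<theta>' \<phi>' p)"
    by simp
  then have "norm (rot2 \<alpha> (projM \<theta> \<phi> p) - projM \<theta>' \<phi>' p) \<le>
      norm (rot2 \<alpha> (projM \<theta> \<phi> p) - projM \<theta> \<phi> p) + norm (projM \<theta> \<phi> p - projM \<theta>' \<phi> p)
      + norm (projM \<theta>' \<phi> p - projM \<theta>' \<phi>' p)"
    by (metis norm_triangle_mono norm_triangle_ineq order_refl)
  also have "\<dots> \<le> \<bar>\<alpha>\<bar> * norm p + \<bar>\<theta> - \<theta>'\<bar> * norm p + \<bar>\<phi> - \<phi>'\<bar> * norm p"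
  proof (intro add_mono norm_projM_diff_azimuth norm_projM_diff_tilt)
    show "norm (rot2 \<alpha> (projM \<theta> \<phi> p) - projM \<theta> \<phi> p) \<le> \<bar>\<alpha>\<bar> * norm p"
      using norm_rot2_diff_le[of \<alpha> "projM \<theta> \<phi> p"] norm_projM_le[of \<theta> \<phi> p]
      by (meson abs_ge_zero mult_left_mono order_trans)
  qed
  finally show ?thesis by (simp add: algebra_simps)
qed

lemma view_dir_diff:
  "\<bar>view_dir \<theta> \<phi> \<bullet> p - view_dir \<theta>' \<phi>' \<bullet> p\<bar> \<le> (\<bar>\<theta> - \<theta>'\<bar> + \<bar>\<phi> - \<phi>'\<bar>) * norm p"
  using view_dir_diff_azimuth[of \<theta> \<phi> p \<theta>'] view_dir_diff_tilt[of \<theta>' \<phi> p \<phi>']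
  by (simp add: algebra_simps)

text \<open>The cone condition with aperture \<open>\<kappa>\<close> makes \<open>v\<close> the point of the hull that is farthest from
  the origin among those at distance less than \<open>2 * \<kappa>\<close> from \<open>v\<close>.\<close>

lemma norm_less_if_cone_condition:
  fixes v x :: "'a::{euclidean_space}"
  assumes \<kappa>: "0 < \<kappa>"
    and cone: "\<And>w. w \<in> W \<Longrightarrow> \<kappa> * norm (v - w) \<le> v \<bullet> (v - w)"
    and x: "x \<in> interior (convex hull W)"
    and close: "norm (x - v) < 2 * \<kappa>"
  shows "norm x < norm v"
proof -
  \<comment> \<open>\<open>C\<close> is convex because the norm is convex and
    \<open>v \<bullet> (v - y)\<close> is affine in \<open>y\<close>; hence it contains the whole
    hull.\<close>
  define C where "C = {y. \<kappa> * norm (v - y) \<le> v \<bullet> (v - y)}"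
  have "convex C"
  proof (rule convexI)
    fix y z and a b :: real
    assume yz: "y \<in> C" "z \<in> C" and ab: "0 \<le> a" "0 \<le> b" "a + b = 1"
    have split: "v - (a *\<^sub>R y + b *\<^sub>R z) = a *\<^sub>R (v - y) + b *\<^sub>R (v - z)"
      using ab by (simp add: algebra_simps flip: scaleR_add_left)
    have "\<kappa> * norm (v - (a *\<^sub>R y + b *\<^sub>R z)) \<le> \<kappa> * (a * norm (v - y) + b * norm (v - z))"
      unfolding split using ab \<kappa> norm_triangle_ineq[of "a *\<^sub>R (v - y)" "b *\<^sub>R (v - z)"]
      by (intro mult_left_mono) simp_all
    also have "\<dots> = a * (\<kappa> * norm (v - y)) + b * (\<kappa> * norm (v - z))"
      by (simp add: algebra_simps)
    also have "\<dots> \<le> a * (v \<bullet> (v - y)) + b * (v \<bullet> (v - z))"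
      using yz ab by (intro add_mono mult_left_mono) (auto simp: C_def)
    also have "\<dots> = v \<bullet> (v - (a *\<^sub>R y + b *\<^sub>R z))"
      unfolding split by (simp add: inner_add_right)
    finally show "a *\<^sub>R y + b *\<^sub>R z \<in> C"
      by (simp add: C_def)
  qed
  then have sub: "convex hull W \<subseteq> C"
    by (intro hull_minimal) (auto simp: C_def cone)
  obtain e where e: "0 < e" "cball x e \<subseteq> C"
    using x sub by (meson mem_interior_cball order_trans)
  \<comment> \<open>If \<open>x = v\<close>, a small ball around \<open>v\<close> would lie in
    \<open>C\<close>. But a step from \<open>v\<close> in a direction \<open>d\<close> with
    \<open>v \<bullet> d \<ge> 0\<close> leaves \<open>C\<close>; the outward direction serves, or
    any unit vector if \<open>v = 0\<close>.\<close>
  have "x \<noteq> v"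
  proof
    assume "x = v"
    obtain d :: 'a where d: "norm d = 1" "0 \<le> v \<bullet> d"
    proof (cases "v = 0")
      case True
      then show ?thesis using that[of "SOME b. b \<in> Basis"] by (simp add: SOME_Basis)
    next
      case False
      then show ?thesis using that[of "v /\<^sub>R norm v"] by simp
    qed
    have "v + e *\<^sub>R d \<in> cball x e"
      using \<open>x = v\<close> d e by (simp add: dist_norm)
    with e have "\<kappa> * e \<le> - (e * (v \<bullet> d))"
      using d by (auto simp: C_def)
    with \<kappa> e d show False
      by (smt (verit) mult_nonneg_nonneg mult_pos_pos)
  qed
  \<comment> \<open>In the expansion of \<open>norm x\<close> squared around \<open>v\<close>, the
    decrease is at least \<open>2 * \<kappa> * norm (x - v)\<close>, and this beats the quadratic
    term because \<open>norm (x - v) < 2 * \<kappa>\<close>.\<close>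
  have "x \<in> C"
    using e by auto
  then have "2 * \<kappa> * norm (x - v) \<le> 2 * (v \<bullet> (v - x))"
    by (simp add: C_def norm_minus_commute)
  moreover have "norm (x - v) * norm (x - v) < 2 * \<kappa> * norm (x - v)"
    using close \<open>x \<noteq> v\<close> by (intro mult_strict_right_mono) auto
  ultimately have "(norm (x - v))\<^sup>2 < 2 * (v \<bullet> (v - x))"
    by (simp add: power2_eq_square)
  moreover have "(norm x)\<^sup>2 = (norm v)\<^sup>2 - 2 * (v \<bullet> (v - x)) + (norm (x - v))\<^sup>2"
    unfolding power2_norm_eq_inner by (simp add: inner_diff_left inner_diff_right inner_commute)
  ultimately have "(norm x)\<^sup>2 < (norm v)\<^sup>2"
    by linarith
  then show ?thesis
    by (rule power2_less_imp_less) simp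
qed

section \<open>Blocked directions\<close>

definition base_point :: "int \<Rightarrow> real^3" where
  "base_point i = (if i = 0 then D1 else if i = 1 then D2 else D3)"

definition symmetry :: "int \<Rightarrow> int \<Rightarrow> real^3 \<Rightarrow> real^3" where
  "symmetry k s x = real_of_int s *\<^sub>R rotz (2 * pi * real_of_int k / 15) x"

text \<open>The triple \<open>(i, k, s)\<close> stands for the image of the \<open>i\<close>-th base point under \<open>s R\<^sub>z(2 \<pi> k / 15)\<close>.\<close>

type_synonym vertex = "int \<times> int \<times> int"

fun vertex_point :: "vertex \<Rightarrow> real^3" where
  "vertex_point (i, k, s) = symmetry k s (base_point i)"

text \<open>The rotation index runs through all integers so that symmetries act on names by
  addition. A point thus has many names, and reduction mod 15 selects the one used by the
  table.\<close>

definition vertices :: "vertex set" where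
  "vertices = {0, 1, 2} \<times> UNIV \<times> {1, -1}"

lemma linear_symmetry: "linear (symmetry k s)"
  unfolding symmetry_def by (intro linear_compose_scale_right linear_rotz)

lemma symmetry_component:
  "symmetry k s x $ 1 = real_of_int s * (cos15 k * x$1 - sin15 k * x$2)"
  "symmetry k s x $ 2 = real_of_int s * (sin15 k * x$1 + cos15 k * x$2)"
  "symmetry k s x $ 3 = real_of_int s * x$3"
  by (simp_all add: symmetry_def rotz_def cos15_def sin15_def)

lemma symmetry_symmetry: "symmetry k s (symmetry l t x) = symmetry (k + l) (s * t) x"
  by (simp add: symmetry_def linear_cmul[OF linear_rotz] rotz_rotz add_divide_distrib distrib_left)

lemma symmetry_0_1 [simp]: "symmetry 0 1 x = x"
  by (simp add: symmetry_def rotz_def vec_eq_iff forall_3)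

lemma symmetry_vertex: "symmetry k s (vertex_point (j, l, t)) = vertex_point (j, k + l, s * t)"
  by (simp add: symmetry_symmetry)

lemma inner_symmetry: "s \<in> {1, -1} \<Longrightarrow> symmetry k s x \<bullet> symmetry k s y = x \<bullet> y"
  by (auto simp: symmetry_def inner_rotz)

lemma norm_symmetry: "s \<in> {1, -1} \<Longrightarrow> norm (symmetry k s x) = norm x"
  by (simp add: norm_eq_sqrt_inner inner_symmetry)

lemma symmetry_mod_15: "symmetry (k mod 15) s x = symmetry k s x"
proof -
  have eq: "2 * pi * real_of_int k / 15 = 2 * pi * real_of_int (k mod 15) / 15 + 2 * pi * real_of_int (k div 15)"
  proof -
    have "real_of_int k = real_of_int (k div 15 * 15 + k mod 15)"
      by simp
    then show ?thesis
      by (simp only: of_int_add of_int_mult) (simp add: field_simps)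
  qed
  have per: "cos (y + 2 * pi * real_of_int n) = cos y" "sin (y + 2 * pi * real_of_int n) = sin y" for y n
    using cos.plus_of_int[of y n] sin.plus_of_int[of y n] by (simp_all add: mult.commute)
  show ?thesis
    unfolding symmetry_def rotz_def by (simp only: eq per)
qed

lemma vertex_point_mod_15: "vertex_point (i, k mod 15, s) = vertex_point (i, k, s)"
  by (simp add: symmetry_mod_15)

lemma ruperthedron_eq: "ruperthedron = vertex_point ` vertices"
proof (intro equalityI subsetI)
  fix x
  assume "x \<in> ruperthedron"
  then obtain k l :: nat and D where
    x: "x = ((-1) ^ l) *\<^sub>R rotz (2 * pi * real k / 15) D" and D: "D \<in> {D1, D2, D3}"
    unfolding ruperthedron_def by auto
  obtain i where i: "i \<in> {0, 1, 2}" "D = base_point i"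
    using D that[of 0] that[of 1] that[of 2] by (auto simp: base_point_def)
  have "x = vertex_point (i, int k, (-1) ^ l)"
    by (simp add: x symmetry_def i)
  moreover have "(i, int k, (-1) ^ l) \<in> vertices"
    using i(1) by (simp add: vertices_def minus_one_power_iff)
  ultimately show "x \<in> vertex_point ` vertices"
    by blast
next
  fix x
  assume "x \<in> vertex_point ` vertices"
  then obtain i k s where x: "x = vertex_point (i, k, s)" and s: "s \<in> {1, -1}"
    by (auto simp: vertices_def)
  define m where "m = nat (k mod 15)"
  have m: "int m = k mod 15" "m \<in> {0..14}"
    by (auto simp: m_def nat_le_iff)
  have "x = vertex_point (i, int m, s)"
    by (simp only: x m vertex_point_mod_15)
  then have "x = ((-1) ^ (if s = 1 then 0 else 1)) *\<^sub>R rotz (2 * pi * real m / 15) (base_point i)"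
    using s by (auto simp: symmetry_def)
  moreover have "base_point i \<in> {D1, D2, D3}"
    by (simp add: base_point_def)
  ultimately show "x \<in> ruperthedron"
    unfolding ruperthedron_def using m(2) by (intro CollectI exI conjI) (assumption, auto)
qed

lemma symmetry_ruperthedron:
  assumes "s \<in> {1, -1}" "x \<in> ruperthedron"
  shows "symmetry k s x \<in> ruperthedron"
proof -
  obtain j l t where x: "x = vertex_point (j, l, t)" "(j, l, t) \<in> vertices"
    using assms(2) by (auto simp: ruperthedron_eq)
  then have "(j, k + l, s * t) \<in> vertices"
    using assms(1) by (auto simp: vertices_def)
  then show ?thesis
    unfolding ruperthedron_eq x(1) symmetry_vertex by (rule imageI)
qed

lemma symmetry_inverse:
  assumes "s \<in> {1, -1}"
  shows "symmetry k s (symmetry (- k) s x) = x" "symmetry (- k) s (symmetry k s x) = x"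
  using assms by (auto simp: symmetry_symmetry)

lemma uminus_ruperthedron: "x \<in> ruperthedron \<Longrightarrow> - x \<in> ruperthedron"
proof -
  have "symmetry 0 (-1) x = - x"
    by (simp add: symmetry_def rotz_def vec_eq_iff forall_3)
  then show "x \<in> ruperthedron \<Longrightarrow> - x \<in> ruperthedron"
    using symmetry_ruperthedron[of "-1" x 0] by simp
qed

lemma norm_base_point: "norm (base_point i) \<le> 1"
  by (rule power2_le_imp_le)
    (simp_all add: base_point_def D1_def D2_def D3_def power2_norm_eq_inner inner_real3)

lemma norm_vertex: "p \<in> vertices \<Longrightarrow> norm (vertex_point p) \<le> 1"
  by (auto simp: vertices_def norm_symmetry norm_base_point)

lemma norm_ruperthedron: "x \<in> ruperthedron \<Longrightarrow> norm x \<le> 1"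
  unfolding ruperthedron_eq using norm_vertex by blast

text \<open>For a unit vector \<open>X\<close> this is the inner product of the orthogonal projections of \<open>u\<close> and \<open>w\<close>
  along \<open>X\<close>; it is homogenised so that it makes sense for every direction vector.\<close>

definition shadow_inner :: "real^3 \<Rightarrow> real^3 \<Rightarrow> real^3 \<Rightarrow> real" where
  "shadow_inner X u w = (u \<bullet> w) * (X \<bullet> X) - (X \<bullet> u) * (X \<bullet> w)"

lemma shadow_inner_add_right: "shadow_inner X u (v + w) = shadow_inner X u v + shadow_inner X u w"
  and shadow_inner_scale_left: "shadow_inner X (r *\<^sub>R u) w = r * shadow_inner X u w"
  and shadow_inner_scale_right: "shadow_inner X u (r *\<^sub>R w) = r * shadow_inner X u w"
  by (simp_all add: shadow_inner_def inner_add_left inner_add_right algebra_simps)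

text \<open>The auxiliary vector is \<open>X \<bullet> X\<close> times the component of
  \<open>u\<close> orthogonal to \<open>X\<close>. The bound later controls the effect of rounding
  \<open>u\<close> and \<open>w\<close>.\<close>

lemma abs_shadow_inner_le: "\<bar>shadow_inner X u w\<bar> \<le> norm u * norm w * (X \<bullet> X)"
proof -
  define v where "v = (X \<bullet> X) *\<^sub>R u - (X \<bullet> u) *\<^sub>R X"
  have "v \<bullet> v = (X \<bullet> X)\<^sup>2 * (u \<bullet> u) - (X \<bullet> X) * (X \<bullet> u)\<^sup>2"
    by (simp add: v_def inner_diff_left inner_diff_right inner_commute power2_eq_square algebra_simps)
  also have "\<dots> \<le> (X \<bullet> X)\<^sup>2 * (u \<bullet> u)"
    by simp
  finally have "(norm v)\<^sup>2 \<le> ((X \<bullet> X) * norm u)\<^sup>2"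
    by (simp add: power2_norm_eq_inner power_mult_distrib)
  then have "norm v \<le> (X \<bullet> X) * norm u"
    by (rule power2_le_imp_le) simp
  moreover have "shadow_inner X u w = v \<bullet> w"
    by (simp add: shadow_inner_def v_def inner_diff_left)
  ultimately show ?thesis
    using Cauchy_Schwarz_ineq2[of v w] mult_right_mono[of "norm v" "(X \<bullet> X) * norm u" "norm w"]
    by (simp add: mult.assoc mult.left_commute mult.commute)
qed

text \<open>Both constants come from the radius 0.0006. Images move by at most 0.0018 < 2 *
  0.000905. Inner products with \<open>P\<close> change by at most 0.0012 = 2 * 0.0006, so starting
  from at least 0.0006 their absolute value cannot grow by a change of sign. The length of
  \<open>P - Q\<close> is taken in space: this is stronger than using the shadow, and the factor
  does not vary with \<open>X\<close>.\<close>

definition farthest :: "real^3 \<Rightarrow> real^3 \<Rightarrow> bool" where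
  "farthest X P \<longleftrightarrow> 0.0006 * norm X \<le> X \<bullet> P \<and>
     (\<forall>Q\<in>ruperthedron. 0.000905 * norm (P - Q) * (X \<bullet> X) \<le> shadow_inner X P (P - Q))"

definition blocked :: "real^3 \<Rightarrow> bool" where
  "blocked X \<longleftrightarrow> (\<exists>P\<in>ruperthedron. \<exists>Q\<in>ruperthedron. \<exists>R\<in>ruperthedron. \<exists>a\<ge>0. \<exists>b\<ge>0. \<exists>c\<ge>0.
     farthest X P \<and> farthest X Q \<and> farthest X R \<and> X = a *\<^sub>R P + b *\<^sub>R Q + c *\<^sub>R R)"

lemma farthest_symmetry:
  assumes s: "s \<in> {1, -1}" and far: "farthest X P"
  shows "farthest (symmetry k s X) (symmetry k s P)"
  unfolding farthest_def
proof (intro conjI ballI)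
  show "0.0006 * norm (symmetry k s X) \<le> symmetry k s X \<bullet> symmetry k s P"
    using far by (simp add: farthest_def norm_symmetry[OF s] inner_symmetry[OF s])
next
  fix Q
  assume "Q \<in> ruperthedron"
  define Q' where "Q' = symmetry (- k) s Q"
  have Q': "Q' \<in> ruperthedron" "Q = symmetry k s Q'"
    using symmetry_ruperthedron[OF s \<open>Q \<in> ruperthedron\<close>] symmetry_inverse[OF s] by (auto simp: Q'_def)
  have "symmetry k s P - Q = symmetry k s (P - Q')"
    by (simp add: Q'(2) linear_diff[OF linear_symmetry])
  then show "0.000905 * norm (symmetry k s P - Q) * (symmetry k s X \<bullet> symmetry k s X)
      \<le> shadow_inner (symmetry k s X) (symmetry k s P) (symmetry k s P - Q)"
    using far Q'(1) by (simp add: farthest_def shadow_inner_def norm_symmetry[OF s] inner_symmetry[OF s])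
qed

lemma blocked_symmetry:
  assumes s: "s \<in> {1, -1}" and "blocked X"
  shows "blocked (symmetry k s X)"
proof -
  obtain P Q R a b c where PQR: "P \<in> ruperthedron" "Q \<in> ruperthedron" "R \<in> ruperthedron"
    "farthest X P" "farthest X Q" "farthest X R"
    and abc: "a \<ge> 0" "b \<ge> 0" "c \<ge> 0" "X = a *\<^sub>R P + b *\<^sub>R Q + c *\<^sub>R R"
    using assms(2) unfolding blocked_def by blast
  have "symmetry k s X = a *\<^sub>R symmetry k s P + b *\<^sub>R symmetry k s Q + c *\<^sub>R symmetry k s R"
    by (simp add: abc(4) linear_add[OF linear_symmetry] linear_cmul[OF linear_symmetry])
  then show ?thesis
    unfolding blocked_def
    using PQR abc farthest_symmetry[OF s] symmetry_ruperthedron[OF s] by blast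
qed

text \<open>A shadow that fits strictly inside moves all three blocking vertices closer to the origin, hence
  all three towards the viewing direction; this is impossible because the old viewing direction is a
  nonnegative combination of them.\<close>

lemma no_nearby_solution:
  assumes blocked: "blocked (view_dir \<theta>' \<phi>')"
    and near: "\<bar>\<theta> - \<theta>'\<bar> \<le> 0.0006" "\<bar>\<phi> - \<phi>'\<bar> \<le> 0.0006" "\<bar>\<alpha>\<bar> \<le> 0.0006"
  shows "\<not> rupert_cond 1 ruperthedron \<theta> \<phi> \<theta>' \<phi>' \<alpha>"
proof
  assume cond: "rupert_cond 1 ruperthedron \<theta> \<phi> \<theta>' \<phi>' \<alpha>"
  define X where "X = view_dir \<theta>' \<phi>'"
  define Y where "Y = view_dir \<theta> \<phi>"
  have XX: "X \<bullet> X = 1" and YY: "Y \<bullet> Y = 1"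
    by (simp_all add: X_def Y_def flip: power2_norm_eq_inner)
  have less: "X \<bullet> P < Y \<bullet> P" if P: "P \<in> ruperthedron" and far: "farthest X P" for P
  proof -
    define v where "v = projM \<theta>' \<phi>' P"
    define x where "x = rot2 \<alpha> (projM \<theta> \<phi> P)"
    have nP: "norm P \<le> 1"
      using P by (rule norm_ruperthedron)
    have inner_v: "v \<bullet> (v - projM \<theta>' \<phi>' Q) = shadow_inner X P (P - Q)" for Q
      using inner_projM[of \<theta>' \<phi>' P "P - Q"]
      by (simp add: v_def shadow_inner_def XX linear_diff[OF linear_projM] flip: X_def)
    have "norm x < norm v"
    proof (rule norm_less_if_cone_condition)
      show "x \<in> interior (convex hull (projM \<theta>' \<phi>' ` ruperthedron))"
        using cond P by (auto simp: rupert_cond_def x_def)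
      have "norm (x - v) \<le> (\<bar>\<alpha>\<bar> + \<bar>\<theta> - \<theta>'\<bar> + \<bar>\<phi> - \<phi>'\<bar>) * norm P"
        unfolding x_def v_def by (rule norm_rot2_projM_diff)
      also have "\<dots> \<le> 0.0018 * 1"
        using near nP by (intro mult_mono) auto
      finally show "norm (x - v) < 2 * 0.000905"
        by simp
    next
      fix w
      assume "w \<in> projM \<theta>' \<phi>' ` ruperthedron"
      then obtain Q where Q: "Q \<in> ruperthedron" "w = projM \<theta>' \<phi>' Q"
        by auto
      have "norm (v - w) \<le> norm (P - Q)"
        using norm_projM_le[of \<theta>' \<phi>' "P - Q"] by (simp add: v_def Q(2) linear_diff[OF linear_projM])
      then have "0.000905 * norm (v - w) \<le> 0.000905 * norm (P - Q) * (X \<bullet> X)"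
        by (simp add: XX)
      also have "\<dots> \<le> shadow_inner X P (P - Q)"
        using far Q(1) by (simp add: farthest_def)
      finally show "0.000905 * norm (v - w) \<le> v \<bullet> (v - w)"
        by (simp add: Q(2) inner_v)
    qed simp
    then have "(norm x)\<^sup>2 < (norm v)\<^sup>2"
      by (simp add: power_strict_mono)
    then have sq: "(X \<bullet> P)\<^sup>2 < (Y \<bullet> P)\<^sup>2"
      by (simp add: x_def v_def norm_projM X_def Y_def)
    have "\<bar>Y \<bullet> P - X \<bullet> P\<bar> \<le> (\<bar>\<theta> - \<theta>'\<bar> + \<bar>\<phi> - \<phi>'\<bar>) * norm P"
      unfolding X_def Y_def by (rule view_dir_diff)
    also have "\<dots> \<le> 0.0012 * 1"
      using near nP by (intro mult_mono) auto
    finally have "\<bar>Y \<bullet> P - X \<bullet> P\<bar> \<le> 0.0012"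
      by simp
    moreover have "0.0006 \<le> X \<bullet> P"
      using far by (simp add: farthest_def X_def)
    ultimately have "Y \<bullet> P \<ge> - (X \<bullet> P)"
      by linarith
    moreover have "\<bar>X \<bullet> P\<bar> < \<bar>Y \<bullet> P\<bar>"
      using sq by (metis abs_le_square_iff linorder_not_le)
    ultimately show ?thesis
      using \<open>0.0006 \<le> X \<bullet> P\<close> by linarith
  qed
  obtain P Q R a b c where PQR: "P \<in> ruperthedron" "Q \<in> ruperthedron" "R \<in> ruperthedron"
    "farthest X P" "farthest X Q" "farthest X R"
    and abc: "a \<ge> 0" "b \<ge> 0" "c \<ge> 0" and X: "X = a *\<^sub>R P + b *\<^sub>R Q + c *\<^sub>R R"
    using blocked unfolding blocked_def X_def by blast
  have comb: "Z \<bullet> X = a * (Z \<bullet> P) + b * (Z \<bullet> Q) + c * (Z \<bullet> R)" for Z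
    by (subst X) (simp add: inner_add_right)
  have "Y \<bullet> X \<le> 1"
    using norm_cauchy_schwarz[of Y X] by (simp add: X_def Y_def)
  then have "a * (Y \<bullet> P - X \<bullet> P) + b * (Y \<bullet> Q - X \<bullet> Q) + c * (Y \<bullet> R - X \<bullet> R) \<le> 0"
    using comb[of X] comb[of Y] XX by (simp add: algebra_simps)
  moreover have "a * (Y \<bullet> P - X \<bullet> P) \<ge> 0" "b * (Y \<bullet> Q - X \<bullet> Q) \<ge> 0" "c * (Y \<bullet> R - X \<bullet> R) \<ge> 0"
    using less PQR abc by (simp_all add: less_imp_le)
  ultimately have "a * (Y \<bullet> P - X \<bullet> P) = 0" "b * (Y \<bullet> Q - X \<bullet> Q) = 0" "c * (Y \<bullet> R - X \<bullet> R) = 0"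
    by linarith+
  then have "a = 0" "b = 0" "c = 0"
    using less PQR by force+
  then show False
    using X XX by simp
qed

text \<open>A sign moves \<open>X\<close> into the upper half-space, and a multiple of 24 degrees
  moves its azimuth into the wedge from 0 to 24 degrees. The generator (29, 13, 0) replaces the
  irrational edge of the wedge: 13/29 is slightly larger than the tangent of 24 degrees, so the cone
  contains the wedge and has integer generators.\<close>

lemma fundamental_domain:
  fixes X :: "real^3"
  obtains k s a b c where "s \<in> {1, -1}" "a \<ge> 0" "b \<ge> 0" "c \<ge> 0"
    "symmetry k s X = a *\<^sub>R vector [0, 0, 1] + b *\<^sub>R vector [1, 0, 0] + c *\<^sub>R vector [29, 13, 0]"
proof -
  define s :: int where "s = (if X$3 \<ge> 0 then 1 else -1)"
  define Z where "Z = real_of_int s *\<^sub>R X"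
  have s: "s \<in> {1, -1}" and Z3: "Z$3 \<ge> 0"
    by (auto simp: s_def Z_def)
  define r where "r = cmod (Complex (Z$1) (Z$2))"
  define t where "t = Arg (Complex (Z$1) (Z$2))"
  have "rcis r t = Complex (Z$1) (Z$2)"
    unfolding r_def t_def by (rule rcis_cmod_Arg)
  then have Z12: "Z$1 = r * cos t" "Z$2 = r * sin t"
    by (auto simp: complex_eq_iff)
  have r: "r \<ge> 0"
    by (simp add: r_def)
  define k where "k = \<lfloor>15 * t / (2 * pi)\<rfloor>"
  define t' where "t' = t - 2 * pi * real_of_int k / 15"
  have "real_of_int k \<le> 15 * t / (2 * pi)" "15 * t / (2 * pi) < real_of_int k + 1"
    unfolding k_def by linarith+
  then have t': "0 \<le> t'" "t' \<le> 2 * pi / 15"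
    by (simp_all add: t'_def field_simps)
  have small: "2 * pi / 15 \<le> pi / 2"
    by simp
  have "sin t' \<le> sin (2 * pi / 15)"
    using t' small by (intro sin_monotone_2pi_le) auto
  moreover have "cos (2 * pi / 15) \<le> cos t'"
    using t' small by (intro cos_monotone_0_pi_le) auto
  ultimately have "29 * sin t' \<le> 13 * cos t'"
    using cos15_sin15_one unfolding cos15_def sin15_def abs_le_iff by simp
  moreover have "0 \<le> sin t'"
    using t' small pi_gt_zero by (intro sin_ge_zero) linarith+
  ultimately have nonneg: "0 \<le> r * sin t' / 13" "0 \<le> r * cos t' - 29 * (r * sin t' / 13)"
    using r mult_left_mono[of "29 * sin t'" "13 * cos t'" r] by simp_all
  have t: "t = t' + 2 * pi * real_of_int k / 15"
    by (simp add: t'_def)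
  define \<beta> where "\<beta> = 2 * pi * real_of_int k / 15"
  have "(cos \<beta>)\<^sup>2 + (sin \<beta>)\<^sup>2 = 1"
    by simp
  then have "cos \<beta> * (r * cos (t' + \<beta>)) + sin \<beta> * (r * sin (t' + \<beta>)) = r * cos t'"
    "- sin \<beta> * (r * cos (t' + \<beta>)) + cos \<beta> * (r * sin (t' + \<beta>)) = r * sin t'"
    unfolding cos_add sin_add by algebra+
  then have "rotz (- \<beta>) Z = vector [r * cos t', r * sin t', Z$3]"
    by (simp add: rotz_def vec_eq_iff forall_3 Z12 t \<beta>_def)
  moreover have "symmetry (- k) s X = rotz (- \<beta>) Z"
    by (simp add: symmetry_def Z_def \<beta>_def linear_cmul[OF linear_rotz])
  ultimately have "symmetry (- k) s X = Z$3 *\<^sub>R vector [0, 0, 1]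
      + (r * cos t' - 29 * (r * sin t' / 13)) *\<^sub>R vector [1, 0, 0] + (r * sin t' / 13) *\<^sub>R vector [29, 13, 0]"
    by (simp add: vec_eq_iff forall_3)
  then show ?thesis
    using that s Z3 nonneg by blast
qed

lemma blocked_if_fundamental_domain:
  assumes "\<And>a b c. a \<ge> 0 \<Longrightarrow> b \<ge> 0 \<Longrightarrow> c \<ge> 0 \<Longrightarrow>
      a *\<^sub>R vector [0, 0, 1] + b *\<^sub>R vector [1, 0, 0] + c *\<^sub>R vector [29, 13, 0] \<noteq> (0 :: real^3) \<Longrightarrow>
      blocked (a *\<^sub>R vector [0, 0, 1] + b *\<^sub>R vector [1, 0, 0] + c *\<^sub>R vector [29, 13, 0])"
    and "X \<noteq> 0"
  shows "blocked X"
proof -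
  obtain k s a b c where s: "s \<in> {1, -1}" and abc: "a \<ge> 0" "b \<ge> 0" "c \<ge> 0"
    and eq: "symmetry k s X = a *\<^sub>R vector [0, 0, 1] + b *\<^sub>R vector [1, 0, 0] + c *\<^sub>R vector [29, 13, 0]"
    by (rule fundamental_domain)
  have "symmetry k s X \<noteq> 0"
    using norm_symmetry[OF s, of k X] \<open>X \<noteq> 0\<close> by auto
  then have "blocked (symmetry k s X)"
    using assms(1)[OF abc] eq by simp
  then have "blocked (symmetry (- k) s (symmetry k s X))"
    by (rule blocked_symmetry[OF s])
  then show ?thesis
    by (simp add: symmetry_inverse[OF s])
qed

section \<open>Integer approximation of the vertices\<close>

type_synonym ivec = "int \<times> int \<times> int"

fun iadd :: "ivec \<Rightarrow> ivec \<Rightarrow> ivec" where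
  "iadd (a, b, c) (d, e, f) = (a + d, b + e, c + f)"

fun isub :: "ivec \<Rightarrow> ivec \<Rightarrow> ivec" where
  "isub (a, b, c) (d, e, f) = (a - d, b - e, c - f)"

fun iscale :: "int \<Rightarrow> ivec \<Rightarrow> ivec" where
  "iscale r (a, b, c) = (r * a, r * b, r * c)"

fun idot :: "ivec \<Rightarrow> ivec \<Rightarrow> int" where
  "idot (a, b, c) (d, e, f) = a * d + b * e + c * f"

fun icross :: "ivec \<Rightarrow> ivec \<Rightarrow> ivec" where
  "icross (a, b, c) (d, e, f) = (b * f - c * e, c * d - a * f, a * e - b * d)"

text \<open>Row \<open>i\<close>, column \<open>k\<close> is the vertex \<open>(i, k, 1)\<close>, scaled by \<open>100000\<close> and rounded.\<close>

definition vertex_table :: "ivec list list" where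
  "vertex_table = [
    [(67207,0,74049), (61397,27336,74049), (44970,49945,74049), (20768,63918,74049), (-7025,66839,74049),
     (-33603,58203,74049), (-54372,39503,74049), (-65738,13973,74049), (-65738,-13973,74049), (-54372,-39503,74049),
     (-33603,-58203,74049), (-7025,-66839,74049), (20768,-63918,74049), (44970,-49945,74049), (61397,-27336,74049)],
    [(78550,41780,44840), (54766,70117,44840), (21512,86330,44840), (-15462,87616,44840), (-49762,73752,44840),
     (-75458,47136,44840), (-88106,12370,44840), (-85520,-24536,44840), (-68147,-57198,44840), (-38991,-79971,44840),
     (-3092,-88916,44840), (33340,-82487,44840), (64008,-61795,44840), (83609,-30418,44840), (88752,6219,44840)],
    [(95260,20570,11020), (78658,57537,11020), (48455,84556,11020), (9874,96954,11020), (-30415,92588,11020),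
     (-65444,72213,11020), (-89158,39351,11020), (-97455,-315,11020), (-88902,-39926,11020), (-64976,-72634,11020),
     (-29816,-92783,11020), (10500,-96888,11020), (49000,-84241,11020), (79028,-57028,11020), (95391,-19954,11020)]]"

definition table_entry :: "int \<Rightarrow> int \<Rightarrow> ivec" where
  "table_entry i k = vertex_table ! nat i ! nat k"

fun approx :: "vertex \<Rightarrow> ivec" where
  "approx (i, k, s) = iscale s (table_entry i (k mod 15))"

text \<open>The essential property is that these vertices generate the cone of the polyhedron at the
  base point, as \<open>base_cone\<close> shows. Rotation indices are kept in 0..14 so that
  \<open>in_cone\<close> can test membership by comparing names.\<close>

definition base_neighbours :: "int \<Rightarrow> vertex list" where
  "base_neighbours i =
    (if i = 0 then [(0,1,1), (1,14,1), (1,13,1), (0,14,1)]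
     else if i = 1 then [(0,1,1), (0,2,1), (1,1,1), (2,1,1), (2,0,1), (1,14,1)]
     else [(1,0,1), (2,1,1), (2,8,-1), (2,7,-1), (2,14,1), (1,14,1)])"

fun neighbours :: "vertex \<Rightarrow> vertex list" where
  "neighbours (i, k, s) = map (\<lambda>(j, l, t). (j, k + l, s * t)) (base_neighbours i)"

lemma table_entry_simps:
  "table_entry 0 0 = (67207,0,74049)"
  "table_entry 0 1 = (61397,27336,74049)"
  "table_entry 0 2 = (44970,49945,74049)"
  "table_entry 0 3 = (20768,63918,74049)"
  "table_entry 0 4 = (-7025,66839,74049)"
  "table_entry 0 5 = (-33603,58203,74049)"
  "table_entry 0 6 = (-54372,39503,74049)"
  "table_entry 0 7 = (-65738,13973,74049)"
  "table_entry 0 8 = (-65738,-13973,74049)"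
  "table_entry 0 9 = (-54372,-39503,74049)"
  "table_entry 0 10 = (-33603,-58203,74049)"
  "table_entry 0 11 = (-7025,-66839,74049)"
  "table_entry 0 12 = (20768,-63918,74049)"
  "table_entry 0 13 = (44970,-49945,74049)"
  "table_entry 0 14 = (61397,-27336,74049)"
  "table_entry 1 0 = (78550,41780,44840)"
  "table_entry 1 1 = (54766,70117,44840)"
  "table_entry 1 2 = (21512,86330,44840)"
  "table_entry 1 3 = (-15462,87616,44840)"
  "table_entry 1 4 = (-49762,73752,44840)"
  "table_entry 1 5 = (-75458,47136,44840)"
  "table_entry 1 6 = (-88106,12370,44840)"
  "table_entry 1 7 = (-85520,-24536,44840)"
  "table_entry 1 8 = (-68147,-57198,44840)"
  "table_entry 1 9 = (-38991,-79971,44840)"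
  "table_entry 1 10 = (-3092,-88916,44840)"
  "table_entry 1 11 = (33340,-82487,44840)"
  "table_entry 1 12 = (64008,-61795,44840)"
  "table_entry 1 13 = (83609,-30418,44840)"
  "table_entry 1 14 = (88752,6219,44840)"
  "table_entry 2 0 = (95260,20570,11020)"
  "table_entry 2 1 = (78658,57537,11020)"
  "table_entry 2 2 = (48455,84556,11020)"
  "table_entry 2 3 = (9874,96954,11020)"
  "table_entry 2 4 = (-30415,92588,11020)"
  "table_entry 2 5 = (-65444,72213,11020)"
  "table_entry 2 6 = (-89158,39351,11020)"
  "table_entry 2 7 = (-97455,-315,11020)"
  "table_entry 2 8 = (-88902,-39926,11020)"
  "table_entry 2 9 = (-64976,-72634,11020)"
  "table_entry 2 10 = (-29816,-92783,11020)"
  "table_entry 2 11 = (10500,-96888,11020)"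
  "table_entry 2 12 = (49000,-84241,11020)"
  "table_entry 2 13 = (79028,-57028,11020)"
  "table_entry 2 14 = (95391,-19954,11020)"
  by (simp_all add: table_entry_def vertex_table_def)


section \<open>Rounding errors between integer vectors and exact vertices\<close>

fun real_vec :: "ivec \<Rightarrow> real^3" where
  "real_vec (a, b, c) = vector [real_of_int a, real_of_int b, real_of_int c]"

lemma inner_real_vec: "real_vec u \<bullet> real_vec v = real_of_int (idot u v)"
  by (cases u; cases v) (simp add: inner_real3)

lemma real_vec_add: "real_vec (iadd u v) = real_vec u + real_vec v"
  and real_vec_sub: "real_vec (isub u v) = real_vec u - real_vec v"
  and real_vec_scale: "real_vec (iscale r u) = real_of_int r *\<^sub>R real_vec u"
  by (cases u; cases v; simp add: vec_eq_iff forall_3)+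

lemma real_vec_cross: "real_vec (icross u v) = cross3 (real_vec u) (real_vec v)"
  by (cases u; cases v) (simp add: cross3_def vec_eq_iff forall_3)

text \<open>Rounding to integers contributes 0.5. The errors of sine and cosine contribute at most
  0.0121, since they are scaled by 100000 and the horizontal coordinates of a base point have
  absolute sum below 1.21.\<close>

lemma table_entry_error:
  assumes i: "i \<in> {0, 1, 2}" and k: "0 \<le> k" "k < 15"
  shows "\<bar>100000 * (cos15 k * base_point i $ 1 - sin15 k * base_point i $ 2) - real_vec (table_entry i k) $ 1\<bar> \<le> 0.515
    \<and> \<bar>100000 * (sin15 k * base_point i $ 1 + cos15 k * base_point i $ 2) - real_vec (table_entry i k) $ 2\<bar> \<le> 0.515
    \<and> \<bar>100000 * base_point i $ 3 - real_vec (table_entry i k) $ 3\<bar> \<le> 0.515"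
proof -
  have cases: "k = 0 \<or> k = 1 \<or> k = 2 \<or> k = 3 \<or> k = 4 \<or> k = 5 \<or> k = 6 \<or> k = 7 \<or> k = 8
      \<or> k = 9 \<or> k = 10 \<or> k = 11 \<or> k = 12 \<or> k = 13 \<or> k = 14"
    using k by presburger
  note points = base_point_def D1_def D2_def D3_def table_entry_simps
  from cases show ?thesis
  proof (elim disjE)
    assume "k = 0"
    then show ?thesis
      using i cos15_sin15_bounds(1,2) unfolding abs_le_iff by (auto simp: points)
  next
    assume "k = 1"
    then show ?thesis
      using i cos15_sin15_bounds(3,4) unfolding abs_le_iff by (auto simp: points)
  next
    assume "k = 2"
    then show ?thesis
      using i cos15_sin15_bounds(5,6) unfolding abs_le_iff by (auto simp: points)
  next
    assume "k = 3"
    then show ?thesis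
      using i cos15_sin15_bounds(7,8) unfolding abs_le_iff by (auto simp: points)
  next
    assume "k = 4"
    then show ?thesis
      using i cos15_sin15_bounds(9,10) unfolding abs_le_iff by (auto simp: points)
  next
    assume "k = 5"
    then show ?thesis
      using i cos15_sin15_bounds(11,12) unfolding abs_le_iff by (auto simp: points)
  next
    assume "k = 6"
    then show ?thesis
      using i cos15_sin15_bounds(13,14) unfolding abs_le_iff by (auto simp: points)
  next
    assume "k = 7"
    then show ?thesis
      using i cos15_sin15_bounds(15,16) unfolding abs_le_iff by (auto simp: points)
  next
    assume "k = 8"
    then show ?thesis
      using i cos15_sin15_bounds(17,18) unfolding abs_le_iff by (auto simp: points)
  next
    assume "k = 9"
    then show ?thesis
      using i cos15_sin15_bounds(19,20) unfolding abs_le_iff by (auto simp: points)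
  next
    assume "k = 10"
    then show ?thesis
      using i cos15_sin15_bounds(21,22) unfolding abs_le_iff by (auto simp: points)
  next
    assume "k = 11"
    then show ?thesis
      using i cos15_sin15_bounds(23,24) unfolding abs_le_iff by (auto simp: points)
  next
    assume "k = 12"
    then show ?thesis
      using i cos15_sin15_bounds(25,26) unfolding abs_le_iff by (auto simp: points)
  next
    assume "k = 13"
    then show ?thesis
      using i cos15_sin15_bounds(27,28) unfolding abs_le_iff by (auto simp: points)
  next
    assume "k = 14"
    then show ?thesis
      using i cos15_sin15_bounds(29,30) unfolding abs_le_iff by (auto simp: points)
  qed
qed

text \<open>The bound 0.9 is 0.515 times \<open>sqrt 3\<close>, rounded up.\<close>

lemma approx_error:
  assumes "p \<in> vertices"
  shows "norm (100000 *\<^sub>R vertex_point p - real_vec (approx p)) \<le> 0.9"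
proof -
  obtain i k s where p: "p = (i, k, s)" and i: "i \<in> {0, 1, 2}" and s: "s \<in> {1, -1}"
    using assms by (auto simp: vertices_def)
  define m where "m = k mod 15"
  have m: "0 \<le> m" "m < 15"
    by (simp_all add: m_def)
  define x where "x = 100000 *\<^sub>R symmetry m 1 (base_point i) - real_vec (table_entry i m)"
  have comp: "\<bar>x$1\<bar> \<le> 0.515" "\<bar>x$2\<bar> \<le> 0.515" "\<bar>x$3\<bar> \<le> 0.515"
    using table_entry_error[OF i m] by (simp_all add: x_def symmetry_component)
  have "(norm x)\<^sup>2 = (x$1)\<^sup>2 + (x$2)\<^sup>2 + (x$3)\<^sup>2"
    unfolding power2_norm_eq_inner inner_real3 by (simp add: power2_eq_square)
  also have "\<dots> \<le> 0.515\<^sup>2 + 0.515\<^sup>2 + 0.515\<^sup>2"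
    using comp by (intro add_mono abs_le_square_iff[THEN iffD1]) simp_all
  also have "\<dots> \<le> 0.9\<^sup>2"
    by (simp add: power2_eq_square)
  finally have "norm x \<le> 0.9"
    by (rule power2_le_imp_le) simp
  moreover have "100000 *\<^sub>R vertex_point p - real_vec (approx p) = real_of_int s *\<^sub>R x"
  proof -
    have "vertex_point p = real_of_int s *\<^sub>R symmetry m 1 (base_point i)"
      unfolding p vertex_point_mod_15[symmetric, of i k s] by (simp add: symmetry_def m_def)
    then show ?thesis
      by (simp add: p x_def real_vec_scale scaleR_diff_right flip: m_def)
  qed
  ultimately show ?thesis
    using s by auto
qed

section \<open>Vertex cones\<close>

text \<open>Simplicial cones spanned by neighbours, chosen so that every vertex outside the special
  cases of \<open>convex_position\<close> is a neighbour or lies strictly inside one of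
  them.\<close>

definition cone_triples :: "int \<Rightarrow> (vertex \<times> vertex \<times> vertex) list" where
  "cone_triples i =
    (if i = 0 then [((0,1,1), (1,14,1), (0,14,1))]
     else if i = 1 then
       [((0,2,1), (2,1,1), (1,14,1)), ((0,1,1), (1,1,1), (2,1,1)),
        ((0,1,1), (0,2,1), (1,14,1)), ((0,1,1), (2,1,1), (2,0,1))]
     else [((2,1,1), (2,7,-1), (1,14,1)), ((1,0,1), (2,8,-1), (2,7,-1))])"

definition idet :: "ivec \<Rightarrow> ivec \<Rightarrow> ivec \<Rightarrow> int" where
  "idet u v w = idot u (icross v w)"

definition edge :: "int \<Rightarrow> vertex \<Rightarrow> ivec" where
  "edge i q = isub (approx q) (approx (i, 0, 1))"

text \<open>These are the determinants of Cramer's rule for the rounded edges. The threshold exceeds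
  \<open>3 * 1.8 * 200002 ^ 2\<close>, about 2.2 * 10^11, which bounds the effect of rounding; hence
  the exact determinants are positive.\<close>

fun in_triple :: "int \<Rightarrow> vertex \<Rightarrow> vertex \<times> vertex \<times> vertex \<Rightarrow> bool" where
  "in_triple i q (a, b, c) \<longleftrightarrow>
     300000000000 \<le> idet (edge i a) (edge i b) (edge i c) \<and>
     300000000000 \<le> idet (edge i q) (edge i b) (edge i c) \<and>
     300000000000 \<le> idet (edge i a) (edge i q) (edge i c) \<and>
     300000000000 \<le> idet (edge i a) (edge i b) (edge i q)"

definition in_cone :: "int \<Rightarrow> vertex \<Rightarrow> bool" where
  "in_cone i q \<longleftrightarrow> List.member (base_neighbours i) q \<or> list_ex (in_triple i q) (cone_triples i)"

definition convex_position :: "int \<Rightarrow> bool" where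
  "convex_position i \<longleftrightarrow> list_all (\<lambda>j. list_all (\<lambda>k. list_all (\<lambda>s.
     j = i \<and> s = 1 \<and> (i = 0 \<or> k = 0) \<or> in_cone i (j, k, s)) [1, -1]) [0..14]) [0, 1, 2]"


text \<open>Cramer's rule multiplied out, so that no assumption on the determinant enters.\<close>

lemma cramer3:
  fixes a b c q :: "real^3"
  shows "(a \<bullet> cross3 b c) *\<^sub>R q =
    (q \<bullet> cross3 b c) *\<^sub>R a + (a \<bullet> cross3 q c) *\<^sub>R b + (a \<bullet> cross3 b q) *\<^sub>R c"
  by (simp add: vec_eq_iff forall_3 cross3_def inner_real3 algebra_simps)

lemma norm_cross3_le: "norm (cross3 x y) \<le> norm x * norm y"
  by (rule power2_le_imp_le) (simp_all add: norm_cross power_mult_distrib)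

text \<open>The three factors are replaced one after the other, each at a cost of at most
  \<open>e * m\<^sup>2\<close>.\<close>

lemma triple_product_error:
  fixes x y z x' y' z' :: "real^3"
  assumes "norm (x - x') \<le> e" "norm (y - y') \<le> e" "norm (z - z') \<le> e"
    and "norm x \<le> m" "norm y' \<le> m" "norm z' \<le> m" "norm y \<le> m"
  shows "\<bar>x \<bullet> cross3 y z - x' \<bullet> cross3 y' z'\<bar> \<le> 3 * e * m\<^sup>2"
proof -
  have "0 \<le> e" "0 \<le> m"
    using assms(1,4) norm_ge_zero order_trans by blast+
  have split: "x \<bullet> cross3 y z - x' \<bullet> cross3 y' z' =
      (x - x') \<bullet> cross3 y' z' + x \<bullet> cross3 (y - y') z' + x \<bullet> cross3 y (z - z')"
    by (simp add: cross3_def inner_real3 algebra_simps)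
  have bound: "\<bar>a \<bullet> cross3 b c\<bar> \<le> norm a * (norm b * norm c)" for a b c :: "real^3"
    by (rule order_trans[OF Cauchy_Schwarz_ineq2]) (intro mult_left_mono norm_cross3_le norm_ge_zero)
  have "\<bar>(x - x') \<bullet> cross3 y' z'\<bar> \<le> e * (m * m)" "\<bar>x \<bullet> cross3 (y - y') z'\<bar> \<le> m * (e * m)"
    "\<bar>x \<bullet> cross3 y (z - z')\<bar> \<le> m * (m * e)"
    by (rule order_trans[OF bound], intro mult_mono; use assms \<open>0 \<le> e\<close> \<open>0 \<le> m\<close> in simp)+
  then show ?thesis
    unfolding split by (simp add: power2_eq_square algebra_simps)
qed

lemma edge_error:
  assumes "p \<in> vertices" "q \<in> vertices"
  shows "norm (100000 *\<^sub>R (vertex_point q - vertex_point p) - real_vec (isub (approx q) (approx p))) \<le> 1.8"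
proof -
  have "100000 *\<^sub>R (vertex_point q - vertex_point p) - real_vec (isub (approx q) (approx p)) =
      (100000 *\<^sub>R vertex_point q - real_vec (approx q)) - (100000 *\<^sub>R vertex_point p - real_vec (approx p))"
    by (simp add: real_vec_sub scaleR_diff_right)
  then show ?thesis
    using norm_triangle_ineq4[of "100000 *\<^sub>R vertex_point q - real_vec (approx q)"
        "100000 *\<^sub>R vertex_point p - real_vec (approx p)"] approx_error[OF assms(1)] approx_error[OF assms(2)]
    by simp
qed

lemma in_triple_imp_cone:
  assumes i: "i \<in> {0, 1, 2}" and vs: "q \<in> vertices" "a \<in> vertices" "b \<in> vertices" "c \<in> vertices"
    and triple: "in_triple i q (a, b, c)"
  obtains \<alpha> \<beta> \<gamma> where "\<alpha> \<ge> 0" "\<beta> \<ge> 0" "\<gamma> \<ge> 0"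
    "vertex_point q - base_point i = \<alpha> *\<^sub>R (vertex_point a - base_point i)
      + \<beta> *\<^sub>R (vertex_point b - base_point i) + \<gamma> *\<^sub>R (vertex_point c - base_point i)"
proof -
  define E where "E p = 100000 *\<^sub>R (vertex_point p - base_point i)" for p
  define F where "F p = real_vec (edge i p)" for p
  have base: "(i, 0, 1) \<in> vertices" "vertex_point (i, 0, 1) = base_point i"
    using i by (auto simp: vertices_def)
  have EF: "norm (E p - F p) \<le> 1.8" if "p \<in> vertices" for p
    using edge_error[OF base(1) that] base(2) by (simp add: E_def F_def edge_def)
  have E: "norm (E p) \<le> 200002" if "p \<in> vertices" for p
    using norm_triangle_ineq4[of "vertex_point p" "base_point i"] norm_vertex[OF that] norm_base_point[of i]
    by (simp add: E_def)
  have F: "norm (F p) \<le> 200002" if "p \<in> vertices" for p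
    using EF[OF that] norm_triangle_ineq2[of "F p" "E p"] norm_triangle_ineq4[of "vertex_point p" "base_point i"]
      norm_vertex[OF that] norm_base_point[of i]
    by (simp add: E_def norm_minus_commute)
  have pos: "E x \<bullet> cross3 (E y) (E z) > 0"
    if v: "x \<in> vertices" "y \<in> vertices" "z \<in> vertices"
      and "300000000000 \<le> idet (edge i x) (edge i y) (edge i z)" for x y z
  proof -
    have "real_of_int (idet (edge i x) (edge i y) (edge i z)) = F x \<bullet> cross3 (F y) (F z)"
      by (simp add: idet_def F_def inner_real_vec flip: real_vec_cross)
    moreover have "300000000000 \<le> real_of_int (idet (edge i x) (edge i y) (edge i z))"
      using that(4) by linarith
    \<comment> \<open>An edge has error at most 1.8 = 2 * 0.9, and its scaled length is at most
      200000 plus that error.\<close>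
    moreover have "\<bar>E x \<bullet> cross3 (E y) (E z) - F x \<bullet> cross3 (F y) (F z)\<bar> \<le> 3 * 1.8 * 200002\<^sup>2"
      using v by (intro triple_product_error EF E F)
    ultimately show ?thesis
      unfolding abs_le_iff by simp
  qed
  define d where "d = E a \<bullet> cross3 (E b) (E c)"
  have d: "d > 0" "E q \<bullet> cross3 (E b) (E c) > 0" "E a \<bullet> cross3 (E q) (E c) > 0" "E a \<bullet> cross3 (E b) (E q) > 0"
    using triple by (auto simp: d_def intro!: pos vs)
  have "d *\<^sub>R E q = (E q \<bullet> cross3 (E b) (E c)) *\<^sub>R E a + (E a \<bullet> cross3 (E q) (E c)) *\<^sub>R E b
      + (E a \<bullet> cross3 (E b) (E q)) *\<^sub>R E c"
    unfolding d_def by (rule cramer3)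
  then have "(1 / d) *\<^sub>R d *\<^sub>R E q = (E q \<bullet> cross3 (E b) (E c) / d) *\<^sub>R E a
      + (E a \<bullet> cross3 (E q) (E c) / d) *\<^sub>R E b + (E a \<bullet> cross3 (E b) (E q) / d) *\<^sub>R E c"
    by (simp add: scaleR_add_right)
  then have "E q = (E q \<bullet> cross3 (E b) (E c) / d) *\<^sub>R E a
      + (E a \<bullet> cross3 (E q) (E c) / d) *\<^sub>R E b + (E a \<bullet> cross3 (E b) (E q) / d) *\<^sub>R E c"
    using d(1) by simp
  then have "100000 *\<^sub>R (vertex_point q - base_point i) =
      100000 *\<^sub>R ((E q \<bullet> cross3 (E b) (E c) / d) *\<^sub>R (vertex_point a - base_point i)
      + (E a \<bullet> cross3 (E q) (E c) / d) *\<^sub>R (vertex_point b - base_point i)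
      + (E a \<bullet> cross3 (E b) (E q) / d) *\<^sub>R (vertex_point c - base_point i))"
    \<comment> \<open>Occurrences 1, 5, 9 and 13 are the four edge vectors; those inside the
      determinants stay folded.\<close>
    by (subst (asm) (1 5 9 13) E_def) (simp add: scaleR_add_right mult.commute)
  then have "vertex_point q - base_point i =
      (E q \<bullet> cross3 (E b) (E c) / d) *\<^sub>R (vertex_point a - base_point i)
      + (E a \<bullet> cross3 (E q) (E c) / d) *\<^sub>R (vertex_point b - base_point i)
      + (E a \<bullet> cross3 (E b) (E q) / d) *\<^sub>R (vertex_point c - base_point i)"
    by (simp only: scaleR_cancel_left) simp
  then show ?thesis
    using d by (intro that) auto
qed

text \<open>The vertices of the top face are coplanar, so numerical determinants cannot decide this case.\<close>

lemma top_face_cone: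
  assumes "0 \<le> k" "k \<le> 14"
  obtains \<alpha> \<beta> where "\<alpha> \<ge> 0" "\<beta> \<ge> 0"
    "vertex_point (0, k, 1) - base_point 0 = \<alpha> *\<^sub>R (vertex_point (0, 1, 1) - base_point 0)
      + \<beta> *\<^sub>R (vertex_point (0, 14, 1) - base_point 0)"
proof -
  define h where "h = pi / 15"
  define x where "x = real_of_int k * h"
  \<comment> \<open>On the unit circle the chord from angle 0 to angle \<open>2 * x\<close> is
    \<open>2 * sin x\<close> times (- sin x, cos x). Expressing it by the chords to
    \<open>2 * h\<close> and \<open>- 2 * h\<close> and solving the two linear equations gives these
    coefficients.\<close>
  define \<alpha> where "\<alpha> = sin x * sin (x + h) / (2 * (sin h)\<^sup>2 * cos h)"
  define \<beta> where "\<beta> = sin x * sin (x - h) / (2 * (sin h)\<^sup>2 * cos h)"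
  have h: "sin h > 0" "cos h > 0"
    by (auto simp: h_def intro!: sin_gt_zero cos_gt_zero)
  have x: "0 \<le> x" "x + h \<le> pi"
    using assms by (simp_all add: x_def h_def field_simps)
  \<comment> \<open>For \<open>k = 0\<close> the second factor is negative, but then
    \<open>sin x\<close> vanishes.\<close>
  have "sin x * sin (x - h) \<ge> 0"
  proof (cases "k = 0")
    case False
    then have "h \<le> x"
      using assms by (simp add: x_def h_def)
    moreover have "0 \<le> h"
      by (simp add: h_def)
    ultimately show ?thesis
      using x by (intro mult_nonneg_nonneg sin_ge_zero) linarith+
  qed (simp add: x_def)
  moreover have "sin x * sin (x + h) \<ge> 0"
    using x by (intro mult_nonneg_nonneg sin_ge_zero) (auto simp: h_def)
  ultimately have nonneg: "\<alpha> \<ge> 0" "\<beta> \<ge> 0"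
    using h by (simp_all add: \<alpha>_def \<beta>_def)
  have one: "(cos x)\<^sup>2 + (sin x)\<^sup>2 = 1" "(cos h)\<^sup>2 + (sin h)\<^sup>2 = 1"
    by simp_all
  have ab: "\<alpha> * (2 * (sin h)\<^sup>2 * cos h) = sin x * sin (x + h)" "\<beta> * (2 * (sin h)\<^sup>2 * cos h) = sin x * sin (x - h)"
    using h by (simp_all add: \<alpha>_def \<beta>_def)
  have angle: "2 * pi * real_of_int k / 15 = 2 * x" "2 * pi * real_of_int 1 / 15 = 2 * h"
    by (simp_all add: x_def h_def)
  have trig: "cos15 k = 1 - 2 * (sin x)\<^sup>2" "sin15 k = 2 * sin x * cos x"
    "cos15 1 = 1 - 2 * (sin h)\<^sup>2" "sin15 1 = 2 * sin h * cos h"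
    unfolding cos15_def sin15_def angle by (simp_all only: cos_double_sin sin_double)
  have trig14: "cos15 14 = cos15 1" "sin15 14 = - sin15 1"
    using cos15_sin15_diff_15[of 1] by simp_all
  have "(cos15 k - 1) * (2 * (sin h)\<^sup>2 * cos h) = (\<alpha> * (cos15 1 - 1) + \<beta> * (cos15 1 - 1)) * (2 * (sin h)\<^sup>2 * cos h)"
    using ab one unfolding trig sin_add sin_diff by algebra
  then have c: "cos15 k - 1 = \<alpha> * (cos15 1 - 1) + \<beta> * (cos15 1 - 1)"
    using h by simp
  have "sin15 k * (2 * (sin h)\<^sup>2 * cos h) = (\<alpha> * sin15 1 - \<beta> * sin15 1) * (2 * (sin h)\<^sup>2 * cos h)"
    using ab one unfolding trig sin_add sin_diff by algebra
  then have s: "sin15 k = \<alpha> * sin15 1 - \<beta> * sin15 1"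
    using h by simp
  have "vertex_point (0, k, 1) - base_point 0 = \<alpha> *\<^sub>R (vertex_point (0, 1, 1) - base_point 0)
      + \<beta> *\<^sub>R (vertex_point (0, 14, 1) - base_point 0)"
  proof -
    define r where "r = base_point 0 $ 1"
    have "base_point 0 $ 2 = 0"
      by (simp add: base_point_def D1_def)
    moreover have "(cos15 k - 1) * r = (\<alpha> * (cos15 1 - 1) + \<beta> * (cos15 1 - 1)) * r"
      "sin15 k * r = (\<alpha> * sin15 1 - \<beta> * sin15 1) * r"
      using c s by simp_all
    ultimately show ?thesis
      by (simp add: vec_eq_iff forall_3 symmetry_component trig14 algebra_simps flip: r_def)
  qed
  then show ?thesis
    using that nonneg by blast
qed

lemma base_neighbours_vertices: "set (base_neighbours i) \<subseteq> vertices"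
  by (auto simp: base_neighbours_def vertices_def)

lemma cone_triples_neighbours:
  "(a, b, c) \<in> set (cone_triples i) \<Longrightarrow> {a, b, c} \<subseteq> set (base_neighbours i)"
  by (auto simp: cone_triples_def base_neighbours_def split: if_splits)

text \<open>The three generators may coincide, so the definition also covers a single neighbour,
  combinations of two, and \<open>P\<close> itself.\<close>

definition in_vertex_cone :: "real^3 \<Rightarrow> (real^3) set \<Rightarrow> real^3 \<Rightarrow> bool" where
  "in_vertex_cone P N Q \<longleftrightarrow> (\<exists>A\<in>N. \<exists>B\<in>N. \<exists>C\<in>N. \<exists>a\<ge>0. \<exists>b\<ge>0. \<exists>c\<ge>0.
     Q - P = a *\<^sub>R (A - P) + b *\<^sub>R (B - P) + c *\<^sub>R (C - P))"

lemma base_cone: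
  assumes conv: "convex_position i" and i: "i \<in> {0, 1, 2}" and q: "q \<in> vertices"
  shows "in_vertex_cone (base_point i) (vertex_point ` set (base_neighbours i)) (vertex_point q)"
proof -
  obtain j l s where q': "q = (j, l, s)" "j \<in> {0, 1, 2}" "s \<in> {1, -1}"
    using q by (auto simp: vertices_def)
  define k where "k = l mod 15"
  have k: "0 \<le> k" "k \<le> 14"
    using pos_mod_bound[of 15 l] unfolding k_def by auto
  have eq: "vertex_point q = vertex_point (j, k, s)"
    unfolding q' k_def by (rule vertex_point_mod_15[symmetric])
  have v: "(j, k, s) \<in> vertices"
    using q' by (simp add: vertices_def)
  have "j = i \<and> s = 1 \<and> (i = 0 \<or> k = 0) \<or> in_cone i (j, k, s)"
    using conv k q'(2,3) unfolding convex_position_def list_all_iff by auto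
  moreover have ?thesis if "j = i \<and> s = 1 \<and> k = 0"
  proof -
    define N where "N = vertex_point (hd (base_neighbours i))"
    have "N \<in> vertex_point ` set (base_neighbours i)"
      unfolding N_def by (intro imageI hd_in_set) (simp add: base_neighbours_def)
    moreover have "vertex_point q - base_point i = 0 *\<^sub>R (N - base_point i)
        + 0 *\<^sub>R (N - base_point i) + 0 *\<^sub>R (N - base_point i)"
      using that unfolding eq by simp
    ultimately show ?thesis
      unfolding in_vertex_cone_def by (metis order_refl)
  qed
  moreover have ?thesis if "j = i \<and> s = 1 \<and> i = 0"
  proof -
    obtain \<alpha> \<beta> where "\<alpha> \<ge> 0" "\<beta> \<ge> 0" and
      eq0: "vertex_point (0, k, 1) - base_point 0 = \<alpha> *\<^sub>R (vertex_point (0, 1, 1) - base_point 0)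
        + \<beta> *\<^sub>R (vertex_point (0, 14, 1) - base_point 0)"
      using top_face_cone[OF k] by blast
    moreover have "vertex_point (0, 1, 1) \<in> vertex_point ` set (base_neighbours 0)"
      "vertex_point (0, 14, 1) \<in> vertex_point ` set (base_neighbours 0)"
      by (intro imageI; simp add: base_neighbours_def)+
    moreover have "vertex_point (0, k, 1) - base_point 0 = \<alpha> *\<^sub>R (vertex_point (0, 1, 1) - base_point 0)
        + \<beta> *\<^sub>R (vertex_point (0, 14, 1) - base_point 0) + 0 *\<^sub>R (vertex_point (0, 14, 1) - base_point 0)"
      using eq0 by simp
    ultimately show ?thesis
      using that unfolding eq in_vertex_cone_def by (metis order_refl)
  qed
  moreover have ?thesis if "in_cone i (j, k, s)"
  proof -
    have "(j, k, s) \<in> set (base_neighbours i) \<or> (\<exists>t\<in>set (cone_triples i). in_triple i (j, k, s) t)"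
      using that by (simp add: in_cone_def list_ex_iff)
    then consider "(j, k, s) \<in> set (base_neighbours i)"
      | a b c where "(a, b, c) \<in> set (cone_triples i)" "in_triple i (j, k, s) (a, b, c)"
      by (metis prod_cases3)
    then show ?thesis
    proof cases
      case 1
      then have "vertex_point q \<in> vertex_point ` set (base_neighbours i)"
        unfolding eq by (rule imageI)
      moreover have "vertex_point q - base_point i = 1 *\<^sub>R (vertex_point q - base_point i)
          + 0 *\<^sub>R (vertex_point q - base_point i) + 0 *\<^sub>R (vertex_point q - base_point i)"
        by simp
      ultimately show ?thesis
        unfolding in_vertex_cone_def by (metis order_refl zero_le_one)
    next
      case 2
      have nb: "{a, b, c} \<subseteq> set (base_neighbours i)"
        by (rule cone_triples_neighbours[OF 2(1)])
      then have "a \<in> vertices" "b \<in> vertices" "c \<in> vertices"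
        using base_neighbours_vertices by blast+
      then show ?thesis
        using in_triple_imp_cone[OF i v _ _ _ 2(2)] nb
        unfolding in_vertex_cone_def eq by (metis image_eqI insert_subset)
    qed
  qed
  ultimately show ?thesis
    by blast
qed

lemma neighbours_vertices: "p \<in> vertices \<Longrightarrow> set (neighbours p) \<subseteq> vertices"
  using base_neighbours_vertices by (fastforce simp: vertices_def)

lemma vertex_cone:
  assumes conv: "\<And>i. i \<in> {0, 1, 2} \<Longrightarrow> convex_position i" and p: "p \<in> vertices" and q: "q \<in> vertices"
  shows "in_vertex_cone (vertex_point p) (vertex_point ` set (neighbours p)) (vertex_point q)"
proof -
  obtain i k s where p': "p = (i, k, s)" "i \<in> {0, 1, 2}" and s: "s \<in> {1, -1}"
    using p by (auto simp: vertices_def)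
  obtain j l t where q': "q = (j, l, t)"
    by (cases q)
  \<comment> \<open>The inverse of the symmetry that carries the base point to \<open>p\<close>,
    applied to the name of \<open>q\<close>; the sign \<open>s\<close> is its own inverse.\<close>
  define q0 where "q0 = (j, l - k, s * t)"
  have "q0 \<in> vertices"
    using q s by (auto simp: q0_def q' vertices_def)
  have q_eq: "vertex_point q = symmetry k s (vertex_point q0)"
    using s unfolding q0_def symmetry_vertex by (auto simp: q')
  have p_eq: "vertex_point p = symmetry k s (base_point i)"
    by (simp add: p')
  have img: "symmetry k s N \<in> vertex_point ` set (neighbours p)"
    if "N \<in> vertex_point ` set (base_neighbours i)" for N
  proof -
    obtain j' l' t' where N: "(j', l', t') \<in> set (base_neighbours i)" "N = vertex_point (j', l', t')"
      using \<open>N \<in> _\<close> by auto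
    then have "(j', k + l', s * t') \<in> set (neighbours p)"
      unfolding p' by force
    then show ?thesis
      unfolding N(2) symmetry_vertex by (rule imageI)
  qed
  obtain A B C a b c where
    ABC: "A \<in> vertex_point ` set (base_neighbours i)" "B \<in> vertex_point ` set (base_neighbours i)"
      "C \<in> vertex_point ` set (base_neighbours i)" and abc: "a \<ge> 0" "b \<ge> 0" "c \<ge> 0" and
    eq: "vertex_point q0 - base_point i = a *\<^sub>R (A - base_point i) + b *\<^sub>R (B - base_point i) + c *\<^sub>R (C - base_point i)"
    using base_cone[OF conv[OF p'(2)] p'(2) \<open>q0 \<in> vertices\<close>] unfolding in_vertex_cone_def by blast
  note lin = linear_diff[OF linear_symmetry] linear_add[OF linear_symmetry] linear_cmul[OF linear_symmetry]
  have "vertex_point q - vertex_point p = a *\<^sub>R (symmetry k s A - vertex_point p)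
      + b *\<^sub>R (symmetry k s B - vertex_point p) + c *\<^sub>R (symmetry k s C - vertex_point p)"
    using arg_cong[OF eq, of "symmetry k s"] unfolding q_eq p_eq by (simp only: lin)
  then show ?thesis
    unfolding in_vertex_cone_def using abc img[OF ABC(1)] img[OF ABC(2)] img[OF ABC(3)] by blast
qed

lemma convex_position: "i \<in> {0, 1, 2} \<Longrightarrow> convex_position i"
proof -
  have "list_all convex_position [0, 1, 2]"
    by code_simp
  then show "i \<in> {0, 1, 2} \<Longrightarrow> convex_position i"
    by auto
qed

section \<open>Certificates for blocked directions\<close>

definition form_nonneg :: "int \<Rightarrow> ivec \<Rightarrow> ivec \<Rightarrow> ivec \<Rightarrow> ivec \<Rightarrow> ivec \<Rightarrow> bool" where
  "form_nonneg e a d u v w \<longleftrightarrow>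
     idot a u * idot d u \<le> e * idot u u \<and>
     idot a v * idot d v \<le> e * idot v v \<and>
     idot a w * idot d w \<le> e * idot w w \<and>
     idot a u * idot d v + idot a v * idot d u \<le> 2 * (e * idot u v) \<and>
     idot a v * idot d w + idot a w * idot d v \<le> 2 * (e * idot v w) \<and>
     idot a w * idot d u + idot a u * idot d w \<le> 2 * (e * idot w u)"

text \<open>With this first argument the tested form is
  \<open>shadow_inner X a d - 4400000 * (X \<bullet> X)\<close> for the real vectors of
  \<open>a\<close> and \<open>d\<close>. The length bound is 45900 squared.\<close>

definition edge_ok :: "ivec \<Rightarrow> ivec \<Rightarrow> ivec \<Rightarrow> ivec \<Rightarrow> ivec \<Rightarrow> bool" where
  "edge_ok a d u v w \<longleftrightarrow> idot d d \<le> 2106810000 \<and> form_nonneg (idot a d - 4400000) a d u v w"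

text \<open>On vectors with nonnegative coordinates the coordinate sum is at least the norm. This
  linear inequality at the generators therefore yields the lower bound \<open>r * norm X\<close> for
  the inner product with \<open>a\<close> on the whole cone.\<close>

definition dominates :: "int \<Rightarrow> ivec \<Rightarrow> ivec \<Rightarrow> bool" where
  "dominates r a u \<longleftrightarrow> r * idot (1, 1, 1) u \<le> idot a u"

fun is_vertex :: "vertex \<Rightarrow> bool" where
  "is_vertex (i, k, s) \<longleftrightarrow> (i = 0 \<or> i = 1 \<or> i = 2) \<and> (s = 1 \<or> s = -1)"

text \<open>The number 62 exceeds 100000 * 0.0006 plus the rounding error 0.9.\<close>

definition locmax_ok :: "vertex \<Rightarrow> ivec \<Rightarrow> ivec \<Rightarrow> ivec \<Rightarrow> bool" where
  "locmax_ok p u v w \<longleftrightarrow> is_vertex p \<and>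
     dominates 62 (approx p) u \<and> dominates 62 (approx p) v \<and> dominates 62 (approx p) w \<and>
     list_all (\<lambda>n. edge_ok (approx p) (isub (approx p) (approx n)) u v w) (neighbours p)"

text \<open>Puts the cone strictly on the positive side of the plane through the origin and the
  vertices \<open>p\<close> and \<open>q\<close>. The margin 200000 exceeds the rounding error of
  the cross product, which is below 190000.\<close>

definition side_ok :: "vertex \<Rightarrow> vertex \<Rightarrow> ivec \<Rightarrow> ivec \<Rightarrow> ivec \<Rightarrow> bool" where
  "side_ok p q u v w \<longleftrightarrow>
     dominates 200000 (icross (approx p) (approx q)) u \<and>
     dominates 200000 (icross (approx p) (approx q)) v \<and>
     dominates 200000 (icross (approx p) (approx q)) w"

text \<open>\<open>covered A u v w c\<close> checks that the cone generated by \<open>u\<close>, \<open>v\<close>, \<open>w\<close> consists of blocked directions, where the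
  vertices in \<open>A\<close> are already known to be locally farthest on it. \<open>Claim\<close> adds a vertex to \<open>A\<close>, \<open>Leaf\<close> uses
  three vertices of \<open>A\<close> whose cone contains the current one, and \<open>Split\<close> cuts the cone in two.\<close>

datatype cert =
    Leaf vertex vertex vertex
  | Claim vertex cert
  | Turn cert
  | Split int int int ivec cert cert

primrec covered :: "vertex list \<Rightarrow> ivec \<Rightarrow> ivec \<Rightarrow> ivec \<Rightarrow> cert \<Rightarrow> bool" where
  "covered A u v w (Leaf p q r) \<longleftrightarrow>
     p \<in> set A \<and> q \<in> set A \<and> r \<in> set A \<and>
     side_ok p q u v w \<and> side_ok q r u v w \<and> side_ok r p u v w"
| "covered A u v w (Claim p c) \<longleftrightarrow> locmax_ok p u v w \<and> covered (p # A) u v w c"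
| "covered A u v w (Turn c) \<longleftrightarrow> covered A v w u c"
| "covered A u v w (Split a b g m c d) \<longleftrightarrow>
     0 < a \<and> 0 < b \<and> 0 < g \<and> iscale g m = iadd (iscale a u) (iscale b v) \<and>
     covered A u m w c \<and> covered A m v w d"


section \<open>Soundness of the certificate checks\<close>

lemma is_vertex_iff: "is_vertex p \<longleftrightarrow> p \<in> vertices"
  by (cases p) (simp add: vertices_def)

text \<open>In \<open>P - Q\<close> the left side of the margin inequality is sublinear and the
  right side is linear, so the inequality passes from the generators of the vertex cone to all its
  elements, in particular to all other vertices.\<close>

lemma farthest_if_neighbours:
  assumes p: "p \<in> vertices" and pos: "0.0006 * norm X \<le> X \<bullet> vertex_point p"
    and nb: "\<And>n. n \<in> set (neighbours p) \<Longrightarrow>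
      0.000905 * norm (vertex_point p - vertex_point n) * (X \<bullet> X)
        \<le> shadow_inner X (vertex_point p) (vertex_point p - vertex_point n)"
  shows "farthest X (vertex_point p)"
  unfolding farthest_def
proof (intro conjI ballI pos)
  fix Q
  assume "Q \<in> ruperthedron"
  then obtain q where q: "q \<in> vertices" "Q = vertex_point q"
    by (auto simp: ruperthedron_eq)
  define P where "P = vertex_point p"
  obtain A B C a b c where
    ABC: "A \<in> vertex_point ` set (neighbours p)" "B \<in> vertex_point ` set (neighbours p)"
      "C \<in> vertex_point ` set (neighbours p)" and abc: "a \<ge> 0" "b \<ge> 0" "c \<ge> 0" and
    "Q - P = a *\<^sub>R (A - P) + b *\<^sub>R (B - P) + c *\<^sub>R (C - P)"
    using vertex_cone[OF convex_position p q(1)] unfolding in_vertex_cone_def P_def q(2) by blast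
  then have eq: "P - Q = a *\<^sub>R (P - A) + b *\<^sub>R (P - B) + c *\<^sub>R (P - C)"
    by (metis (no_types, lifting) minus_add_distrib minus_diff_eq scaleR_minus_right)
  have nb': "0.000905 * norm (P - N) * (X \<bullet> X) \<le> shadow_inner X P (P - N)"
    if "N \<in> vertex_point ` set (neighbours p)" for N
    using nb that by (auto simp: P_def)
  have "norm (P - Q) \<le> a * norm (P - A) + b * norm (P - B) + c * norm (P - C)"
    unfolding eq using abc by (intro norm_triangle_le add_mono) simp_all
  then have "0.000905 * norm (P - Q) * (X \<bullet> X)
      \<le> 0.000905 * (a * norm (P - A) + b * norm (P - B) + c * norm (P - C)) * (X \<bullet> X)"
    by (intro mult_right_mono mult_left_mono) simp_all
  also have "\<dots> = a * (0.000905 * norm (P - A) * (X \<bullet> X)) + b * (0.000905 * norm (P - B) * (X \<bullet> X))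
      + c * (0.000905 * norm (P - C) * (X \<bullet> X))"
    by (simp add: algebra_simps)
  also have "\<dots> \<le> a * shadow_inner X P (P - A) + b * shadow_inner X P (P - B) + c * shadow_inner X P (P - C)"
    using abc ABC by (intro add_mono mult_left_mono nb')
  also have "\<dots> = shadow_inner X P (P - Q)"
    unfolding eq by (simp add: shadow_inner_add_right shadow_inner_scale_right)
  finally show "0.000905 * norm (vertex_point p - Q) * (X \<bullet> X)
      \<le> shadow_inner X (vertex_point p) (vertex_point p - Q)"
    by (simp add: P_def)
qed

lemma norm_approx_le:
  assumes "p \<in> vertices"
  shows "norm (real_vec (approx p)) \<le> 100001"
  using approx_error[OF assms] norm_vertex[OF assms]
    norm_triangle_ineq2[of "real_vec (approx p)" "100000 *\<^sub>R vertex_point p"]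
  by (simp add: norm_minus_commute)

text \<open>The constant \<open>4400000\<close> covers \<open>0.000905 * 0.46\<close>, scaled by \<open>10 ^ 10\<close>, plus the rounding errors;
  \<open>0.46\<close> bounds the length of the edges.\<close>

lemma neighbour_condition:
  fixes X :: "real^3"
  assumes p: "p \<in> vertices" and n: "n \<in> vertices"
    and len: "idot (isub (approx p) (approx n)) (isub (approx p) (approx n)) \<le> 2106810000"
    and form: "4400000 * (X \<bullet> X) \<le> shadow_inner X (real_vec (approx p)) (real_vec (isub (approx p) (approx n)))"
  shows "0.000905 * norm (vertex_point p - vertex_point n) * (X \<bullet> X)
    \<le> shadow_inner X (vertex_point p) (vertex_point p - vertex_point n)"
proof -
  define a where "a = real_vec (approx p)"
  define d where "d = real_vec (isub (approx p) (approx n))"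
  define P where "P = 100000 *\<^sub>R vertex_point p"
  define D where "D = 100000 *\<^sub>R (vertex_point p - vertex_point n)"
  have ea: "norm (P - a) \<le> 0.9"
    unfolding P_def a_def by (rule approx_error[OF p])
  have ed: "norm (D - d) \<le> 1.8"
    unfolding D_def d_def by (rule edge_error[OF n p])
  have na: "norm a \<le> 100001"
    unfolding a_def by (rule norm_approx_le[OF p])
  have "real_of_int (idot (isub (approx p) (approx n)) (isub (approx p) (approx n))) \<le> 2106810000"
    using len by linarith
  then have "(norm d)\<^sup>2 \<le> 45900\<^sup>2"
    by (simp add: d_def power2_norm_eq_inner inner_real_vec)
  then have "norm d \<le> 45900"
    by (rule power2_le_imp_le) simp
  then have nD: "norm D \<le> 46000"
    using ed norm_triangle_ineq2[of D d] by simp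
  have "\<bar>shadow_inner X (P - a) D\<bar> \<le> 0.9 * 46000 * (X \<bullet> X)"
    by (rule order_trans[OF abs_shadow_inner_le]) (intro mult_right_mono mult_mono; use ea nD in simp)
  moreover have "\<bar>shadow_inner X a (D - d)\<bar> \<le> 100001 * 1.8 * (X \<bullet> X)"
    by (rule order_trans[OF abs_shadow_inner_le]) (intro mult_right_mono mult_mono; use na ed in simp)
  moreover have "shadow_inner X P D = shadow_inner X a d + shadow_inner X (P - a) D + shadow_inner X a (D - d)"
    by (simp add: shadow_inner_def inner_diff_left inner_diff_right algebra_simps)
  \<comment> \<open>The two errors are 41400 and about 180002, so more than 4170000 remains of
    4400000, while 0.000905 * 0.46 * 10^10 is only 4163000.\<close>
  ultimately have "4170000 * (X \<bullet> X) \<le> shadow_inner X P D"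
    using form unfolding abs_le_iff a_def[symmetric] d_def[symmetric] by simp
  then have "4170000 / 10000000000 * (X \<bullet> X) \<le> shadow_inner X (vertex_point p) (vertex_point p - vertex_point n)"
    by (simp add: P_def D_def shadow_inner_scale_left shadow_inner_scale_right)
  moreover have "0.000905 * norm (vertex_point p - vertex_point n) * (X \<bullet> X) \<le> 4170000 / 10000000000 * (X \<bullet> X)"
  proof (intro mult_right_mono inner_ge_zero)
    have "norm (vertex_point p - vertex_point n) \<le> 0.46"
      using nD by (simp add: D_def)
    then show "0.000905 * norm (vertex_point p - vertex_point n) \<le> 4170000 / 10000000000"
      by simp
  qed
  ultimately show ?thesis
    by (rule order_trans[rotated])
qed

definition cone3 :: "ivec \<Rightarrow> ivec \<Rightarrow> ivec \<Rightarrow> (real^3) set" where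
  "cone3 u v w = {x *\<^sub>R real_vec u + y *\<^sub>R real_vec v + z *\<^sub>R real_vec w | x y z. 0 \<le> x \<and> 0 \<le> y \<and> 0 \<le> z}"

text \<open>The six inequalities say that the coefficients of the quadratic form in the generators of the cone are
  nonnegative.\<close>

lemma form_nonneg_cone3:
  assumes form: "form_nonneg e a d u v w" and X: "X \<in> cone3 u v w"
  shows "(X \<bullet> real_vec a) * (X \<bullet> real_vec d) \<le> real_of_int e * (X \<bullet> X)"
proof -
  obtain x y z where nonneg: "0 \<le> x" "0 \<le> y" "0 \<le> z"
    and X': "X = x *\<^sub>R real_vec u + y *\<^sub>R real_vec v + z *\<^sub>R real_vec w"
    using X by (auto simp: cone3_def)
  define au av aw du dv dw where "au = real_of_int (idot a u)" "av = real_of_int (idot a v)"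
    "aw = real_of_int (idot a w)" "du = real_of_int (idot d u)" "dv = real_of_int (idot d v)"
    "dw = real_of_int (idot d w)"
  note ad = this
  define E uu vv ww uv vw wu where "E = real_of_int e" "uu = real_of_int (idot u u)"
    "vv = real_of_int (idot v v)" "ww = real_of_int (idot w w)" "uv = real_of_int (idot u v)"
    "vw = real_of_int (idot v w)" "wu = real_of_int (idot w u)"
  note g = this
  have ineqs: "au * du \<le> E * uu" "av * dv \<le> E * vv" "aw * dw \<le> E * ww"
    "au * dv + av * du \<le> 2 * (E * uv)" "av * dw + aw * dv \<le> 2 * (E * vw)" "aw * du + au * dw \<le> 2 * (E * wu)"
    using form[unfolded form_nonneg_def, folded of_int_le_iff[where 'a = real]]
    by (simp_all only: ad g of_int_mult of_int_add of_int_numeral)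
  have idot_commute: "idot s t = idot t s" for s t
    by (cases s; cases t) simp
  have dots: "real_vec u \<bullet> real_vec a = au" "real_vec v \<bullet> real_vec a = av" "real_vec w \<bullet> real_vec a = aw"
    "real_vec u \<bullet> real_vec d = du" "real_vec v \<bullet> real_vec d = dv" "real_vec w \<bullet> real_vec d = dw"
    "real_vec u \<bullet> real_vec u = uu" "real_vec v \<bullet> real_vec v = vv" "real_vec w \<bullet> real_vec w = ww"
    "real_vec u \<bullet> real_vec v = uv" "real_vec v \<bullet> real_vec w = vw" "real_vec w \<bullet> real_vec u = wu"
    "real_vec v \<bullet> real_vec u = uv" "real_vec w \<bullet> real_vec v = vw" "real_vec u \<bullet> real_vec w = wu"
    unfolding inner_real_vec ad g by (simp_all add: idot_commute)
  have Xa: "X \<bullet> real_vec a = x * au + y * av + z * aw" "X \<bullet> real_vec d = x * du + y * dv + z * dw"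
    unfolding X' by (simp_all add: inner_add_left dots)
  have XX: "X \<bullet> X = x * x * uu + y * y * vv + z * z * ww + 2 * (x * y * uv) + 2 * (y * z * vw) + 2 * (z * x * wu)"
    unfolding X' by (simp add: inner_add_left inner_add_right dots algebra_simps)
  have "E * (X \<bullet> X) - (X \<bullet> real_vec a) * (X \<bullet> real_vec d) =
      x * x * (E * uu - au * du) + y * y * (E * vv - av * dv) + z * z * (E * ww - aw * dw)
      + x * y * (2 * (E * uv) - (au * dv + av * du)) + y * z * (2 * (E * vw) - (av * dw + aw * dv))
      + z * x * (2 * (E * wu) - (aw * du + au * dw))"
    unfolding Xa XX by (simp add: algebra_simps)
  also have "\<dots> \<ge> 0"
    using nonneg ineqs by (intro add_nonneg_nonneg mult_nonneg_nonneg) simp_all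
  finally show ?thesis
    by (simp add: g)
qed

lemma dominates_cone3:
  assumes "dominates r a u" "dominates r a v" "dominates r a w" and X: "X \<in> cone3 u v w"
    and pos: "0 \<le> X$1" "0 \<le> X$2" "0 \<le> X$3" and r: "0 \<le> r"
  shows "real_of_int r * norm X \<le> X \<bullet> real_vec a"
proof -
  obtain x y z where nonneg: "0 \<le> x" "0 \<le> y" "0 \<le> z"
    and X': "X = x *\<^sub>R real_vec u + y *\<^sub>R real_vec v + z *\<^sub>R real_vec w"
    using X by (auto simp: cone3_def)
  have gen: "real_of_int r * (real_vec (1, 1, 1) \<bullet> real_vec g) \<le> real_vec a \<bullet> real_vec g" if "dominates r a g" for g
    using that unfolding dominates_def inner_real_vec by (metis of_int_le_iff of_int_mult)
  have "(norm X)\<^sup>2 \<le> (X$1 + X$2 + X$3)\<^sup>2"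
    unfolding power2_norm_eq_inner inner_real3 using pos by (simp add: power2_eq_square algebra_simps)
  then have "norm X \<le> X$1 + X$2 + X$3"
    by (rule power2_le_imp_le) (use pos in simp)
  also have "\<dots> = real_vec (1, 1, 1) \<bullet> X"
    by (simp add: inner_real3)
  finally have "real_of_int r * norm X \<le> real_of_int r * (real_vec (1, 1, 1) \<bullet> X)"
    using r by (intro mult_left_mono) simp_all
  also have "\<dots> = x * (real_of_int r * (real_vec (1, 1, 1) \<bullet> real_vec u))
      + y * (real_of_int r * (real_vec (1, 1, 1) \<bullet> real_vec v)) + z * (real_of_int r * (real_vec (1, 1, 1) \<bullet> real_vec w))"
    unfolding X' by (simp only: inner_add_right inner_scaleR_right) (simp only: algebra_simps)
  also have "\<dots> \<le> x * (real_vec a \<bullet> real_vec u) + y * (real_vec a \<bullet> real_vec v) + z * (real_vec a \<bullet> real_vec w)"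
    using nonneg assms by (intro add_mono mult_left_mono gen)
  also have "\<dots> = real_vec a \<bullet> X"
    unfolding X' by (simp add: inner_add_right)
  also have "\<dots> = X \<bullet> real_vec a"
    by (rule inner_commute)
  finally show ?thesis .
qed

lemma locmax_ok_farthest:
  assumes ok: "locmax_ok p u v w" and X: "X \<in> cone3 u v w" and pos: "0 \<le> X$1" "0 \<le> X$2" "0 \<le> X$3"
  shows "farthest X (vertex_point p)"
proof -
  have p: "p \<in> vertices"
    using ok by (simp add: locmax_ok_def is_vertex_iff)
  show ?thesis
  proof (rule farthest_if_neighbours[OF p])
    have "62 * norm X \<le> X \<bullet> real_vec (approx p)"
      using dominates_cone3[OF _ _ _ X pos, of 62 "approx p"] ok by (simp add: locmax_ok_def)
    moreover have "\<bar>X \<bullet> (100000 *\<^sub>R vertex_point p - real_vec (approx p))\<bar> \<le> norm X * 0.9"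
      by (rule order_trans[OF Cauchy_Schwarz_ineq2]) (intro mult_left_mono approx_error p norm_ge_zero)
    ultimately show "0.0006 * norm X \<le> X \<bullet> vertex_point p"
      unfolding abs_le_iff inner_diff_right by simp
  next
    fix n
    assume n: "n \<in> set (neighbours p)"
    define d where "d = isub (approx p) (approx n)"
    have "edge_ok (approx p) d u v w"
      using ok n by (auto simp: locmax_ok_def list_all_iff d_def)
    then have len: "idot d d \<le> 2106810000" and form: "form_nonneg (idot (approx p) d - 4400000) (approx p) d u v w"
      by (simp_all add: edge_ok_def)
    have "4400000 * (X \<bullet> X) \<le> shadow_inner X (real_vec (approx p)) (real_vec d)"
      using form_nonneg_cone3[OF form X] unfolding shadow_inner_def inner_real_vec by (simp add: left_diff_distrib)
    then show "0.000905 * norm (vertex_point p - vertex_point n) * (X \<bullet> X)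
        \<le> shadow_inner X (vertex_point p) (vertex_point p - vertex_point n)"
      using n neighbours_vertices[OF p] len unfolding d_def by (intro neighbour_condition[OF p]) auto
  qed
qed

lemma side_ok_pos:
  assumes p: "p \<in> vertices" and q: "q \<in> vertices" and ok: "side_ok p q u v w"
    and X: "X \<in> cone3 u v w" and pos: "0 \<le> X$1" "0 \<le> X$2" "0 \<le> X$3" and "X \<noteq> 0"
  shows "X \<bullet> cross3 (vertex_point p) (vertex_point q) > 0"
proof -
  define P where "P = 100000 *\<^sub>R vertex_point p"
  define Q where "Q = 100000 *\<^sub>R vertex_point q"
  define a where "a = real_vec (approx p)"
  define b where "b = real_vec (approx q)"
  have "200000 * norm X \<le> X \<bullet> cross3 a b"
    using dominates_cone3[OF _ _ _ X pos, of 200000 "icross (approx p) (approx q)"] ok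
    by (simp add: side_ok_def a_def b_def real_vec_cross)
  moreover have "\<bar>X \<bullet> (cross3 P Q - cross3 a b)\<bar> \<le> norm X * 190000"
  proof (rule order_trans[OF Cauchy_Schwarz_ineq2], intro mult_left_mono norm_ge_zero)
    have "cross3 P Q - cross3 a b = cross3 (P - a) Q + cross3 a (Q - b)"
      by (simp add: cross3_def vec_eq_iff forall_3 algebra_simps)
    then have "norm (cross3 P Q - cross3 a b) \<le> norm (P - a) * norm Q + norm a * norm (Q - b)"
      using norm_cross3_le[of "P - a" Q] norm_cross3_le[of a "Q - b"] by (metis norm_triangle_mono)
    also have "\<dots> \<le> 0.9 * 100000 + 100001 * 0.9"
      using approx_error[OF p] approx_error[OF q] norm_approx_le[OF p] norm_vertex[OF q]
      by (intro add_mono mult_mono) (simp_all add: P_def Q_def a_def b_def)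
    finally show "norm (cross3 P Q - cross3 a b) \<le> 190000"
      by simp
  qed
  ultimately have "10000 * norm X \<le> X \<bullet> cross3 P Q"
    unfolding abs_le_iff inner_diff_right by simp
  moreover have "norm X > 0"
    using \<open>X \<noteq> 0\<close> by simp
  ultimately have "X \<bullet> cross3 P Q > 0"
    by linarith
  then show ?thesis
    by (simp add: P_def Q_def cross_mult_left cross_mult_right)
qed

text \<open>By Cramer's rule \<open>d *\<^sub>R X\<close> is the combination of the vertices with
  the three given triple products as coefficients. The sign of the determinant \<open>d\<close>
  results from pairing with \<open>X\<close>, because all three vertices have positive inner product
  with \<open>X\<close>.\<close>

lemma leaf_blocked:
  assumes v: "p \<in> vertices" "q \<in> vertices" "r \<in> vertices"
    and far: "farthest X (vertex_point p)" "farthest X (vertex_point q)" "farthest X (vertex_point r)"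
    and pos: "X \<bullet> cross3 (vertex_point p) (vertex_point q) > 0" "X \<bullet> cross3 (vertex_point q) (vertex_point r) > 0"
      "X \<bullet> cross3 (vertex_point r) (vertex_point p) > 0"
    and "X \<noteq> 0"
  shows "blocked X"
proof -
  define P Q R where "P = vertex_point p" "Q = vertex_point q" "R = vertex_point r"
  note PQR = this
  define d where "d = P \<bullet> cross3 Q R"
  define a b c where "a = X \<bullet> cross3 Q R" "b = X \<bullet> cross3 R P" "c = X \<bullet> cross3 P Q"
  note abc = this
  have abc_pos: "a > 0" "b > 0" "c > 0"
    using pos by (simp_all add: abc PQR)
  have inner_pos: "X \<bullet> V > 0" if "farthest X V" for V
    using that \<open>X \<noteq> 0\<close> unfolding farthest_def by (smt (verit) zero_less_norm_iff mult_pos_pos divide_pos_pos zero_less_power)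
  have "P \<bullet> cross3 X R = b" "P \<bullet> cross3 Q X = c"
    by (simp_all add: abc cross3_def inner_real3 algebra_simps)
  then have comb: "d *\<^sub>R X = a *\<^sub>R P + b *\<^sub>R Q + c *\<^sub>R R"
    using cramer3[of P Q R X] by (simp add: d_def abc)
  then have "d * (X \<bullet> X) = a * (X \<bullet> P) + b * (X \<bullet> Q) + c * (X \<bullet> R)"
    by (metis inner_add_right inner_scaleR_right)
  moreover have "\<dots> > 0"
    using abc_pos far inner_pos by (intro add_pos_pos mult_pos_pos) (simp_all add: PQR)
  ultimately have "d * (X \<bullet> X) > 0"
    by simp
  then have "d > 0"
    by (simp add: zero_less_mult_iff) (metis inner_ge_zero not_le)
  have "X = (1 / d) *\<^sub>R d *\<^sub>R X"
    using \<open>d > 0\<close> by simp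
  also have "\<dots> = (a / d) *\<^sub>R P + (b / d) *\<^sub>R Q + (c / d) *\<^sub>R R"
    unfolding comb by (simp add: scaleR_add_right)
  finally have "X = (a / d) *\<^sub>R P + (b / d) *\<^sub>R Q + (c / d) *\<^sub>R R" .
  moreover have "a / d \<ge> 0" "b / d \<ge> 0" "c / d \<ge> 0"
    using abc_pos \<open>d > 0\<close> by simp_all
  moreover have "P \<in> ruperthedron" "Q \<in> ruperthedron" "R \<in> ruperthedron"
    using v by (simp_all add: PQR ruperthedron_eq)
  ultimately show ?thesis
    unfolding blocked_def using far unfolding PQR[symmetric] by blast
qed

text \<open>The ray through \<open>m\<close> divides the face spanned by \<open>u\<close> and
  \<open>v\<close>, and comparing \<open>y * ra\<close> with \<open>x * rb\<close> tells on which
  side a combination lies. The factor \<open>g\<close> allows \<open>m\<close> to be shortened by a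
  common divisor.\<close>

lemma cone3_split:
  assumes pos: "0 < a" "0 < b" "0 < g" and m: "iscale g m = iadd (iscale a u) (iscale b v)"
  shows "cone3 u v w = cone3 u m w \<union> cone3 m v w"
proof -
  define ra rb rg where "ra = real_of_int a" "rb = real_of_int b" "rg = real_of_int g"
  have r: "0 < ra" "0 < rb" "0 < rg"
    using pos by (simp_all add: ra_rb_rg_def)
  have "rg *\<^sub>R real_vec m = ra *\<^sub>R real_vec u + rb *\<^sub>R real_vec v"
    using arg_cong[OF m, of real_vec] by (simp add: real_vec_scale real_vec_add ra_rb_rg_def)
  then have "(1 / rg) *\<^sub>R rg *\<^sub>R real_vec m = (ra / rg) *\<^sub>R real_vec u + (rb / rg) *\<^sub>R real_vec v"
    by (simp add: scaleR_add_right)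
  then have m': "real_vec m = (ra / rg) *\<^sub>R real_vec u + (rb / rg) *\<^sub>R real_vec v"
    using r by simp
  show ?thesis
  proof (intro equalityI subsetI)
    fix X
    assume "X \<in> cone3 u v w"
    then obtain x y z where nonneg: "0 \<le> x" "0 \<le> y" "0 \<le> z"
      and X: "X = x *\<^sub>R real_vec u + y *\<^sub>R real_vec v + z *\<^sub>R real_vec w"
      by (auto simp: cone3_def)
    show "X \<in> cone3 u m w \<union> cone3 m v w"
    proof (cases "y * ra \<le> x * rb")
      case True
      have "X = (x - y * ra / rb) *\<^sub>R real_vec u + (y * rg / rb) *\<^sub>R real_vec m + z *\<^sub>R real_vec w"
        using r unfolding X m' by (simp add: scaleR_add_right scaleR_diff_left)
      moreover have "0 \<le> x - y * ra / rb" "0 \<le> y * rg / rb"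
        using True r nonneg by (simp_all add: field_simps)
      ultimately show ?thesis
        unfolding cone3_def using nonneg(3) by blast
    next
      case False
      have "X = (x * rg / ra) *\<^sub>R real_vec m + (y - x * rb / ra) *\<^sub>R real_vec v + z *\<^sub>R real_vec w"
        using r unfolding X m' by (simp add: scaleR_add_right scaleR_diff_left)
      moreover have "0 \<le> y - x * rb / ra" "0 \<le> x * rg / ra"
        using False r nonneg by (simp_all add: field_simps)
      ultimately show ?thesis
        unfolding cone3_def using nonneg(3) by blast
    qed
  next
    fix X
    assume "X \<in> cone3 u m w \<union> cone3 m v w"
    then show "X \<in> cone3 u v w"
    proof
      assume "X \<in> cone3 u m w"
      then obtain x y z where nonneg: "0 \<le> x" "0 \<le> y" "0 \<le> z"
        and X: "X = x *\<^sub>R real_vec u + y *\<^sub>R real_vec m + z *\<^sub>R real_vec w"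
        by (auto simp: cone3_def)
      have "X = (x + y * (ra / rg)) *\<^sub>R real_vec u + (y * (rb / rg)) *\<^sub>R real_vec v + z *\<^sub>R real_vec w"
        unfolding X m' by (simp add: scaleR_add_right scaleR_add_left)
      moreover have "0 \<le> x + y * (ra / rg)" "0 \<le> y * (rb / rg)"
        using nonneg r by simp_all
      ultimately show ?thesis
        unfolding cone3_def using nonneg(3) by blast
    next
      assume "X \<in> cone3 m v w"
      then obtain x y z where nonneg: "0 \<le> x" "0 \<le> y" "0 \<le> z"
        and X: "X = x *\<^sub>R real_vec m + y *\<^sub>R real_vec v + z *\<^sub>R real_vec w"
        by (auto simp: cone3_def)
      have "X = (x * (ra / rg)) *\<^sub>R real_vec u + (x * (rb / rg) + y) *\<^sub>R real_vec v + z *\<^sub>R real_vec w"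
        unfolding X m' by (simp add: scaleR_add_right scaleR_add_left)
      moreover have "0 \<le> x * (ra / rg)" "0 \<le> x * (rb / rg) + y"
        using nonneg r by simp_all
      ultimately show ?thesis
        unfolding cone3_def using nonneg(3) by blast
    qed
  qed
qed

text \<open>Justifies \<open>Turn\<close>: cycling the generators brings any edge of the cone into
  the position that \<open>Split\<close> cuts.\<close>

lemma cone3_rotate: "cone3 v w u = cone3 u v w"
proof -
  have "x *\<^sub>R real_vec v + y *\<^sub>R real_vec w + z *\<^sub>R real_vec u
      = z *\<^sub>R real_vec u + x *\<^sub>R real_vec v + y *\<^sub>R real_vec w" for x y z
    by simp
  then show ?thesis
    unfolding cone3_def by (intro Collect_cong iffI) metis+
qed

text \<open>Two invariants are carried through the induction: the vertices in \<open>A\<close> are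
  farthest on the entire current cone, and the cone lies in the nonnegative octant, as
  \<open>dominates_cone3\<close> requires. Both are inherited by subcones.\<close>

lemma covered_imp_blocked:
  assumes "covered A u v w c"
    and "\<And>p X. p \<in> set A \<Longrightarrow> X \<in> cone3 u v w \<Longrightarrow> p \<in> vertices \<and> farthest X (vertex_point p)"
    and "\<And>X. X \<in> cone3 u v w \<Longrightarrow> 0 \<le> X$1 \<and> 0 \<le> X$2 \<and> 0 \<le> X$3"
    and "X \<in> cone3 u v w" "X \<noteq> 0"
  shows "blocked X"
  using assms
proof (induction c arbitrary: A u v w)
  case (Leaf p q r)
  note far = Leaf.prems(2)[OF _ Leaf.prems(4)]
  have mem: "p \<in> set A" "q \<in> set A" "r \<in> set A"
    using Leaf.prems(1) by simp_all
  have pos: "0 \<le> X$1" "0 \<le> X$2" "0 \<le> X$3"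
    using Leaf.prems(3)[OF Leaf.prems(4)] by simp_all
  show ?case
    using Leaf.prems(1) far[OF mem(1)] far[OF mem(2)] far[OF mem(3)] \<open>X \<noteq> 0\<close>
    by (intro leaf_blocked[of p q r] side_ok_pos[OF _ _ _ Leaf.prems(4) pos]) auto
next
  case (Claim p c)
  have ok: "locmax_ok p u v w" and cov: "covered (p # A) u v w c"
    using Claim.prems(1) by simp_all
  show ?case
  proof (rule Claim.IH[OF cov _ Claim.prems(3-5)])
    fix q Y
    assume "q \<in> set (p # A)" "Y \<in> cone3 u v w"
    moreover have "p \<in> vertices"
      using ok by (simp add: locmax_ok_def is_vertex_iff)
    ultimately show "q \<in> vertices \<and> farthest Y (vertex_point q)"
      using Claim.prems(2)[of q Y] Claim.prems(3)[of Y] locmax_ok_farthest[OF ok, of Y] by auto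
  qed
next
  case (Turn c)
  show ?case
    by (rule Turn.IH[OF _ Turn.prems(2-5)[folded cone3_rotate[of v w u]]]) (use Turn.prems(1) in simp)
next
  case (Split a b g m c d)
  have eq: "cone3 u v w = cone3 u m w \<union> cone3 m v w"
    using Split.prems(1) by (intro cone3_split[of a b g]) simp_all
  have cov: "covered A u m w c" "covered A m v w d"
    using Split.prems(1) by simp_all
  from Split.prems(4) show ?case
    unfolding eq
  proof
    assume "X \<in> cone3 u m w"
    then show ?case
      by (intro Split.IH(1)[OF cov(1)]) (use eq Split.prems(2,3,5) in blast)+
  next
    assume "X \<in> cone3 m v w"
    then show ?case
      by (intro Split.IH(2)[OF cov(2)]) (use eq Split.prems(2,3,5) in blast)+
  qed
qed

text \<open>Found by a numerical search.\<close>

definition root_cert :: cert where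
  "root_cert =
    Turn (Turn (Split 1 21 1 (29,13,21) (Turn (Split 1 31 1 (60,13,21) (Turn (Turn (Split 1 2 3
    (29,13,14) (Split 1 1 2 (29,13,7) (Claim (1,4,-1) (Turn (Split 4 1 1 (176,65,49) (Claim (2,4,1)
    (Turn (Split 1 6 1 (350,143,49) (Claim (0,5,1) (Leaf (0,5,1) (1,4,-1) (2,4,1))) (Claim (2,12,1)
    (Leaf (1,4,-1) (2,4,1) (2,12,1)))))) (Turn (Split 1 2 1 (118,39,21) (Claim (2,11,-1) (Split 1 1
    2 (89,26,21) (Claim (0,5,1) (Leaf (0,5,1) (1,4,-1) (2,11,-1))) (Claim (1,11,1) (Leaf (1,4,-1)
    (2,11,-1) (1,11,1))))) (Claim (2,4,1) (Split 1 4 1 (234,91,21) (Claim (1,11,1) (Leaf (1,4,-1)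
    (2,4,1) (1,11,1))) (Turn (Split 6 1 1 (350,143,49) (Claim (2,12,1) (Leaf (1,4,-1) (2,4,1)
    (2,12,1))) (Claim (1,11,1) (Leaf (1,4,-1) (2,4,1) (1,11,1)))))))))))) (Turn (Turn (Split 1 2 1
    (118,39,35) (Claim (0,8,-1) (Split 3 5 2 (385,117,119) (Turn (Split 1 12 1 (733,273,287) (Claim
    (0,5,1) (Claim (1,4,-1) (Leaf (0,5,1) (1,4,-1) (0,8,-1)))) (Turn (Split 2 1 1 (118,39,49) (Claim
    (2,4,1) (Split 4 1 1 (234,91,105) (Claim (1,11,1) (Leaf (0,8,-1) (2,4,1) (1,11,1))) (Claim
    (1,4,-1) (Split 1 2 1 (470,169,203) (Claim (1,11,1) (Leaf (1,4,-1) (2,4,1) (1,11,1))) (Turn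
    (Split 6 1 1 (1441,507,581) (Turn (Split 1 3 1 (2851,1014,1190) (Claim (0,5,1) (Leaf (0,5,1)
    (1,4,-1) (2,4,1))) (Claim (0,11,1) (Leaf (0,8,-1) (2,4,1) (0,11,1))))) (Claim (1,11,1) (Leaf
    (0,8,-1) (2,4,1) (1,11,1))))))))) (Claim (0,5,1) (Claim (1,4,-1) (Leaf (0,5,1) (1,4,-1)
    (0,8,-1)))))))) (Claim (2,4,1) (Turn (Turn (Split 12 1 1 (733,273,287) (Claim (1,11,1) (Leaf
    (0,8,-1) (2,4,1) (1,11,1))) (Claim (0,5,1) (Claim (1,4,-1) (Leaf (0,5,1) (1,4,-1)
    (0,8,-1)))))))))) (Claim (1,11,1) (Claim (2,4,1) (Turn (Split 4 3 7 (29,13,10) (Claim (1,4,-1)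
    (Leaf (1,4,-1) (2,4,1) (1,11,1))) (Claim (0,11,-1) (Leaf (0,11,-1) (2,4,1) (1,11,1)))))))))))
    (Claim (0,8,-1) (Claim (1,10,-1) (Turn (Turn (Split 1 4 1 (176,65,77) (Claim (0,11,1) (Leaf
    (0,8,-1) (1,10,-1) (0,11,1))) (Claim (1,11,1) (Claim (2,4,1) (Leaf (1,10,-1) (2,4,1)
    (1,11,1)))))))))))) (Turn (Split 95 3 13 (14,3,0) (Split 10 1 3 (8,1,0) (Claim (1,10,-1) (Turn
    (Turn (Split 1 65 1 (125,13,21) (Claim (2,4,-1) (Turn (Turn (Split 12 1 1 (156,25,21) (Claim
    (0,4,1) (Leaf (0,4,1) (2,4,-1) (1,10,-1))) (Claim (1,3,1) (Leaf (1,3,1) (2,4,-1) (1,10,-1)))))))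
    (Split 1 191 1 (316,13,21) (Claim (0,4,1) (Split 10 1 1 (1566,143,231) (Claim (2,4,-1) (Leaf
    (0,4,1) (2,4,-1) (1,10,-1))) (Claim (1,3,-1) (Leaf (0,4,1) (1,3,-1) (1,10,-1))))) (Claim
    (1,3,-1) (Turn (Split 3 1 1 (11,1,0) (Claim (2,3,1) (Claim (2,11,1) (Leaf (1,10,-1) (2,3,1)
    (2,11,1)))) (Split 4 5 3 (28,3,0) (Claim (2,3,1) (Claim (2,11,1) (Leaf (1,10,-1) (2,3,1)
    (2,11,1)))) (Claim (0,4,1) (Leaf (0,4,1) (1,3,-1) (1,10,-1)))))))))))) (Claim (2,4,-1) (Claim
    (2,11,-1) (Turn (Turn (Split 1 12 1 (156,25,21) (Claim (1,3,1) (Leaf (1,3,1) (2,4,-1)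
    (2,11,-1))) (Claim (0,4,1) (Leaf (0,4,1) (2,4,-1) (2,11,-1))))))))) (Split 2 1 19 (3,1,0) (Claim
    (1,3,1) (Split 1 7 5 (7,2,0) (Claim (2,4,-1) (Claim (2,11,-1) (Leaf (1,3,1) (2,4,-1)
    (2,11,-1)))) (Turn (Turn (Split 1 50 1 (410,113,21) (Turn (Turn (Split 103 5 21 (29,8,5) (Claim
    (0,5,-1) (Claim (1,11,1) (Leaf (0,5,-1) (1,3,1) (1,11,1)))) (Claim (2,4,-1) (Claim (2,11,-1)
    (Leaf (1,3,1) (2,4,-1) (2,11,-1))))))) (Claim (1,11,1) (Split 1 6 1 (452,125,21) (Claim (0,5,-1)
    (Leaf (0,5,-1) (1,3,1) (1,11,1))) (Turn (Split 1 2 1 (13,4,0) (Claim (2,4,-1) (Claim (2,11,-1)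
    (Leaf (1,3,1) (2,4,-1) (2,11,-1)))) (Split 1 4 1 (25,8,0) (Claim (2,4,-1) (Claim (2,11,-1) (Leaf
    (1,3,1) (2,4,-1) (2,11,-1)))) (Split 1 8 1 (49,16,0) (Claim (2,4,-1) (Claim (2,11,-1) (Leaf
    (1,11,1) (2,4,-1) (2,11,-1)))) (Split 1 5 1 (64,21,0) (Turn (Split 21 1 1 (1796,566,21) (Split
    84 1 1 (7172,2330,21) (Split 336 1 1 (28676,9386,21) (Claim (0,12,-1) (Leaf (0,12,-1) (1,3,1)
    (1,11,1))) (Claim (2,4,-1) (Claim (2,11,-1) (Leaf (1,11,1) (2,4,-1) (2,11,-1))))) (Claim
    (2,4,-1) (Claim (2,11,-1) (Leaf (1,11,1) (2,4,-1) (2,11,-1))))) (Claim (2,4,-1) (Claim (2,11,-1)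
    (Leaf (1,11,1) (2,4,-1) (2,11,-1)))))) (Claim (0,5,-1) (Leaf (0,5,-1) (1,3,1)
    (1,11,1))))))))))))))) (Split 31 3 10 (18,7,0) (Claim (1,3,1) (Turn (Split 7 2 3 (82,25,14)
    (Claim (0,5,-1) (Claim (1,11,1) (Leaf (0,5,-1) (1,3,1) (1,11,1)))) (Turn (Split 5 103 21
    (29,8,5) (Claim (2,4,-1) (Claim (2,11,-1) (Leaf (1,3,1) (2,4,-1) (2,11,-1)))) (Claim (0,5,-1)
    (Claim (1,11,1) (Leaf (0,5,-1) (1,3,1) (1,11,1))))))))) (Turn (Split 2 3 1 (238,65,63) (Split 17
    2 3 (323,117,42) (Claim (0,5,-1) (Claim (2,4,1) (Claim (2,12,1) (Leaf (0,5,-1) (2,4,1)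
    (2,12,1))))) (Split 5 8 17 (207,65,42) (Claim (0,5,-1) (Claim (1,11,1) (Claim (2,4,1) (Leaf
    (0,5,-1) (2,4,1) (1,11,1))))) (Turn (Split 1 2 1 (274,79,63) (Claim (1,4,-1) (Claim (2,11,-1)
    (Turn (Turn (Split 1 1 5 (89,26,21) (Claim (1,11,1) (Leaf (1,4,-1) (2,11,-1) (1,11,1))) (Claim
    (0,5,1) (Leaf (0,5,1) (1,4,-1) (2,11,-1)))))))) (Claim (1,11,1) (Split 1 15 1 (544,184,63)
    (Claim (1,4,-1) (Claim (2,11,-1) (Leaf (1,4,-1) (2,11,-1) (1,11,1)))) (Claim (0,5,-1) (Claim
    (2,4,1) (Leaf (0,5,-1) (2,4,1) (1,11,1)))))))))) (Turn (Turn (Split 4 1 1 (310,93,63) (Claim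
    (1,3,1) (Turn (Turn (Split 2 7 3 (82,25,14) (Claim (1,4,-1) (Claim (2,4,-1) (Leaf (1,3,1)
    (2,4,-1) (1,4,-1)))) (Claim (0,5,-1) (Claim (1,11,1) (Leaf (0,5,-1) (1,3,1) (1,11,1))))))))
    (Claim (1,3,1) (Claim (2,4,-1) (Claim (2,11,-1) (Leaf (1,3,1) (2,4,-1) (2,11,-1))))))))))))))))
    (Turn (Turn (Split 20 1 1 (49,13,21) (Turn (Turn (Split 1 9 1 (9,0,1) (Split 8 1 9 (1,0,1) (Turn
    (Turn (Split 1 24 1 (49,13,45) (Turn (Turn (Split 39 1 1 (88,13,60) (Claim (0,6,1) (Turn (Turn
    (Split 1 144 1 (193,13,189) (Claim (1,9,-1) (Claim (1,10,1) (Leaf (0,6,1) (1,10,1) (1,9,-1))))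
    (Claim (1,4,-1) (Turn (Split 76 1 1 (164,13,136) (Claim (1,3,1) (Leaf (0,6,1) (1,4,-1) (1,3,1)))
    (Claim (1,9,-1) (Leaf (0,6,1) (1,4,-1) (1,9,-1)))))))))) (Claim (0,8,-1) (Split 4 9 13
    (61,13,33) (Claim (1,10,1) (Split 11 16 27 (72,13,44) (Claim (0,10,1) (Claim (1,9,-1) (Leaf
    (0,10,1) (1,10,1) (1,9,-1)))) (Claim (2,11,-1) (Leaf (0,8,-1) (2,11,-1) (1,10,1))))) (Claim
    (2,11,-1) (Turn (Split 13 11 24 (49,13,32) (Claim (0,11,1) (Leaf (0,8,-1) (2,11,-1) (0,11,1)))
    (Claim (1,10,1) (Leaf (0,8,-1) (2,11,-1) (1,10,1))))))))))) (Split 1 102 1 (49,13,147) (Split 12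
    5 17 (49,13,75) (Split 3 2 5 (49,13,57) (Claim (0,9,1) (Turn (Turn (Split 144 1 1 (193,13,189)
    (Turn (Turn (Split 1 54 1 (103,13,111) (Claim (1,9,-1) (Claim (1,10,1) (Leaf (0,9,1) (1,10,1)
    (1,9,-1)))) (Claim (1,8,-1) (Claim (2,4,-1) (Leaf (0,9,1) (2,4,-1) (1,8,-1))))))) (Claim
    (1,9,-1) (Claim (1,10,1) (Leaf (0,9,1) (1,10,1) (1,9,-1)))))))) (Split 1 1 2 (49,13,66) (Claim
    (0,8,1) (Turn (Turn (Split 81 1 1 (130,13,138) (Claim (1,8,-1) (Claim (1,9,1) (Leaf (0,8,1)
    (1,9,1) (1,8,-1)))) (Claim (1,4,1) (Claim (1,5,-1) (Leaf (0,8,1) (1,5,-1) (1,4,1)))))))) (Claim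
    (1,8,-1) (Claim (1,9,1) (Turn (Split 10 641 13 (87,10,107) (Claim (1,4,1) (Leaf (1,4,1) (1,9,1)
    (1,8,-1))) (Claim (0,9,1) (Leaf (0,9,1) (1,9,1) (1,8,-1))))))))) (Claim (1,9,1) (Turn (Split 1
    110 1 (159,13,257) (Claim (1,5,1) (Claim (2,11,1) (Turn (Turn (Split 2 1 3 (49,13,99) (Claim
    (1,7,-1) (Leaf (1,5,1) (1,9,1) (1,7,-1))) (Claim (2,10,-1) (Leaf (1,9,1) (2,11,1)
    (2,10,-1)))))))) (Claim (1,8,-1) (Turn (Split 641 10 13 (87,10,107) (Claim (2,10,-1) (Leaf
    (1,8,-1) (2,10,-1) (1,9,1))) (Claim (1,4,1) (Leaf (1,4,1) (1,9,1) (1,8,-1)))))))))) (Turn (Split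
    1 1 1 (1,0,2) (Claim (2,11,1) (Split 2 1 1 (1,0,4) (Claim (2,4,1) (Turn (Turn (Split 1 155 1
    (49,13,302) (Claim (2,6,-1) (Leaf (2,4,1) (2,11,1) (2,6,-1))) (Claim (2,3,1) (Leaf (2,3,1)
    (2,4,1) (2,11,1))))))) (Claim (1,7,1) (Split 1 2 1 (3,0,8) (Claim (2,9,-1) (Leaf (1,7,1)
    (2,11,1) (2,9,-1))) (Claim (2,10,-1) (Leaf (1,7,1) (2,11,1) (2,10,-1))))))) (Claim (1,9,1)
    (Claim (2,10,-1) (Turn (Split 110 1 1 (159,13,257) (Claim (2,4,-1) (Leaf (1,9,1) (2,4,-1)
    (2,10,-1))) (Claim (2,11,1) (Leaf (1,9,1) (2,11,1) (2,10,-1))))))))))))) (Split 109 3 8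
    (17,0,14) (Claim (1,4,-1) (Turn (Turn (Split 1 116 1 (165,13,137) (Claim (0,8,-1) (Split 23 6 29
    (73,13,45) (Claim (0,5,1) (Leaf (0,5,1) (1,4,-1) (0,8,-1))) (Claim (0,10,1) (Claim (1,9,-1)
    (Leaf (0,10,1) (1,4,-1) (1,9,-1)))))) (Claim (0,9,1) (Claim (1,3,1) (Leaf (0,9,1) (1,4,-1)
    (1,3,1)))))))) (Turn (Split 7 1 1 (112,13,28) (Turn (Turn (Split 1 2 1 (35,0,16) (Claim (0,8,-1)
    (Claim (1,3,1) (Turn (Turn (Split 3 20 13 (52,3,28) (Claim (2,11,1) (Leaf (0,8,-1) (1,3,1)
    (2,11,1))) (Claim (0,10,1) (Leaf (0,8,-1) (1,3,1) (0,10,1)))))))) (Claim (2,11,1) (Split 1 4 1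
    (71,0,20) (Split 11 1 4 (114,0,49) (Claim (0,8,-1) (Claim (1,3,1) (Leaf (0,8,-1) (1,3,1)
    (2,11,1)))) (Claim (0,5,-1) (Turn (Split 2 1 1 (254,13,68) (Claim (2,3,1) (Leaf (0,5,-1) (2,3,1)
    (2,11,1))) (Claim (1,3,1) (Leaf (0,5,-1) (1,3,1) (2,11,1))))))) (Turn (Split 13 1 1 (229,13,41)
    (Claim (1,3,-1) (Claim (2,3,1) (Leaf (1,3,-1) (2,3,1) (2,11,1)))) (Split 7 6 13 (175,13,35)
    (Claim (0,4,1) (Turn (Split 1 2 1 (317,13,75) (Turn (Turn (Split 2 7 3 (561,39,109) (Claim
    (1,3,-1) (Claim (2,3,1) (Leaf (1,3,-1) (2,3,1) (2,11,1)))) (Turn (Split 7 1 2 (771,52,160) (Turn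
    (Split 2 3 1 (3225,221,647) (Claim (0,5,-1) (Leaf (0,4,1) (2,11,1) (0,5,-1))) (Claim (1,10,-1)
    (Leaf (0,4,1) (2,11,1) (1,10,-1))))) (Claim (1,3,-1) (Claim (2,3,1) (Leaf (0,4,1) (1,3,-1)
    (2,3,1))))))))) (Claim (1,3,-1) (Claim (2,3,1) (Leaf (1,3,-1) (2,3,1) (2,11,1))))))) (Claim
    (0,5,-1) (Split 2 5 7 (130,13,30) (Split 2 3 5 (148,13,32) (Claim (0,4,1) (Leaf (0,4,1) (2,11,1)
    (0,5,-1))) (Turn (Split 1 2 1 (272,13,70) (Claim (1,3,1) (Leaf (0,5,-1) (1,3,1) (2,11,1)))
    (Claim (0,4,1) (Leaf (0,4,1) (2,11,1) (0,5,-1)))))) (Turn (Split 1 2 1 (254,13,68) (Claim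
    (1,3,1) (Leaf (0,5,-1) (1,3,1) (2,11,1))) (Turn (Split 2 1 1 (272,13,70) (Claim (2,3,1) (Leaf
    (0,5,-1) (2,3,1) (2,11,1))) (Claim (1,3,1) (Leaf (0,5,-1) (1,3,1) (2,11,1)))))))))))))))))
    (Claim (0,8,-1) (Split 2 5 7 (67,13,23) (Claim (1,3,1) (Turn (Turn (Split 47 9 13 (139,9,70)
    (Claim (0,5,1) (Claim (1,4,-1) (Leaf (0,5,1) (1,4,-1) (1,3,1)))) (Claim (2,4,-1) (Leaf (0,8,-1)
    (1,3,1) (2,4,-1))))))) (Claim (0,5,1) (Claim (1,4,-1) (Leaf (0,5,1) (1,4,-1) (0,8,-1))))))))))
    (Turn (Split 67 1 1 (116,13,21) (Claim (2,11,1) (Split 118 1 1 (234,13,21) (Claim (1,3,-1)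
    (Claim (2,3,1) (Leaf (1,3,-1) (2,3,1) (2,11,1)))) (Claim (0,4,1) (Turn (Split 1 13 1 (233,13,34)
    (Claim (1,10,-1) (Leaf (0,4,1) (2,11,1) (1,10,-1))) (Claim (1,3,-1) (Claim (2,3,1) (Leaf (0,4,1)
    (1,3,-1) (2,3,1))))))))) (Turn (Split 1 7 1 (112,13,28) (Claim (1,10,-1) (Claim (2,4,-1) (Turn
    (Turn (Split 1 2 1 (214,39,63) (Claim (1,3,1) (Leaf (1,3,1) (2,4,-1) (1,10,-1))) (Claim (0,11,1)
    (Leaf (0,11,1) (2,4,-1) (1,10,-1)))))))) (Claim (2,11,1) (Split 1 13 1 (229,13,41) (Claim
    (1,10,-1) (Split 9 4 13 (148,13,32) (Claim (1,3,1) (Leaf (1,3,1) (2,11,1) (1,10,-1))) (Claim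
    (0,4,1) (Leaf (0,4,1) (2,11,1) (1,10,-1))))) (Claim (0,4,1) (Turn (Split 13 1 1 (233,13,34)
    (Claim (1,3,-1) (Claim (2,3,1) (Leaf (1,3,-1) (2,3,1) (2,11,1)))) (Claim (1,10,-1) (Leaf (0,4,1)
    (2,11,1) (1,10,-1))))))))))))))) (Turn (Turn (Split 55 1 1 (49,13,76) (Turn (Turn (Split 1 38 1
    (29,13,59) (Split 8 11 19 (29,13,43) (Turn (Turn (Split 3 7 5 (70,26,75) (Claim (1,10,1) (Claim
    (2,4,1) (Split 1 1 1 (119,39,151) (Claim (1,8,-1) (Leaf (1,8,-1) (2,4,1) (1,10,1))) (Claim
    (1,9,-1) (Leaf (1,9,-1) (2,4,1) (1,10,1)))))) (Claim (2,11,-1) (Split 1 2 1 (128,52,117) (Claim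
    (1,9,-1) (Claim (1,10,1) (Leaf (1,9,-1) (2,11,-1) (1,10,1)))) (Turn (Split 13 9 22 (29,13,30)
    (Claim (1,5,-1) (Split 5 4 9 (29,13,25) (Claim (0,6,1) (Leaf (0,6,1) (1,5,-1) (2,11,-1))) (Claim
    (0,7,1) (Leaf (0,7,1) (1,5,-1) (2,11,-1))))) (Claim (1,9,-1) (Claim (1,10,1) (Leaf (1,9,-1)
    (2,11,-1) (1,10,1))))))))))) (Claim (1,5,1) (Claim (1,8,-1) (Claim (1,10,1) (Leaf (1,5,1)
    (1,10,1) (1,8,-1)))))) (Claim (2,4,1) (Turn (Split 23 1 1 (49,13,99) (Split 91 1 1 (49,13,190)
    (Turn (Turn (Split 1 67 1 (29,13,126) (Split 2 1 1 (87,39,244) (Claim (1,6,1) (Claim (2,5,-1)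
    (Leaf (1,6,1) (2,5,-1) (2,4,1)))) (Claim (1,7,1) (Claim (2,6,-1) (Leaf (1,7,1) (2,6,-1)
    (2,4,1))))) (Claim (2,11,1) (Turn (Split 197 1 1 (49,13,387) (Claim (2,12,1) (Leaf (2,4,1)
    (2,11,1) (2,12,1))) (Claim (2,7,-1) (Leaf (2,4,1) (2,11,1) (2,7,-1))))))))) (Claim (1,6,1)
    (Claim (2,5,-1) (Leaf (1,6,1) (2,5,-1) (2,4,1))))) (Claim (1,7,-1) (Claim (1,9,1) (Leaf (1,7,-1)
    (2,4,1) (1,9,1)))))))))) (Split 4 7 11 (49,13,41) (Claim (2,4,1) (Turn (Turn (Split 7 3 5
    (70,26,75) (Claim (1,5,-1) (Split 5 2 3 (95,39,85) (Claim (0,6,1) (Leaf (0,6,1) (1,5,-1)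
    (2,4,1))) (Claim (0,10,1) (Leaf (0,10,1) (1,5,-1) (2,4,1))))) (Claim (1,10,1) (Turn (Split 4 3 7
    (49,13,61) (Turn (Turn (Split 1 1 1 (119,39,151) (Claim (1,5,-1) (Leaf (1,5,-1) (2,4,1)
    (1,10,1))) (Claim (1,8,-1) (Leaf (1,8,-1) (2,4,1) (1,10,1)))))) (Claim (1,5,-1) (Leaf (1,5,-1)
    (2,4,1) (1,10,1)))))))))) (Claim (0,8,-1) (Claim (2,11,-1) (Split 9 11 20 (49,13,30) (Turn (Turn
    (Split 3 2 5 (37,13,29) (Claim (0,11,1) (Leaf (0,8,-1) (2,11,-1) (0,11,1))) (Claim (1,10,1)
    (Leaf (0,8,-1) (2,11,-1) (1,10,1)))))) (Claim (0,11,1) (Leaf (0,8,-1) (2,11,-1)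
    (0,11,1)))))))))))))))"

lemma covered_root: "covered [] (0, 0, 1) (1, 0, 0) (29, 13, 0) root_cert"
  unfolding root_cert_def by code_simp

lemma blocked_direction:
  assumes "X \<noteq> 0"
  shows "blocked X"
proof (rule blocked_if_fundamental_domain[OF _ assms])
  fix a b c :: real
  let ?X = "a *\<^sub>R vector [0, 0, 1] + b *\<^sub>R vector [1, 0, 0] + c *\<^sub>R vector [29, 13, 0] :: real^3"
  assume "a \<ge> 0" "b \<ge> 0" "c \<ge> 0" and nz: "?X \<noteq> 0"
  moreover have "?X = a *\<^sub>R real_vec (0, 0, 1) + b *\<^sub>R real_vec (1, 0, 0) + c *\<^sub>R real_vec (29, 13, 0)"
    by simp
  ultimately have mem: "?X \<in> cone3 (0, 0, 1) (1, 0, 0) (29, 13, 0)"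
    unfolding cone3_def by blast
  show "blocked ?X"
    by (rule covered_imp_blocked[OF covered_root _ _ mem nz]) (auto simp: cone3_def)
qed

section \<open>A shadow that fits\<close>

text \<open>The integer vectors are the rows of \<open>98345 * M(\<theta>\<^sub>2, \<phi>\<^sub>2)\<close> and of
  \<open>28118429000 * 1.003 * R(\<alpha>) M(\<theta>\<^sub>1, \<phi>\<^sub>1)\<close> for the angles chosen below; \<open>5 * 10 ^ 15\<close> bounds the effect of
  rounding the vertices on the coordinates of \<open>gap\<close>.\<close>

definition outer_coords :: "vertex \<Rightarrow> int \<times> int" where
  "outer_coords p = (idot (18564, 96577, 0) (approx p), idot (-61180, 11760, 76095) (approx p))"

definition inner_coords :: "vertex \<Rightarrow> int \<times> int" where
  "inner_coords p = (idot (-6512198160, 26553049887, -6922706000) (approx p),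
     idot (26803348537, 7679690160, 4242629820) (approx p))"

text \<open>The scaled difference of an outer and an inner point over a common denominator. The
  factors 98345 = 445 * 221 and 28118429000 = 29 * 1181 * 821 * 1000 collect the denominators of the
  sines, the cosines and the scale 1.003.\<close>

fun gap :: "int \<times> int \<Rightarrow> int \<times> int \<Rightarrow> int \<times> int" where
  "gap (x1, x2) (y1, y2) = (28118429000 * y1 - 98345 * x1, 28118429000 * y2 - 98345 * x2)"

text \<open>The cross product is required to exceed the largest error possible when each of the four
  coordinates is off by 5 * 10^15, so its sign is that of the exact configuration.\<close>

fun left_turn :: "int \<times> int \<Rightarrow> int \<times> int \<Rightarrow> bool" where
  "left_turn (u1, u2) (v1, v2) \<longleftrightarrow>
     5000000000000000 * (\<bar>u1\<bar> + \<bar>u2\<bar> + \<bar>v1\<bar> + \<bar>v2\<bar>) + 2 * 5000000000000000 * 5000000000000000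
       < u1 * v2 - u2 * v1"

fun in_triangle :: "int \<times> int \<Rightarrow> vertex \<times> vertex \<times> vertex \<Rightarrow> bool" where
  "in_triangle x (a, b, c) \<longleftrightarrow>
     left_turn (gap x (outer_coords a)) (gap x (outer_coords b)) \<and>
     left_turn (gap x (outer_coords b)) (gap x (outer_coords c)) \<and>
     left_turn (gap x (outer_coords c)) (gap x (outer_coords a))"

text \<open>One list serves all inner points, and a suitable triangle is searched for each. The
  order of the corners matters: \<open>in_triangle\<close> demands a counterclockwise
  triangle.\<close>

definition triangles :: "(vertex \<times> vertex \<times> vertex) list" where
  "triangles =
    [((0,5,-1), (2,10,-1), (0,8,1)), ((1,3,-1), (1,3,1), (1,9,1)), ((1,4,-1), (0,8,-1), (1,9,-1)),
     ((1,3,-1), (2,3,1), (1,3,1)), ((1,4,1), (0,8,1), (1,9,1)), ((2,3,-1), (1,3,-1), (0,7,-1)),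
     ((1,4,-1), (1,9,-1), (2,10,-1)), ((2,3,-1), (0,6,1), (0,8,1)), ((2,3,-1), (1,8,1), (1,9,1)),
     ((1,8,-1), (1,9,-1), (2,3,1)), ((2,3,-1), (1,9,1), (2,10,1)), ((1,3,-1), (1,4,-1), (0,6,-1)),
     ((1,4,-1), (0,5,-1), (0,7,-1)), ((0,7,-1), (0,9,-1), (1,8,-1)), ((1,3,1), (1,4,1), (0,6,1)),
     ((0,7,1), (0,9,1), (1,8,1)), ((2,3,-1), (0,7,-1), (0,8,-1)), ((2,3,-1), (1,4,1), (0,5,1)),
     ((2,3,-1), (0,7,1), (0,8,1))]"

definition fits :: "int \<Rightarrow> bool" where
  "fits i \<longleftrightarrow> list_all (\<lambda>k. list_all (\<lambda>s.
     list_ex (in_triangle (inner_coords (i, k, s))) triangles) [1, -1]) [0..14]"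

lemma fits: "i \<in> {0, 1, 2} \<Longrightarrow> fits i"
proof -
  have "list_all fits [0, 1, 2]"
    by code_simp
  then show "i \<in> {0, 1, 2} \<Longrightarrow> fits i"
    by auto
qed

lemma triangles_vertices: "(a, b, c) \<in> set triangles \<Longrightarrow> {a, b, c} \<subseteq> vertices"
  by (auto simp: triangles_def vertices_def)

section \<open>Triangle tests in the plane with error margins\<close>

definition cross2 :: "real^2 \<Rightarrow> real^2 \<Rightarrow> real" where
  "cross2 u v = u$1 * v$2 - u$2 * v$1"

text \<open>The three cross products are barycentric coordinates up to a common factor. Where all
  are positive, the point lies in the triangle, and this set is open.\<close>

lemma interior_triangle:
  fixes a b c x :: "real^2"
  assumes "cross2 (a - x) (b - x) > 0" "cross2 (b - x) (c - x) > 0" "cross2 (c - x) (a - x) > 0"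
  shows "x \<in> interior (convex hull {a, b, c})"
proof -
  define T where "T = {y. cross2 (a - y) (b - y) > 0} \<inter> {y. cross2 (b - y) (c - y) > 0}
    \<inter> {y. cross2 (c - y) (a - y) > 0}"
  have "open T"
    unfolding T_def cross2_def by (intro open_Int open_Collect_less continuous_intros)
  moreover have "T \<subseteq> convex hull {a, b, c}"
  proof
    fix y
    assume y: "y \<in> T"
    define u where "u = cross2 (b - y) (c - y)"
    define v where "v = cross2 (c - y) (a - y)"
    define w where "w = cross2 (a - y) (b - y)"
    define t where "t = u + v + w"
    have pos: "u > 0" "v > 0" "w > 0" "t > 0"
      using y by (auto simp: T_def u_def v_def w_def t_def)
    have "t *\<^sub>R y = u *\<^sub>R a + v *\<^sub>R b + w *\<^sub>R c"
      by (simp add: vec_eq_iff forall_2 t_def u_def v_def w_def cross2_def algebra_simps)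
    then have "(1 / t) *\<^sub>R t *\<^sub>R y = (u / t) *\<^sub>R a + (v / t) *\<^sub>R b + (w / t) *\<^sub>R c"
      by (simp add: scaleR_add_right)
    then have "y = (u / t) *\<^sub>R a + (v / t) *\<^sub>R b + (w / t) *\<^sub>R c"
      using pos by simp
    moreover have "0 \<le> u / t" "0 \<le> v / t" "0 \<le> w / t"
      using pos by simp_all
    moreover have "u / t + v / t + w / t = 1"
      using pos(4) by (simp add: t_def flip: add_divide_distrib)
    ultimately show "y \<in> convex hull {a, b, c}"
      unfolding convex_hull_3 by blast
  qed
  moreover have "x \<in> T"
    using assms by (simp add: T_def)
  ultimately show ?thesis
    using interior_maximal by blast
qed

lemma cross2_error:
  fixes u v :: "real^2"
  assumes "\<bar>u$1 - u1\<bar> \<le> e" "\<bar>u$2 - u2\<bar> \<le> e" "\<bar>v$1 - v1\<bar> \<le> e" "\<bar>v$2 - v2\<bar> \<le> e"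
    and big: "e * (\<bar>u1\<bar> + \<bar>u2\<bar> + \<bar>v1\<bar> + \<bar>v2\<bar>) + 2 * e * e < u1 * v2 - u2 * v1"
  shows "cross2 u v > 0"
proof -
  have err: "\<bar>x * y - x0 * y0\<bar> \<le> e * \<bar>y0\<bar> + e * \<bar>x0\<bar> + e * e"
    if "\<bar>x - x0\<bar> \<le> e" "\<bar>y - y0\<bar> \<le> e" for x y x0 y0 :: real
  proof -
    have "x * y - x0 * y0 = (x - x0) * y0 + x0 * (y - y0) + (x - x0) * (y - y0)"
      by (simp add: algebra_simps)
    also have "\<bar>\<dots>\<bar> \<le> \<bar>x - x0\<bar> * \<bar>y0\<bar> + \<bar>x0\<bar> * \<bar>y - y0\<bar> + \<bar>x - x0\<bar> * \<bar>y - y0\<bar>"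
      by (intro order_trans[OF abs_triangle_ineq] add_mono) (simp_all add: abs_mult)
    also have "\<dots> \<le> e * \<bar>y0\<bar> + \<bar>x0\<bar> * e + e * e"
      using that by (intro add_mono mult_mono) auto
    finally show ?thesis by (simp add: mult.commute)
  qed
  show ?thesis
    using err[OF assms(1) assms(4)] err[OF assms(2) assms(3)] big
    unfolding cross2_def abs_le_iff by (simp add: algebra_simps)
qed

lemma row_error:
  assumes p: "p \<in> vertices" and row: "real_of_int (idot r r) \<le> m\<^sup>2" and m: "0 \<le> m"
  shows "\<bar>100000 * (real_vec r \<bullet> vertex_point p) - real_of_int (idot r (approx p))\<bar> \<le> m * 0.9"
proof -
  have "(norm (real_vec r))\<^sup>2 \<le> m\<^sup>2"
    using row by (simp only: power2_norm_eq_inner inner_real_vec)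
  then have "norm (real_vec r) \<le> m"
    using m by (rule power2_le_imp_le)
  have "100000 * (real_vec r \<bullet> vertex_point p) - real_of_int (idot r (approx p)) =
      real_vec r \<bullet> (100000 *\<^sub>R vertex_point p - real_vec (approx p))"
    by (simp add: inner_diff_right inner_real_vec)
  also have "\<bar>\<dots>\<bar> \<le> norm (real_vec r) * norm (100000 *\<^sub>R vertex_point p - real_vec (approx p))"
    by (rule Cauchy_Schwarz_ineq2)
  also have "\<dots> \<le> m * 0.9"
    using \<open>norm (real_vec r) \<le> m\<close> m approx_error[OF p] by (intro mult_mono) simp_all
  finally show ?thesis .
qed

lemma left_turn_imp_cross2:
  fixes x w w' :: "real^2"
  assumes p: "p \<in> vertices" and a: "a \<in> vertices" and b: "b \<in> vertices"
    and x: "28118429000 * x$1 = real_vec (-6512198160, 26553049887, -6922706000) \<bullet> vertex_point p"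
      "28118429000 * x$2 = real_vec (26803348537, 7679690160, 4242629820) \<bullet> vertex_point p"
    and w: "98345 * w$1 = real_vec (18564, 96577, 0) \<bullet> vertex_point a"
      "98345 * w$2 = real_vec (-61180, 11760, 76095) \<bullet> vertex_point a"
    and w': "98345 * w'$1 = real_vec (18564, 96577, 0) \<bullet> vertex_point b"
      "98345 * w'$2 = real_vec (-61180, 11760, 76095) \<bullet> vertex_point b"
    and turn: "left_turn (gap (inner_coords p) (outer_coords a)) (gap (inner_coords p) (outer_coords b))"
  shows "cross2 (w - x) (w' - x) > 0"
proof -
  define U :: real where "U = 100000 * 28118429000 * 98345"
  define x1 x2 where "x1 = idot (-6512198160, 26553049887, -6922706000) (approx p)"
    "x2 = idot (26803348537, 7679690160, 4242629820) (approx p)"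
  note xs = this
  define a1 a2 where "a1 = idot (18564, 96577, 0) (approx a)" "a2 = idot (-61180, 11760, 76095) (approx a)"
  note as = this
  define b1 b2 where "b1 = idot (18564, 96577, 0) (approx b)" "b2 = idot (-61180, 11760, 76095) (approx b)"
  note bs = this
  \<comment> \<open>The rows of a rotated projection are unit vectors, so the integer rows have the
    lengths 28202784287 = 28118429000 * 1.003 and 98345.\<close>
  have ex: "\<bar>100000 * (28118429000 * x$1) - real_of_int x1\<bar> \<le> 28202784287 * 0.9"
    "\<bar>100000 * (28118429000 * x$2) - real_of_int x2\<bar> \<le> 28202784287 * 0.9"
    unfolding x xs by (rule row_error[OF p]; simp)+
  have ea: "\<bar>100000 * (98345 * w$1) - real_of_int a1\<bar> \<le> 98345 * 0.9"
    "\<bar>100000 * (98345 * w$2) - real_of_int a2\<bar> \<le> 98345 * 0.9"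
    unfolding w as by (rule row_error[OF a]; simp)+
  have eb: "\<bar>100000 * (98345 * w'$1) - real_of_int b1\<bar> \<le> 98345 * 0.9"
    "\<bar>100000 * (98345 * w'$2) - real_of_int b2\<bar> \<le> 98345 * 0.9"
    unfolding w' bs by (rule row_error[OF b]; simp)+
  \<comment> \<open>The total error 0.9 * 98345 * (28118429000 + 28202784287) is just below 5 *
    10^15.\<close>
  have comp: "\<bar>U * (y - z) - real_of_int (28118429000 * m - 98345 * n)\<bar> \<le> 5000000000000000"
    if "\<bar>100000 * (98345 * y) - real_of_int m\<bar> \<le> 98345 * 0.9"
      "\<bar>100000 * (28118429000 * z) - real_of_int n\<bar> \<le> 28202784287 * 0.9" for y z m n
    using that unfolding U_def abs_le_iff by simp
  have turn': "left_turn (28118429000 * a1 - 98345 * x1, 28118429000 * a2 - 98345 * x2)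
      (28118429000 * b1 - 98345 * x1, 28118429000 * b2 - 98345 * x2)"
    using turn unfolding inner_coords_def outer_coords_def gap.simps xs as bs .
  have "cross2 (U *\<^sub>R (w - x)) (U *\<^sub>R (w' - x)) > 0"
  proof (rule cross2_error)
    show "\<bar>(U *\<^sub>R (w - x)) $ 1 - real_of_int (28118429000 * a1 - 98345 * x1)\<bar> \<le> 5000000000000000"
      "\<bar>(U *\<^sub>R (w - x)) $ 2 - real_of_int (28118429000 * a2 - 98345 * x2)\<bar> \<le> 5000000000000000"
      "\<bar>(U *\<^sub>R (w' - x)) $ 1 - real_of_int (28118429000 * b1 - 98345 * x1)\<bar> \<le> 5000000000000000"
      "\<bar>(U *\<^sub>R (w' - x)) $ 2 - real_of_int (28118429000 * b2 - 98345 * x2)\<bar> \<le> 5000000000000000"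
      unfolding vector_scaleR_component vector_minus_component real_scaleR_def
      by (fact comp[OF ea(1) ex(1)] comp[OF ea(2) ex(2)] comp[OF eb(1) ex(1)] comp[OF eb(2) ex(2)])+
    show "5000000000000000 * (\<bar>real_of_int (28118429000 * a1 - 98345 * x1)\<bar> + \<bar>real_of_int (28118429000 * a2 - 98345 * x2)\<bar>
        + \<bar>real_of_int (28118429000 * b1 - 98345 * x1)\<bar> + \<bar>real_of_int (28118429000 * b2 - 98345 * x2)\<bar>)
        + 2 * 5000000000000000 * 5000000000000000
      < real_of_int (28118429000 * a1 - 98345 * x1) * real_of_int (28118429000 * b2 - 98345 * x2)
        - real_of_int (28118429000 * a2 - 98345 * x2) * real_of_int (28118429000 * b1 - 98345 * x1)"
      using turn'[unfolded left_turn.simps, folded of_int_less_iff[where 'a = real]]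
      by (simp only: of_int_abs of_int_add of_int_mult of_int_diff of_int_numeral)
  qed
  moreover have "cross2 (U *\<^sub>R (w - x)) (U *\<^sub>R (w' - x)) = U\<^sup>2 * cross2 (w - x) (w' - x)"
    by (simp add: cross2_def power2_eq_square algebra_simps)
  ultimately show ?thesis
    by (simp add: U_def zero_less_mult_iff)
qed

text \<open>The angles are \<open>2 * arctan t\<close> for \<open>t = -2/5, 34/5, -2/21, 9/19, 14/25\<close>, so that their sines and
  cosines are rational.\<close>

lemma rupert_cond_scaled:
  obtains \<theta>\<^sub>1 \<phi>\<^sub>1 \<theta>\<^sub>2 \<phi>\<^sub>2 \<alpha> where
    "in_param_range \<theta>\<^sub>1 \<phi>\<^sub>1 \<theta>\<^sub>2 \<phi>\<^sub>2 \<alpha>" "rupert_cond 1.003 ruperthedron \<theta>\<^sub>1 \<phi>\<^sub>1 \<theta>\<^sub>2 \<phi>\<^sub>2 \<alpha>"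
proof -
  obtain \<theta>\<^sub>1 where \<theta>1: "0 \<le> \<theta>\<^sub>1" "\<theta>\<^sub>1 < 2 * pi" "cos \<theta>\<^sub>1 = 21 / 29" "sin \<theta>\<^sub>1 = - 20 / 29"
    by (rule sincos_total_2pi[of "21 / 29" "- 20 / 29"]) (simp_all add: power2_eq_square)
  obtain \<theta>\<^sub>2 where \<theta>2: "0 \<le> \<theta>\<^sub>2" "\<theta>\<^sub>2 < 2 * pi" "cos \<theta>\<^sub>2 = 437 / 445" "sin \<theta>\<^sub>2 = - 84 / 445"
    by (rule sincos_total_2pi[of "437 / 445" "- 84 / 445"]) (simp_all add: power2_eq_square)
  obtain \<phi>\<^sub>1 where \<phi>1: "0 \<le> \<phi>\<^sub>1" "\<phi>\<^sub>1 \<le> pi" "cos \<phi>\<^sub>1 = - 1131 / 1181" "sin \<phi>\<^sub>1 = 340 / 1181"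
    using sincos_total_pi[of "340 / 1181" "- 1131 / 1181"] by (auto simp: power2_eq_square)
  obtain \<phi>\<^sub>2 where \<phi>2: "0 \<le> \<phi>\<^sub>2" "\<phi>\<^sub>2 \<le> pi" "cos \<phi>\<^sub>2 = 140 / 221" "sin \<phi>\<^sub>2 = 171 / 221"
    using sincos_total_pi[of "171 / 221" "140 / 221"] by (auto simp: power2_eq_square)
  obtain \<alpha> where \<alpha>: "0 \<le> \<alpha>" "\<alpha> \<le> pi" "cos \<alpha> = 429 / 821" "sin \<alpha> = 700 / 821"
    using sincos_total_pi[of "700 / 821" "429 / 821"] by (auto simp: power2_eq_square)
  have "\<alpha> \<noteq> pi"
    using \<alpha>(3) by auto
  then have range: "in_param_range \<theta>\<^sub>1 \<phi>\<^sub>1 \<theta>\<^sub>2 \<phi>\<^sub>2 \<alpha>"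
    using \<theta>1 \<theta>2 \<phi>1 \<phi>2 \<alpha> by (simp add: in_param_range_def)
  have outer: "98345 * projM \<theta>\<^sub>2 \<phi>\<^sub>2 Q $ 1 = real_vec (18564, 96577, 0) \<bullet> Q"
    "98345 * projM \<theta>\<^sub>2 \<phi>\<^sub>2 Q $ 2 = real_vec (-61180, 11760, 76095) \<bullet> Q" for Q
    by (simp_all add: projM_def inner_real3 \<theta>2 \<phi>2)
  have inner: "28118429000 * (1.003 *\<^sub>R rot2 \<alpha> (projM \<theta>\<^sub>1 \<phi>\<^sub>1 Q)) $ 1
      = real_vec (-6512198160, 26553049887, -6922706000) \<bullet> Q"
    "28118429000 * (1.003 *\<^sub>R rot2 \<alpha> (projM \<theta>\<^sub>1 \<phi>\<^sub>1 Q)) $ 2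
      = real_vec (26803348537, 7679690160, 4242629820) \<bullet> Q" for Q
    by (simp_all add: rot2_def projM_def inner_real3 \<theta>1 \<phi>1 \<alpha> algebra_simps)
  have "1.003 *\<^sub>R rot2 \<alpha> (projM \<theta>\<^sub>1 \<phi>\<^sub>1 P) \<in> interior (convex hull (projM \<theta>\<^sub>2 \<phi>\<^sub>2 ` ruperthedron))"
    if P_in: "P \<in> ruperthedron" for P
  proof -
    obtain i l s where P: "P = vertex_point (i, l, s)" and i: "i \<in> {0, 1, 2}" and s: "s \<in> {1, -1}"
      using P_in by (auto simp: ruperthedron_eq vertices_def)
    define k where "k = l mod 15"
    define p where "p = (i, k, s)"
    have P_eq: "P = vertex_point p"
      unfolding P p_def k_def by (rule vertex_point_mod_15[symmetric])
    have p: "p \<in> vertices"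
      using i s by (simp add: p_def vertices_def)
    have "0 \<le> k" "k \<le> 14"
      using pos_mod_bound[of 15 l] unfolding k_def by auto
    then have "\<exists>t\<in>set triangles. in_triangle (inner_coords p) t"
      using fits[OF i] s unfolding fits_def list_all_iff list_ex_iff p_def by auto
    then obtain a b c where abc: "(a, b, c) \<in> set triangles" and tri: "in_triangle (inner_coords p) (a, b, c)"
      by (metis prod_cases3)
    have v: "a \<in> vertices" "b \<in> vertices" "c \<in> vertices"
      using triangles_vertices[OF abc] by simp_all
    have "1.003 *\<^sub>R rot2 \<alpha> (projM \<theta>\<^sub>1 \<phi>\<^sub>1 P) \<in> interior (convex hull
        {projM \<theta>\<^sub>2 \<phi>\<^sub>2 (vertex_point a), projM \<theta>\<^sub>2 \<phi>\<^sub>2 (vertex_point b), projM \<theta>\<^sub>2 \<phi>\<^sub>2 (vertex_point c)})"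
      using tri unfolding P_eq in_triangle.simps
      by (intro interior_triangle left_turn_imp_cross2[OF p _ _ inner outer outer] v) simp_all
    also have "\<dots> \<subseteq> interior (convex hull (projM \<theta>\<^sub>2 \<phi>\<^sub>2 ` ruperthedron))"
      using v by (intro interior_mono hull_mono) (auto simp: ruperthedron_eq)
    finally show ?thesis .
  qed
  then have "rupert_cond 1.003 ruperthedron \<theta>\<^sub>1 \<phi>\<^sub>1 \<theta>\<^sub>2 \<phi>\<^sub>2 \<alpha>"
    by (auto simp: rupert_cond_def)
  with range show ?thesis
    by (rule that)
qed

text \<open>The interior of the outer shadow is convex. It contains \<open>s *\<^sub>R x\<close>
  and, by central symmetry, its negative; for \<open>s \<ge> 1\<close> the point \<open>x\<close>
  lies on the segment between them.\<close>

lemma rupert_cond_shrink: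
  assumes "rupert_cond s ruperthedron \<theta>\<^sub>1 \<phi>\<^sub>1 \<theta>\<^sub>2 \<phi>\<^sub>2 \<alpha>" "1 \<le> s"
  shows "rupert_cond 1 ruperthedron \<theta>\<^sub>1 \<phi>\<^sub>1 \<theta>\<^sub>2 \<phi>\<^sub>2 \<alpha>"
  unfolding rupert_cond_def
proof (intro image_subsetI)
  fix P
  assume P: "P \<in> ruperthedron"
  define H where "H = interior (convex hull (projM \<theta>\<^sub>2 \<phi>\<^sub>2 ` ruperthedron))"
  define x where "x = rot2 \<alpha> (projM \<theta>\<^sub>1 \<phi>\<^sub>1 P)"
  have "convex H"
    by (simp add: H_def convex_interior convex_convex_hull)
  moreover have "s *\<^sub>R x \<in> H"
    using assms(1) P by (auto simp: rupert_cond_def H_def x_def)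
  moreover have "s *\<^sub>R - x \<in> H"
  proof -
    have "- x = rot2 \<alpha> (projM \<theta>\<^sub>1 \<phi>\<^sub>1 (- P))"
      by (simp add: x_def linear_neg[OF linear_projM] linear_neg[OF linear_rot2])
    moreover have "s *\<^sub>R rot2 \<alpha> (projM \<theta>\<^sub>1 \<phi>\<^sub>1 (- P)) \<in> H"
      using assms(1) uminus_ruperthedron[OF P] by (auto simp: rupert_cond_def H_def)
    ultimately show ?thesis
      by simp
  qed
  ultimately have "((1 + 1 / s) / 2) *\<^sub>R s *\<^sub>R x + ((1 - 1 / s) / 2) *\<^sub>R s *\<^sub>R - x \<in> H"
    using assms(2) by (intro convexD) (simp_all add: divide_simps)
  also have "((1 + 1 / s) / 2) *\<^sub>R s *\<^sub>R x + ((1 - 1 / s) / 2) *\<^sub>R s *\<^sub>R - x = 1 *\<^sub>R x"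
  proof -
    have "(1 + 1 / s) / 2 * s = (1 - 1 / s) / 2 * s + 1"
      using assms(2) by (simp add: divide_simps)
    then show ?thesis
      unfolding scaleR_scaleR by (simp only: scaleR_add_left scaleR_minus_right) simp
  qed
  finally show "1 *\<^sub>R rot2 \<alpha> (projM \<theta>\<^sub>1 \<phi>\<^sub>1 P) \<in> interior (convex hull projM \<theta>\<^sub>2 \<phi>\<^sub>2 ` ruperthedron)"
    by (simp add: H_def x_def)
qed

text \<open>The outer shadow lies in the unit disc. Up to the factor 3939/5861, the first
  coordinates of the images of \<open>D1\<close> and of its rotation by 24 degrees are the negative
  sine of \<open>\<theta>\<^sub>1\<close> and the sine of 24 degrees minus
  \<open>\<theta>\<^sub>1\<close>. These cannot both be small, which limits the scale.\<close>

lemma rupert_cond_bounded: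
  assumes "rupert_cond s ruperthedron \<theta>\<^sub>1 \<phi>\<^sub>1 \<theta>\<^sub>2 \<phi>\<^sub>2 \<alpha>" "0 < s"
  shows "s \<le> (1 + 2 / sin15 1) * (5861 / 3939)"
proof -
  have sin_pos: "sin15 1 > 0"
    using cos15_sin15_one(2) unfolding abs_le_iff by simp
  have bound: "s * \<bar>projM \<theta>\<^sub>1 \<phi>\<^sub>1 P $ 1\<bar> \<le> 1" if P: "P \<in> ruperthedron" for P
  proof -
    have "projM \<theta>\<^sub>2 \<phi>\<^sub>2 ` ruperthedron \<subseteq> cball 0 1"
      using norm_projM_le norm_ruperthedron by (force intro: order_trans)
    then have "convex hull (projM \<theta>\<^sub>2 \<phi>\<^sub>2 ` ruperthedron) \<subseteq> cball 0 1"
      by (rule hull_minimal) (rule convex_cball)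
    then have "s *\<^sub>R rot2 \<alpha> (projM \<theta>\<^sub>1 \<phi>\<^sub>1 P) \<in> cball 0 1"
      using assms(1) P interior_subset unfolding rupert_cond_def by blast
    then have "s * norm (projM \<theta>\<^sub>1 \<phi>\<^sub>1 P) \<le> 1"
      using assms(2) by simp
    then show ?thesis
      using component_le_norm_cart[of "projM \<theta>\<^sub>1 \<phi>\<^sub>1 P" 1] assms(2) by (meson mult_left_mono less_imp_le order_trans)
  qed
  have "vertex_point (0, 0, 1) \<in> ruperthedron" "vertex_point (0, 1, 1) \<in> ruperthedron"
    unfolding ruperthedron_eq by (intro imageI; simp add: vertices_def)+
  note b = bound[OF this(1)] bound[OF this(2)]
  have first: "projM \<theta>\<^sub>1 \<phi>\<^sub>1 (vertex_point (0, 0, 1)) $ 1 = - sin \<theta>\<^sub>1 * (3939 / 5861)"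
    by (simp add: projM_def base_point_def D1_def)
  define e where "e = cos \<theta>\<^sub>1 * sin15 1 - sin \<theta>\<^sub>1 * cos15 1"
  have second: "projM \<theta>\<^sub>1 \<phi>\<^sub>1 (vertex_point (0, 1, 1)) $ 1 = e * (3939 / 5861)"
    by (simp add: e_def projM_def symmetry_component base_point_def D1_def algebra_simps)
  define S where "S = s * (3939 / 5861)"
  have "S > 0"
    using assms(2) by (simp add: S_def)
  have s1: "S * \<bar>sin \<theta>\<^sub>1\<bar> \<le> 1"
    using b(1) unfolding first S_def by (simp add: abs_mult)
  have s2: "S * \<bar>e\<bar> \<le> 1"
    using b(2) unfolding second S_def by (simp add: abs_mult)
  have "\<bar>cos \<theta>\<^sub>1\<bar> * sin15 1 = \<bar>e + sin \<theta>\<^sub>1 * cos15 1\<bar>"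
    using sin_pos by (simp add: e_def abs_mult)
  also have "\<dots> \<le> \<bar>e\<bar> + \<bar>sin \<theta>\<^sub>1\<bar> * \<bar>cos15 1\<bar>"
    by (metis abs_mult abs_triangle_ineq)
  also have "\<dots> \<le> \<bar>e\<bar> + \<bar>sin \<theta>\<^sub>1\<bar> * 1"
    by (intro add_left_mono mult_left_mono) (simp_all add: cos15_def)
  finally have "S * (\<bar>cos \<theta>\<^sub>1\<bar> * sin15 1) \<le> S * (\<bar>e\<bar> + \<bar>sin \<theta>\<^sub>1\<bar>)"
    using \<open>S > 0\<close> by simp
  also have "\<dots> \<le> 2"
    using s1 s2 by (simp add: distrib_left)
  finally have "S * \<bar>cos \<theta>\<^sub>1\<bar> \<le> 2 / sin15 1"
    using sin_pos by (simp add: pos_le_divide_eq mult.assoc)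
  moreover have "1 \<le> \<bar>cos \<theta>\<^sub>1\<bar> + \<bar>sin \<theta>\<^sub>1\<bar>"
  proof -
    have "1 = (cos \<theta>\<^sub>1)\<^sup>2 + (sin \<theta>\<^sub>1)\<^sup>2"
      by simp
    also have "\<dots> \<le> \<bar>cos \<theta>\<^sub>1\<bar> * 1 + \<bar>sin \<theta>\<^sub>1\<bar> * 1"
      unfolding power2_eq_square abs_mult_self_eq[symmetric, of "cos \<theta>\<^sub>1"] abs_mult_self_eq[symmetric, of "sin \<theta>\<^sub>1"]
      by (intro add_mono mult_left_mono) simp_all
    finally show ?thesis by simp
  qed
  then have "S * 1 \<le> S * (\<bar>cos \<theta>\<^sub>1\<bar> + \<bar>sin \<theta>\<^sub>1\<bar>)"
    using \<open>S > 0\<close> by (intro mult_left_mono) simp_all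
  ultimately have "S \<le> 1 + 2 / sin15 1"
    using s1 by (simp add: distrib_left)
  then show ?thesis
    by (simp add: S_def field_simps)
qed

theorem theorem8p2:
  shows "rupert ruperthedron \<and> nieuwland_number ruperthedron \<ge> 1.003 \<and>
    \<not> (\<exists>\<theta>\<^sub>1 \<phi>\<^sub>1 \<theta>\<^sub>2 \<phi>\<^sub>2 \<alpha> :: real.
         \<bar>\<theta>\<^sub>1 - \<theta>\<^sub>2\<bar> \<le> 0.0006 \<and> \<bar>\<phi>\<^sub>1 - \<phi>\<^sub>2\<bar> \<le> 0.0006 \<and> \<bar>\<alpha>\<bar> \<le> 0.0006 \<and>
         rupert_cond 1 ruperthedron \<theta>\<^sub>1 \<phi>\<^sub>1 \<theta>\<^sub>2 \<phi>\<^sub>2 \<alpha>) \<and>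
    \<not> locally_rupert ruperthedron"
proof (intro conjI)
  obtain \<theta>\<^sub>1 \<phi>\<^sub>1 \<theta>\<^sub>2 \<phi>\<^sub>2 \<alpha> where range: "in_param_range \<theta>\<^sub>1 \<phi>\<^sub>1 \<theta>\<^sub>2 \<phi>\<^sub>2 \<alpha>"
    and cond: "rupert_cond 1.003 ruperthedron \<theta>\<^sub>1 \<phi>\<^sub>1 \<theta>\<^sub>2 \<phi>\<^sub>2 \<alpha>"
    by (rule rupert_cond_scaled)
  have "rupert_cond 1 ruperthedron \<theta>\<^sub>1 \<phi>\<^sub>1 \<theta>\<^sub>2 \<phi>\<^sub>2 \<alpha>"
    using cond by (rule rupert_cond_shrink) simp
  with range show "rupert ruperthedron"
    unfolding rupert_def rupert_solution_def by blast
  show "nieuwland_number ruperthedron \<ge> 1.003"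
    unfolding nieuwland_number_def
  proof (rule cSup_upper)
    show "1.003 \<in> {s. s > 0 \<and> (\<exists>\<theta>\<^sub>1 \<phi>\<^sub>1 \<theta>\<^sub>2 \<phi>\<^sub>2 \<alpha>.
        in_param_range \<theta>\<^sub>1 \<phi>\<^sub>1 \<theta>\<^sub>2 \<phi>\<^sub>2 \<alpha> \<and> rupert_cond s ruperthedron \<theta>\<^sub>1 \<phi>\<^sub>1 \<theta>\<^sub>2 \<phi>\<^sub>2 \<alpha>)}"
      using range cond by (intro CollectI conjI exI) simp_all
    show "bdd_above {s. s > 0 \<and> (\<exists>\<theta>\<^sub>1 \<phi>\<^sub>1 \<theta>\<^sub>2 \<phi>\<^sub>2 \<alpha>.
        in_param_range \<theta>\<^sub>1 \<phi>\<^sub>1 \<theta>\<^sub>2 \<phi>\<^sub>2 \<alpha> \<and> rupert_cond s ruperthedron \<theta>\<^sub>1 \<phi>\<^sub>1 \<theta>\<^sub>2 \<phi>\<^sub>2 \<alpha>)}"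
      using rupert_cond_bounded by (intro bdd_aboveI) blast
  qed
next
  have none: "\<not> rupert_cond 1 ruperthedron \<theta>\<^sub>1 \<phi>\<^sub>1 \<theta>\<^sub>2 \<phi>\<^sub>2 \<alpha>"
    if "\<bar>\<theta>\<^sub>1 - \<theta>\<^sub>2\<bar> \<le> 0.0006" "\<bar>\<phi>\<^sub>1 - \<phi>\<^sub>2\<bar> \<le> 0.0006" "\<bar>\<alpha>\<bar> \<le> 0.0006" for \<theta>\<^sub>1 \<phi>\<^sub>1 \<theta>\<^sub>2 \<phi>\<^sub>2 \<alpha>
  proof (rule no_nearby_solution[OF blocked_direction that])
    show "view_dir \<theta>\<^sub>2 \<phi>\<^sub>2 \<noteq> 0"
      using norm_view_dir[of \<theta>\<^sub>2 \<phi>\<^sub>2] by fastforce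
  qed
  then show "\<not> (\<exists>\<theta>\<^sub>1 \<phi>\<^sub>1 \<theta>\<^sub>2 \<phi>\<^sub>2 \<alpha> :: real.
      \<bar>\<theta>\<^sub>1 - \<theta>\<^sub>2\<bar> \<le> 0.0006 \<and> \<bar>\<phi>\<^sub>1 - \<phi>\<^sub>2\<bar> \<le> 0.0006 \<and> \<bar>\<alpha>\<bar> \<le> 0.0006 \<and>
      rupert_cond 1 ruperthedron \<theta>\<^sub>1 \<phi>\<^sub>1 \<theta>\<^sub>2 \<phi>\<^sub>2 \<alpha>)"
    by blast
  show "\<not> locally_rupert ruperthedron"
  proof
    assume "locally_rupert ruperthedron"
    moreover have "(0 :: real) < 0.0006"
      by simp
    ultimately show False
      unfolding locally_rupert_def rupert_solution_def using none by blast
  qed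
qed

end
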